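(* Let $p$ be an odd prime and let $r\in\mathbb{Z}_p^\times$, $r\neq 1$, be a root of unity, of order $\mathrm{ord}(r)$. Let $\mathcal{G}_p$ be the group of all $p$-adic roots of unity, $G_r$ its subgroup generated by $r$, and let $\gamma:\mathcal{G}_p/G_r\to\mathcal{G}_p$ be a section of the quotient map $\mathcal{G}_p\to\mathcal{G}_p/G_r$. (1) The following assignments define a faithful representation $$\pi':A_r'\to B\big(\ell^2(\mathbb{Z}/\mathrm{ord}(r)\mathbb{Z}\times\mathbb{Z}_{\geq 0}\times\mathcal{G}_p/G_r\times\mathbb{Z})\big):$$ $V_r\mapsto v_r'$, where $v_r'\phi(k,L,\omega G_r,x)=\phi(k-1\bmod \mathrm{ord}(r),L,\omega G_r,x)$, and $M_f\mapsto M_f'$, where $M_f'\phi(k,L,\omega G_r,x)=f\big(r^kp^L\cdot\gamma(\omega G_r)(1+px)\big)\phi(k,L,\omega G_r,x)$. (2) The following assignments define a faithful representation $$\pi:A_r\to B\big(\ell^2(\mathbb{Z}\times\mathbb{Z}_{\geq 0}\times\mathcal{G}_p/G_r\times\mathbb{Z})\big):$$ $V_r\mapsto v_r$, where $v_r\phi(k,L,\omega G_r,x)=\phi(k-1,L,\omega G_r,x)$, and $M_f\mapsto\mathcal{M}_f$, where $\mathcal{M}_f\phi(k,L,\omega G_r,x)=f\big(r^kp^L\cdot\gamma(\omega G_r)(1+px)\big)\phi(k,L,\omega G_r,x)$.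
   Context: $\mathbb{Z}_p$ is the ring of $p$-adic integers and $\mathbb{Z}_p^\times$ its group of units. For $r\in\mathbb{Z}_p^\times$, let $(\alpha_rf)(x)=f(x/r)$ for $f\in C(\mathbb{Z}_p)$. The algebra $A_r=C(\mathbb{Z}_p)\rtimes_{\alpha_r}\mathbb{N}\cong C(\mathbb{Z}_p)\rtimes_{\alpha_r}\mathbb{Z}$ is the universal unital C$^*$-algebra generated by a (unital) copy $\{M_f:f\in C(\mathbb{Z}_p)\}$ of $C(\mathbb{Z}_p)$ and an element $V_r$ satisfying $V_r^*V_r=I$ and $V_rM_fV_r^*=M_{\alpha_r(f)}$. When $r$ is a root of unity, $\mathrm{ord}(r)$ is the smallest positive integer $n$ with $r^n=1$, and $A_r'=C(\mathbb{Z}_p)\rtimes_{\alpha_r}\mathbb{Z}/\mathrm{ord}(r)\mathbb{Z}$ is the crossed product by the induced action of the finite cyclic group, i.e. generated by $\{M_f\}$ and a unitary $V_r$ with $V_r^{\mathrm{ord}(r)}=I$ and $V_rM_fV_r^*=M_{\alpha_r(f)}$. *)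

theory Defs
  imports "HOL-Analysis.Analysis" "HOL-Computational_Algebra.Primes"
    "HOL-Algebra.Generated_Groups" "HOL-Algebra.Module"
begin

section \<open>The \<open>p\<close>-adic integers\<close>

text \<open>The inverse limit of the rings of integers modulo \<open>p ^ n\<close>: a \<open>p\<close>-adic integer is
  the sequence of its reduced residues. As a subset of the product space \<open>nat \<Rightarrow> int\<close>
  (\<open>int\<close> discrete), the carrier has the \<open>p\<close>-adic topology as its subspace topology, so
  that \<open>continuous_on\<close> has its intended meaning on it.\<close>

definition Zp :: "nat \<Rightarrow> (nat \<Rightarrow> int) ring" where
  "Zp p = \<lparr>carrier = {a. \<forall>n. 0 \<le> a n \<and> a n < int p ^ n \<and> a (Suc n) mod int p ^ n = a n},
           Group.monoid.mult = (\<lambda>a b n. (a n * b n) mod int p ^ n),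
           one = (\<lambda>n. 1 mod int p ^ n),
           zero = (\<lambda>n. 0),
           add = (\<lambda>a b n. (a n + b n) mod int p ^ n)\<rparr>"

definition Zp_of_int :: "nat \<Rightarrow> int \<Rightarrow> (nat \<Rightarrow> int)" where
  "Zp_of_int p x = (\<lambda>n. x mod int p ^ n)"

text \<open>Roots of unity in the field of \<open>p\<close>-adic numbers are integral units, so the following is the
  group of all \<open>p\<close>-adic roots of unity.\<close>

definition roots_Zp :: "nat \<Rightarrow> (nat \<Rightarrow> int) monoid" where
  "roots_Zp p = (units_of (Zp p))
     \<lparr>carrier := {u \<in> Units (Zp p). \<exists>n::nat. 0 < n \<and> u [^]\<^bsub>Zp p\<^esub> n = \<one>\<^bsub>Zp p\<^esub>}\<rparr>"

definition root_ord :: "nat \<Rightarrow> (nat \<Rightarrow> int) \<Rightarrow> nat" where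
  "root_ord p r = (LEAST n. 0 < n \<and> r [^]\<^bsub>Zp p\<^esub> n = \<one>\<^bsub>Zp p\<^esub>)"

definition roots_quotient :: "nat \<Rightarrow> (nat \<Rightarrow> int) \<Rightarrow> (nat \<Rightarrow> int) set monoid" where
  "roots_quotient p r = roots_Zp p Mod generate (roots_Zp p) {r}"

definition is_section :: "nat \<Rightarrow> (nat \<Rightarrow> int) \<Rightarrow> ((nat \<Rightarrow> int) set \<Rightarrow> (nat \<Rightarrow> int)) \<Rightarrow> bool" where
  "is_section p r \<gamma> \<longleftrightarrow>
     \<gamma> \<in> carrier (roots_quotient p r) \<rightarrow> carrier (roots_Zp p) \<and>
     (\<forall>c \<in> carrier (roots_quotient p r). generate (roots_Zp p) {r} #>\<^bsub>roots_Zp p\<^esub> \<gamma> c = c)"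


section \<open>Unital C*-algebras\<close>

definition complex_ring :: "complex ring" where
  "complex_ring = \<lparr>carrier = UNIV, Group.monoid.mult = (*), one = 1, zero = 0, add = (+)\<rparr>"

record 'a cstar = "(complex, 'a) module" +
  adj :: "'a \<Rightarrow> 'a"
  cnorm :: "'a \<Rightarrow> real"

definition cstar_limit :: "'a cstar \<Rightarrow> (nat \<Rightarrow> 'a) \<Rightarrow> 'a \<Rightarrow> bool" where
  "cstar_limit A s l \<longleftrightarrow> (\<lambda>n. cnorm A (s n \<ominus>\<^bsub>A\<^esub> l)) \<longlonglongrightarrow> 0"

text \<open>The zero algebra is allowed.\<close>

locale cstar_algebra =
  fixes A :: "'a cstar" (structure)
  assumes ring: "ring A"
    and complex_module: "Module.module complex_ring A"
    and smult_mult_left: "\<lbrakk>x \<in> carrier A; y \<in> carrier A\<rbrakk> \<Longrightarrow> (c \<odot> x) \<otimes> y = c \<odot> (x \<otimes> y)"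
    and smult_mult_right: "\<lbrakk>x \<in> carrier A; y \<in> carrier A\<rbrakk> \<Longrightarrow> x \<otimes> (c \<odot> y) = c \<odot> (x \<otimes> y)"
    and adj_closed: "x \<in> carrier A \<Longrightarrow> adj A x \<in> carrier A"
    and adj_adj: "x \<in> carrier A \<Longrightarrow> adj A (adj A x) = x"
    and adj_add: "\<lbrakk>x \<in> carrier A; y \<in> carrier A\<rbrakk> \<Longrightarrow> adj A (x \<oplus> y) = adj A x \<oplus> adj A y"
    and adj_smult: "x \<in> carrier A \<Longrightarrow> adj A (c \<odot> x) = cnj c \<odot> adj A x"
    and adj_mult: "\<lbrakk>x \<in> carrier A; y \<in> carrier A\<rbrakk> \<Longrightarrow> adj A (x \<otimes> y) = adj A y \<otimes> adj A x"
    and norm_nonneg: "x \<in> carrier A \<Longrightarrow> 0 \<le> cnorm A x"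
    and norm_eq_0: "x \<in> carrier A \<Longrightarrow> cnorm A x = 0 \<longleftrightarrow> x = \<zero>"
    and norm_add: "\<lbrakk>x \<in> carrier A; y \<in> carrier A\<rbrakk> \<Longrightarrow> cnorm A (x \<oplus> y) \<le> cnorm A x + cnorm A y"
    and norm_smult: "x \<in> carrier A \<Longrightarrow> cnorm A (c \<odot> x) = cmod c * cnorm A x"
    and norm_mult: "\<lbrakk>x \<in> carrier A; y \<in> carrier A\<rbrakk> \<Longrightarrow> cnorm A (x \<otimes> y) \<le> cnorm A x * cnorm A y"
    and cstar_identity: "x \<in> carrier A \<Longrightarrow> cnorm A (adj A x \<otimes> x) = (cnorm A x)\<^sup>2"
    and complete: "\<lbrakk>\<And>n. s n \<in> carrier A;
        \<And>e. 0 < e \<Longrightarrow> \<exists>N. \<forall>m\<ge>N. \<forall>n\<ge>N. cnorm A (s m \<ominus> s n) < e\<rbrakk>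
        \<Longrightarrow> \<exists>l \<in> carrier A. cstar_limit A s l"

text \<open>Unital *-homomorphisms; \<open>ring_hom\<close> includes preservation of the unit.\<close>

definition star_hom :: "'a cstar \<Rightarrow> 'b cstar \<Rightarrow> ('a \<Rightarrow> 'b) \<Rightarrow> bool" where
  "star_hom A B h \<longleftrightarrow> h \<in> ring_hom A B \<and>
     (\<forall>x \<in> carrier A. \<forall>c. h (c \<odot>\<^bsub>A\<^esub> x) = c \<odot>\<^bsub>B\<^esub> h x) \<and>
     (\<forall>x \<in> carrier A. h (adj A x) = adj B (h x))"

definition cstar_subalgebra :: "'a set \<Rightarrow> 'a cstar \<Rightarrow> bool" where
  "cstar_subalgebra S A \<longleftrightarrow> S \<subseteq> carrier A \<and> \<one>\<^bsub>A\<^esub> \<in> S \<and>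
     (\<forall>x \<in> S. \<forall>y \<in> S. x \<oplus>\<^bsub>A\<^esub> y \<in> S \<and> x \<otimes>\<^bsub>A\<^esub> y \<in> S) \<and>
     (\<forall>x \<in> S. \<forall>c. c \<odot>\<^bsub>A\<^esub> x \<in> S) \<and>
     (\<forall>x \<in> S. adj A x \<in> S) \<and>
     (\<forall>s. \<forall>l \<in> carrier A. (\<forall>n. s n \<in> S) \<and> cstar_limit A s l \<longrightarrow> l \<in> S)"

definition cstar_generated :: "'a cstar \<Rightarrow> 'a set \<Rightarrow> bool" where
  "cstar_generated A G \<longleftrightarrow> (\<forall>S. cstar_subalgebra S A \<and> G \<subseteq> S \<longrightarrow> S = carrier A)"

definition CZp :: "nat \<Rightarrow> ((nat \<Rightarrow> int) \<Rightarrow> complex) cstar" where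
  "CZp p = \<lparr>carrier = {f \<in> extensional (carrier (Zp p)). continuous_on (carrier (Zp p)) f},
            Group.monoid.mult = (\<lambda>f g. \<lambda>x\<in>carrier (Zp p). f x * g x),
            one = (\<lambda>x\<in>carrier (Zp p). 1),
            zero = (\<lambda>x\<in>carrier (Zp p). 0),
            add = (\<lambda>f g. \<lambda>x\<in>carrier (Zp p). f x + g x),
            smult = (\<lambda>c f. \<lambda>x\<in>carrier (Zp p). c * f x),
            adj = (\<lambda>f. \<lambda>x\<in>carrier (Zp p). cnj (f x)),
            cnorm = (\<lambda>f. SUP x\<in>carrier (Zp p). cmod (f x))\<rparr>"

definition alpha :: "nat \<Rightarrow> (nat \<Rightarrow> int) \<Rightarrow> ((nat \<Rightarrow> int) \<Rightarrow> complex) \<Rightarrow> (nat \<Rightarrow> int) \<Rightarrow> complex" where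
  "alpha p r f = (\<lambda>x\<in>carrier (Zp p). f (x \<otimes>\<^bsub>Zp p\<^esub> inv\<^bsub>Zp p\<^esub> r))"


section \<open>The crossed products as universal C*-algebras\<close>

definition N_relations ::
  "nat \<Rightarrow> (nat \<Rightarrow> int) \<Rightarrow> 'a cstar \<Rightarrow> (((nat \<Rightarrow> int) \<Rightarrow> complex) \<Rightarrow> 'a) \<Rightarrow> 'a \<Rightarrow> bool" where
  "N_relations p r A M V \<longleftrightarrow> star_hom (CZp p) A M \<and> V \<in> carrier A \<and>
     adj A V \<otimes>\<^bsub>A\<^esub> V = \<one>\<^bsub>A\<^esub> \<and>
     (\<forall>f \<in> carrier (CZp p). V \<otimes>\<^bsub>A\<^esub> M f \<otimes>\<^bsub>A\<^esub> adj A V = M (alpha p r f))"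

definition cyclic_relations ::
  "nat \<Rightarrow> (nat \<Rightarrow> int) \<Rightarrow> 'a cstar \<Rightarrow> (((nat \<Rightarrow> int) \<Rightarrow> complex) \<Rightarrow> 'a) \<Rightarrow> 'a \<Rightarrow> bool" where
  "cyclic_relations p r A M V \<longleftrightarrow> star_hom (CZp p) A M \<and> V \<in> carrier A \<and>
     adj A V \<otimes>\<^bsub>A\<^esub> V = \<one>\<^bsub>A\<^esub> \<and> V \<otimes>\<^bsub>A\<^esub> adj A V = \<one>\<^bsub>A\<^esub> \<and>
     V [^]\<^bsub>A\<^esub> root_ord p r = \<one>\<^bsub>A\<^esub> \<and>
     (\<forall>f \<in> carrier (CZp p). V \<otimes>\<^bsub>A\<^esub> M f \<otimes>\<^bsub>A\<^esub> adj A V = M (alpha p r f))"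

text \<open>\<open>A\<close> is the universal unital C*-algebra generated by a copy \<open>M\<close> of the continuous functions
  and an element \<open>V\<close> subject to the relations \<open>R\<close>. The universal property quantifies over the
  C*-algebras \<open>B\<close> on the same type \<open>'a\<close>, since HOL does not quantify over types. Nothing is lost:
  injectivity of \<open>M\<close> gives \<open>'a\<close> at least the cardinality of the continuum, while a pair \<open>(N, W)\<close> in
  an arbitrary C*-algebra generates a separable C*-subalgebra, which has at most that cardinality
  and so has a copy on \<open>'a\<close>. The homomorphism \<open>h\<close> is unique on the carrier because \<open>A\<close> is
  generated by \<open>M\<close> and \<open>V\<close>.\<close>

definition universal_cstar ::
  "nat \<Rightarrow> ('a cstar \<Rightarrow> (((nat \<Rightarrow> int) \<Rightarrow> complex) \<Rightarrow> 'a) \<Rightarrow> 'a \<Rightarrow> bool) \<Rightarrow>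
   'a cstar \<Rightarrow> (((nat \<Rightarrow> int) \<Rightarrow> complex) \<Rightarrow> 'a) \<Rightarrow> 'a \<Rightarrow> bool" where
  "universal_cstar p R A M V \<longleftrightarrow>
     cstar_algebra A \<and> R A M V \<and> inj_on M (carrier (CZp p)) \<and>
     cstar_generated A (insert V (M ` carrier (CZp p))) \<and>
     (\<forall>B N W. cstar_algebra B \<and> R B N W \<longrightarrow>
        (\<exists>h. star_hom A B h \<and> (\<forall>f \<in> carrier (CZp p). h (M f) = N f) \<and> h V = W))"

definition is_crossed_product_N ::
  "nat \<Rightarrow> (nat \<Rightarrow> int) \<Rightarrow> 'a cstar \<Rightarrow> (((nat \<Rightarrow> int) \<Rightarrow> complex) \<Rightarrow> 'a) \<Rightarrow> 'a \<Rightarrow> bool" where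
  "is_crossed_product_N p r A M V \<longleftrightarrow> universal_cstar p (N_relations p r) A M V"

definition is_crossed_product_cyclic ::
  "nat \<Rightarrow> (nat \<Rightarrow> int) \<Rightarrow> 'a cstar \<Rightarrow> (((nat \<Rightarrow> int) \<Rightarrow> complex) \<Rightarrow> 'a) \<Rightarrow> 'a \<Rightarrow> bool" where
  "is_crossed_product_cyclic p r A M V \<longleftrightarrow> universal_cstar p (cyclic_relations p r) A M V"


section \<open>Bounded operators on \<open>\<ell>\<^sup>2(I)\<close>\<close>

definition ell2 :: "'i set \<Rightarrow> ('i \<Rightarrow> complex) set" where
  "ell2 I = {\<phi>. (\<forall>i. i \<notin> I \<longrightarrow> \<phi> i = 0) \<and> (\<lambda>i. (cmod (\<phi> i))\<^sup>2) summable_on I}"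

definition ell2_norm :: "'i set \<Rightarrow> ('i \<Rightarrow> complex) \<Rightarrow> real" where
  "ell2_norm I \<phi> = sqrt (\<Sum>\<^sub>\<infinity>i\<in>I. (cmod (\<phi> i))\<^sup>2)"

definition ell2_inner :: "'i set \<Rightarrow> ('i \<Rightarrow> complex) \<Rightarrow> ('i \<Rightarrow> complex) \<Rightarrow> complex" where
  "ell2_inner I \<phi> \<psi> = (\<Sum>\<^sub>\<infinity>i\<in>I. \<phi> i * cnj (\<psi> i))"

definition bounded_op :: "'i set \<Rightarrow> (('i \<Rightarrow> complex) \<Rightarrow> ('i \<Rightarrow> complex)) \<Rightarrow> bool" where
  "bounded_op I T \<longleftrightarrow> T \<in> ell2 I \<rightarrow>\<^sub>E ell2 I \<and>
     (\<forall>\<phi> \<in> ell2 I. \<forall>\<psi> \<in> ell2 I. T (\<lambda>i. \<phi> i + \<psi> i) = (\<lambda>i. T \<phi> i + T \<psi> i)) \<and>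
     (\<forall>\<phi> \<in> ell2 I. \<forall>c. T (\<lambda>i. c * \<phi> i) = (\<lambda>i. c * T \<phi> i)) \<and>
     (\<exists>K. \<forall>\<phi> \<in> ell2 I. ell2_norm I (T \<phi>) \<le> K * ell2_norm I \<phi>)"

definition op_adjoint ::
  "'i set \<Rightarrow> (('i \<Rightarrow> complex) \<Rightarrow> ('i \<Rightarrow> complex)) \<Rightarrow> ('i \<Rightarrow> complex) \<Rightarrow> ('i \<Rightarrow> complex)" where
  "op_adjoint I T = (THE S. bounded_op I S \<and>
     (\<forall>\<phi> \<in> ell2 I. \<forall>\<psi> \<in> ell2 I. ell2_inner I (T \<phi>) \<psi> = ell2_inner I \<phi> (S \<psi>)))"

definition bounded_ops :: "'i set \<Rightarrow> (('i \<Rightarrow> complex) \<Rightarrow> ('i \<Rightarrow> complex)) cstar" where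
  "bounded_ops I = \<lparr>carrier = {T. bounded_op I T},
     Group.monoid.mult = (\<lambda>S T. \<lambda>\<phi>\<in>ell2 I. S (T \<phi>)),
     one = (\<lambda>\<phi>\<in>ell2 I. \<phi>),
     zero = (\<lambda>\<phi>\<in>ell2 I. (\<lambda>i. 0)),
     add = (\<lambda>S T. \<lambda>\<phi>\<in>ell2 I. (\<lambda>i. S \<phi> i + T \<phi> i)),
     smult = (\<lambda>c T. \<lambda>\<phi>\<in>ell2 I. (\<lambda>i. c * T \<phi> i)),
     adj = op_adjoint I,
     cnorm = (\<lambda>T. SUP \<phi>\<in>{\<phi> \<in> ell2 I. ell2_norm I \<phi> \<le> 1}. ell2_norm I (T \<phi>))\<rparr>"

definition pullback_op ::
  "'i set \<Rightarrow> ('i \<Rightarrow> 'i) \<Rightarrow> ('i \<Rightarrow> complex) \<Rightarrow> ('i \<Rightarrow> complex)" where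
  "pullback_op I s = (\<lambda>\<phi>\<in>ell2 I. (\<lambda>i. if i \<in> I then \<phi> (s i) else 0))"

definition mult_op ::
  "'i set \<Rightarrow> ('i \<Rightarrow> complex) \<Rightarrow> ('i \<Rightarrow> complex) \<Rightarrow> ('i \<Rightarrow> complex)" where
  "mult_op I g = (\<lambda>\<phi>\<in>ell2 I. (\<lambda>i. if i \<in> I then g i * \<phi> i else 0))"

text \<open>The assignments \<open>V \<mapsto> v\<close>, \<open>M f \<mapsto> m f\<close> extend to exactly one unital *-representation of \<open>A\<close>
  on \<open>\<ell>\<^sup>2(I)\<close>, and this representation is faithful.\<close>

definition defines_faithful_rep ::
  "nat \<Rightarrow> 'a cstar \<Rightarrow> (((nat \<Rightarrow> int) \<Rightarrow> complex) \<Rightarrow> 'a) \<Rightarrow> 'a \<Rightarrow> 'i set \<Rightarrow>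
   (((nat \<Rightarrow> int) \<Rightarrow> complex) \<Rightarrow> ('i \<Rightarrow> complex) \<Rightarrow> ('i \<Rightarrow> complex)) \<Rightarrow>
   (('i \<Rightarrow> complex) \<Rightarrow> ('i \<Rightarrow> complex)) \<Rightarrow> bool" where
  "defines_faithful_rep p A M V I m v \<longleftrightarrow>
     (\<exists>\<pi>. star_hom A (bounded_ops I) \<pi> \<and> \<pi> V = v \<and> (\<forall>f \<in> carrier (CZp p). \<pi> (M f) = m f) \<and>
        inj_on \<pi> (carrier A) \<and>
        (\<forall>\<rho>. star_hom A (bounded_ops I) \<rho> \<and> \<rho> V = v \<and>
              (\<forall>f \<in> carrier (CZp p). \<rho> (M f) = m f) \<longrightarrow>
              (\<forall>a \<in> carrier A. \<rho> a = \<pi> a)))"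


section \<open>The index sets and the sample points\<close>

text \<open>The residues modulo \<open>ord r\<close> are represented by \<open>0, \<dots>, ord r - 1\<close>.\<close>

definition cyclic_index ::
  "nat \<Rightarrow> (nat \<Rightarrow> int) \<Rightarrow> (int \<times> nat \<times> (nat \<Rightarrow> int) set \<times> int) set" where
  "cyclic_index p r = {0..<int (root_ord p r)} \<times> UNIV \<times> carrier (roots_quotient p r) \<times> UNIV"

definition N_index ::
  "nat \<Rightarrow> (nat \<Rightarrow> int) \<Rightarrow> (int \<times> nat \<times> (nat \<Rightarrow> int) set \<times> int) set" where
  "N_index p r = UNIV \<times> UNIV \<times> carrier (roots_quotient p r) \<times> UNIV"

definition sample_point ::
  "nat \<Rightarrow> (nat \<Rightarrow> int) \<Rightarrow> ((nat \<Rightarrow> int) set \<Rightarrow> (nat \<Rightarrow> int)) \<Rightarrow>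
   int \<Rightarrow> nat \<Rightarrow> (nat \<Rightarrow> int) set \<Rightarrow> int \<Rightarrow> (nat \<Rightarrow> int)" where
  "sample_point p r \<gamma> k L c x =
     r [^]\<^bsub>units_of (Zp p)\<^esub> k \<otimes>\<^bsub>Zp p\<^esub> Zp_of_int p (int p ^ L) \<otimes>\<^bsub>Zp p\<^esub>
     (\<gamma> c \<otimes>\<^bsub>Zp p\<^esub> Zp_of_int p (1 + int p * x))"

end

theory Submission
  imports Defs "HOL-Number_Theory.Residues"
begin

text \<open>Both algebras are generated by monomials \<open>M f \<otimes> V\<^sup>k\<close>, and a matrix coefficient of the image
  of a polynomial \<open>\<Sum> M f\<^sub>k \<otimes> V\<^sup>k\<close> recovers the value of a single \<open>f\<^sub>k\<close> at a sample point. The sample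
  points are dense in \<open>\<int>\<^sub>p\<close> because every unit residue has a Teichmueller representative, so the norm
  of each \<open>f\<^sub>k\<close> is bounded by the norm of the image of the polynomial. For the finite cyclic group
  this already bounds the polynomial by its image. For \<open>\<int>\<close> one first applies a Fejer mean of the gauge
  action \<open>V \<mapsto> \<lambda>V\<close>, given by the universal property: it is contractive, is close to the identity on
  a given polynomial, and leaves a number of monomials that does not depend on the approximation.

  The universal property only speaks of algebras on one fixed type. The representation exists because
  the index set is countable, so that the bounded operators inject into the complex numbers, and these
  into the crossed product as constant functions.\<close>

section \<open>C*-algebras\<close>

text \<open>Everything rests on the contractivity of unital star homomorphisms, and this is derived
  from the C*-identity and completeness alone: no spectrum or functional calculus is set up, and the
  one square root that is needed comes from Banach's fixed point iteration. The obstacle in the case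
  of \<int> is that a polynomial within \<open>d\<close> of an element of the kernel has
  coefficients of norm below \<open>d\<close>, but the number of its monomials may grow as
  \<open>d\<close> shrinks, so that these bounds cannot simply be added up. Two approximations are
  therefore used: a coarse one fixes the order \<open>R\<close> of the Fejer mean, and only then is
  a polynomial within \<open>e / (2 * R + 1)\<close> chosen, of which at most
  \<open>2 * R + 1\<close> monomials survive the mean. The mean is a finite sum over the
  \<open>Q\<close>-th roots of unity instead of an integral over the circle, with \<open>Q\<close>
  so large that no aliasing occurs. Hence neither integration in the algebra nor continuity of the
  gauge action enters.\<close>

lemma real_null_sequence_comparison:
  fixes f g :: "nat \<Rightarrow> real"
  assumes "\<And>n. 0 \<le> f n" "\<And>n. f n \<le> g n" "g \<longlonglongrightarrow> 0"
  shows "f \<longlonglongrightarrow> 0"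
  by (rule tendsto_sandwich[OF _ _ tendsto_const assms(3)]) (auto simp: assms(1,2))

sublocale cstar_algebra \<subseteq> ring A
  by (rule ring)

sublocale cstar_algebra \<subseteq> mod: Module.module complex_ring A
  by (rule complex_module)

context cstar_algebra
begin

lemma smult_closed [simp, intro]: "x \<in> carrier A \<Longrightarrow> c \<odot> x \<in> carrier A"
  using mod.smult_closed[of c x] by (simp add: complex_ring_def)

lemma smult_add_left: "x \<in> carrier A \<Longrightarrow> (a + b) \<odot> x = a \<odot> x \<oplus> b \<odot> x"
  using mod.smult_l_distr[of a b x] by (simp add: complex_ring_def)

lemma smult_add_right:
  "\<lbrakk>x \<in> carrier A; y \<in> carrier A\<rbrakk> \<Longrightarrow> c \<odot> (x \<oplus> y) = c \<odot> x \<oplus> c \<odot> y"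
  using mod.smult_r_distr[of c x y] by (simp add: complex_ring_def)

lemma smult_assoc: "x \<in> carrier A \<Longrightarrow> (a * b) \<odot> x = a \<odot> (b \<odot> x)"
  using mod.smult_assoc1[of a b x] by (simp add: complex_ring_def)

lemma smult_one [simp]: "x \<in> carrier A \<Longrightarrow> 1 \<odot> x = x"
  using mod.smult_one[of x] by (simp add: complex_ring_def)

lemma smult_zero_left [simp]: "x \<in> carrier A \<Longrightarrow> 0 \<odot> x = \<zero>"
  using smult_add_left[of x 0 0] by (metis add.r_cancel_one' add_0 smult_closed)

lemma smult_zero_right [simp]: "c \<odot> \<zero> = \<zero>"
  using mod.smult_r_null[of c] by (simp add: complex_ring_def)

lemma smult_minus_one: "x \<in> carrier A \<Longrightarrow> (-1) \<odot> x = \<ominus> x"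
  using smult_add_left[of x "-1" 1] by (simp add: minus_equality)

lemma smult_two: "x \<in> carrier A \<Longrightarrow> 2 \<odot> x = x \<oplus> x"
  using smult_add_left[of x 1 1] by simp

declare adj_closed [simp, intro]

lemma adj_one [simp]: "adj A \<one> = \<one>"
  by (metis adj_adj adj_closed adj_mult one_closed r_one)

lemma adj_minus: "x \<in> carrier A \<Longrightarrow> adj A (\<ominus> x) = \<ominus> adj A x"
  using adj_smult[of x "-1"] by (simp add: smult_minus_one)

lemma adj_zero [simp]: "adj A \<zero> = \<zero>"
  using adj_smult[of \<zero> 0] by simp

lemma norm_zero [simp]: "cnorm A \<zero> = 0"
  using norm_eq_0 by simp

lemma norm_uminus [simp]: "x \<in> carrier A \<Longrightarrow> cnorm A (\<ominus> x) = cnorm A x"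
  using norm_smult[of x "-1"] by (simp add: smult_minus_one)

lemma norm_minus_commute:
  assumes "x \<in> carrier A" "y \<in> carrier A"
  shows "cnorm A (x \<ominus> y) = cnorm A (y \<ominus> x)"
proof -
  have "y \<ominus> x = \<ominus> (x \<ominus> y)"
    using assms by algebra
  then show ?thesis
    using assms by simp
qed

lemma norm_minus_triangle:
  assumes "x \<in> carrier A" "y \<in> carrier A" "z \<in> carrier A"
  shows "cnorm A (x \<ominus> z) \<le> cnorm A (x \<ominus> y) + cnorm A (y \<ominus> z)"
proof -
  have "x \<ominus> z = (x \<ominus> y) \<oplus> (y \<ominus> z)"
    using assms by algebra
  then show ?thesis
    using assms norm_add by simp
qed

lemma norm_le_minus:
  assumes "x \<in> carrier A" "y \<in> carrier A"
  shows "cnorm A x \<le> cnorm A (x \<ominus> y) + cnorm A y"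
  using norm_minus_triangle[of x y \<zero>] assms by (simp add: a_minus_def)

text \<open>By the C*-identity the square of the norm of \<open>z\<close> is at most the norm of
  \<open>adj A z\<close> times that of \<open>z\<close>; cancelling one factor, for \<open>x\<close>
  and for \<open>adj A x\<close>, gives both inequalities.\<close>

lemma norm_adj [simp]:
  assumes "x \<in> carrier A"
  shows "cnorm A (adj A x) = cnorm A x"
proof -
  have le: "cnorm A z \<le> cnorm A (adj A z)" if z: "z \<in> carrier A" for z
  proof (cases "cnorm A z = 0")
    case False
    have "(cnorm A z)\<^sup>2 \<le> cnorm A (adj A z) * cnorm A z"
      using cstar_identity[OF z] norm_mult[of "adj A z" z] z by simp
    then show ?thesis
      using False norm_nonneg[OF z] by (simp add: power2_eq_square)
  qed (use z norm_nonneg in simp)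
  show ?thesis
    using le[of x] le[of "adj A x"] assms adj_adj by simp
qed

text \<open>Only an inequality, because in the zero algebra, which is allowed, the unit has norm
  0.\<close>

lemma norm_one_le: "cnorm A \<one> \<le> 1"
proof -
  have "(cnorm A \<one>)\<^sup>2 = cnorm A \<one>"
    using cstar_identity[of \<one>] by simp
  then show ?thesis
    by (auto simp: power2_eq_square)
qed

text \<open>The source of contractivity: the relation \<open>adj A u \<otimes> u = \<one>\<close> is
  purely algebraic and so survives every star homomorphism.\<close>

lemma norm_unitary_le:
  assumes "u \<in> carrier A" "adj A u \<otimes> u = \<one>"
  shows "cnorm A u \<le> 1"
  using cstar_identity[of u] assms norm_one_le norm_nonneg[of u]
  by (metis abs_square_le_1 abs_of_nonneg)

lemma limit_unique:
  assumes "\<And>n. s n \<in> carrier A" "l \<in> carrier A" "l' \<in> carrier A"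
    and "cstar_limit A s l" "cstar_limit A s l'"
  shows "l = l'"
proof -
  have "(\<lambda>n. cnorm A (s n \<ominus> l) + cnorm A (s n \<ominus> l')) \<longlonglongrightarrow> 0 + 0"
    using assms(4,5) unfolding cstar_limit_def by (rule tendsto_add)
  moreover have "cnorm A (l \<ominus> l') \<le> cnorm A (s n \<ominus> l) + cnorm A (s n \<ominus> l')" for n
    using norm_minus_triangle[of l "s n" l'] norm_minus_commute[of l "s n"] assms by simp
  ultimately have "cnorm A (l \<ominus> l') \<le> 0"
    by (intro LIMSEQ_le_const[of _ _ "cnorm A (l \<ominus> l')"]) auto
  then have "l \<oplus> \<ominus> l' = \<zero>"
    using norm_eq_0[of "l \<ominus> l'"] norm_nonneg[of "l \<ominus> l'"] assms(2,3) by (simp add: a_minus_def)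
  then show ?thesis
    using assms(2,3) minus_equality[of l "\<ominus> l'"] by (simp add: minus_minus)
qed

text \<open>Only a Lipschitz estimate at the limit is asked of \<open>f\<close>. This covers the
  adjoint and the one-sided multiplications as well as the quadratic map \<open>g\<close> in
  \<open>complementary_square\<close>.\<close>

lemma limit_bounded_linear:
  assumes "\<And>n. s n \<in> carrier A" "l \<in> carrier A" "cstar_limit A s l"
    and "\<And>n. f (s n) \<in> carrier A" "f l \<in> carrier A"
    and "\<And>n. cnorm A (f (s n) \<ominus> f l) \<le> K * cnorm A (s n \<ominus> l)"
  shows "cstar_limit A (\<lambda>n. f (s n)) (f l)"
proof -
  have "(\<lambda>n. K * cnorm A (s n \<ominus> l)) \<longlonglongrightarrow> K * 0"
    using assms(3) unfolding cstar_limit_def by (intro tendsto_mult_left)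
  then have lim: "(\<lambda>n. K * cnorm A (s n \<ominus> l)) \<longlonglongrightarrow> 0"
    by simp
  show ?thesis
    unfolding cstar_limit_def
    by (rule real_null_sequence_comparison[OF norm_nonneg assms(6) lim]) (use assms(4,5) in simp)
qed

lemma limit_adj:
  assumes "\<And>n. s n \<in> carrier A" "l \<in> carrier A" "cstar_limit A s l"
  shows "cstar_limit A (\<lambda>n. adj A (s n)) (adj A l)"
proof (rule limit_bounded_linear[OF assms, where K=1])
  show "cnorm A (adj A (s n) \<ominus> adj A l) \<le> 1 * cnorm A (s n \<ominus> l)" for n
    using norm_adj[of "s n \<ominus> l"] assms(1)[of n] assms(2) by (simp add: a_minus_def adj_add adj_minus)
qed (use assms in auto)

lemma limit_mult_left:
  assumes "\<And>n. s n \<in> carrier A" "l \<in> carrier A" "cstar_limit A s l" "x \<in> carrier A"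
  shows "cstar_limit A (\<lambda>n. x \<otimes> s n) (x \<otimes> l)"
proof (rule limit_bounded_linear[OF assms(1-3), where K="cnorm A x"])
  have *: "x \<otimes> s n \<ominus> x \<otimes> l = x \<otimes> (s n \<ominus> l)" for n
    using assms(1)[of n] assms(2,4) by algebra
  show "cnorm A (x \<otimes> s n \<ominus> x \<otimes> l) \<le> cnorm A x * cnorm A (s n \<ominus> l)" for n
    using norm_mult[of x "s n \<ominus> l"] assms(1)[of n] assms(2,4) by (simp add: *)
qed (use assms in auto)

lemma limit_mult_right:
  assumes "\<And>n. s n \<in> carrier A" "l \<in> carrier A" "cstar_limit A s l" "x \<in> carrier A"
  shows "cstar_limit A (\<lambda>n. s n \<otimes> x) (l \<otimes> x)"
proof (rule limit_bounded_linear[OF assms(1-3), where K="cnorm A x"])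
  have *: "s n \<otimes> x \<ominus> l \<otimes> x = (s n \<ominus> l) \<otimes> x" for n
    using assms(1)[of n] assms(2,4) by algebra
  show "cnorm A (s n \<otimes> x \<ominus> l \<otimes> x) \<le> cnorm A x * cnorm A (s n \<ominus> l)" for n
    using norm_mult[of "s n \<ominus> l" x] assms(1)[of n] assms(2,4) by (simp add: * mult.commute)
qed (use assms in auto)

text \<open>The difference of squares is split so that no commutativity is used. On the ball of
  radius \<open>q\<close> squaring becomes Lipschitz with constant \<open>2 * q\<close>; the factor
  1/2 in the iteration below then leaves \<open>q\<close>.\<close>

lemma norm_square_diff:
  assumes "a \<in> carrier A" "b \<in> carrier A" "cnorm A a \<le> q" "cnorm A b \<le> q"
  shows "cnorm A (a \<otimes> a \<ominus> b \<otimes> b) \<le> 2 * q * cnorm A (a \<ominus> b)"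
proof -
  have "a \<otimes> a \<ominus> b \<otimes> b = a \<otimes> (a \<ominus> b) \<oplus> (a \<ominus> b) \<otimes> b"
    using assms(1,2) by algebra
  then have "cnorm A (a \<otimes> a \<ominus> b \<otimes> b)
      \<le> cnorm A a * cnorm A (a \<ominus> b) + cnorm A (a \<ominus> b) * cnorm A b"
    using assms(1,2) norm_add[of "a \<otimes> (a \<ominus> b)" "(a \<ominus> b) \<otimes> b"] norm_mult[of a "a \<ominus> b"]
      norm_mult[of "a \<ominus> b" b] by simp
  also have "\<dots> \<le> q * cnorm A (a \<ominus> b) + cnorm A (a \<ominus> b) * q"
    using assms by (intro add_mono mult_right_mono mult_left_mono) (auto intro: norm_nonneg)
  finally show ?thesis
    by (simp add: algebra_simps)
qed

lemma norm_smult_minus: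
  assumes "a \<in> carrier A" "b \<in> carrier A"
  shows "c \<odot> a \<ominus> c \<odot> b = c \<odot> (a \<ominus> b)"
  using assms smult_assoc[of b c "-1"] smult_assoc[of b "-1" c]
  by (simp add: a_minus_def smult_add_right flip: smult_minus_one)

text \<open>The square root of \<open>1 - x\<^sup>2\<close> is \<open>1 - s\<close> with \<open>s\<close> the fixed point of the contraction
  \<open>s \<mapsto> (x\<^sup>2 + s\<^sup>2) / 2\<close>.\<close>

lemma complementary_square:
  assumes x: "x \<in> carrier A" "adj A x = x" "cnorm A x < 1"
  shows "\<exists>y\<in>carrier A. adj A y = y \<and> x \<otimes> y = y \<otimes> x \<and> x \<otimes> x \<oplus> y \<otimes> y = \<one>"
proof -
  define t where "t = x \<otimes> x"
  \<comment> \<open>This \<open>q\<close> is both the radius of a ball preserved by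
    \<open>g\<close>, since (q + q^2) / 2 <= q, and the contraction constant on that ball.\<close>
  define q where "q = (cnorm A x)\<^sup>2"
  have t: "t \<in> carrier A" "adj A t = t" "x \<otimes> t = t \<otimes> x" "cnorm A t \<le> q"
    using x adj_mult norm_mult[of x x] by (auto simp: t_def q_def power2_eq_square m_assoc)
  have q: "0 \<le> q" "q < 1"
    using x norm_nonneg[of x] by (auto simp: q_def abs_square_less_1)
  define g where "g s = (1/2) \<odot> (t \<oplus> s \<otimes> s)" for s
  define s where "s n = (g ^^ n) \<zero>" for n
  have s_Suc: "s (Suc n) = g (s n)" for n
    by (simp add: s_def)
  have s: "s n \<in> carrier A \<and> adj A (s n) = s n \<and> x \<otimes> s n = s n \<otimes> x \<and> cnorm A (s n) \<le> q" for n
  proof (induction n)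
    case 0
    show ?case
      using x q by (simp add: s_def)
  next
    case (Suc n)
    let ?s = "s n"
    have "x \<otimes> (?s \<otimes> ?s) = (?s \<otimes> ?s) \<otimes> x"
      using Suc x by (metis m_assoc)
    then have "x \<otimes> g ?s = g ?s \<otimes> x"
      using Suc x t by (simp add: g_def smult_mult_left smult_mult_right r_distr l_distr)
    moreover have "adj A (g ?s) = g ?s"
      using Suc t by (simp add: g_def adj_smult adj_add adj_mult)
    moreover have "cnorm A (g ?s) \<le> q"
    proof -
      have "cnorm A (?s \<otimes> ?s) \<le> q * q"
        using Suc norm_mult[of ?s ?s] norm_nonneg[of ?s]
        by (meson mult_mono order_trans q(1))
      then have "cnorm A (t \<oplus> ?s \<otimes> ?s) \<le> q + q * 1"
        using Suc t norm_add[of t "?s \<otimes> ?s"] q mult_left_mono[of q 1 q] by simp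
      then show ?thesis
        using Suc t by (simp add: g_def norm_smult)
    qed
    ultimately show ?case
      using Suc t by (simp add: s_Suc g_def)
  qed
  then have sc [simp]: "s n \<in> carrier A" for n
    by blast
  have g_diff: "cnorm A (g a \<ominus> g b) \<le> q * cnorm A (a \<ominus> b)"
    if "a \<in> carrier A" "b \<in> carrier A" "cnorm A a \<le> q" "cnorm A b \<le> q" for a b
  proof -
    have "(t \<oplus> a \<otimes> a) \<ominus> (t \<oplus> b \<otimes> b) = a \<otimes> a \<ominus> b \<otimes> b"
      using t that by algebra
    then have "g a \<ominus> g b = (1/2) \<odot> (a \<otimes> a \<ominus> b \<otimes> b)"
      using that t by (simp add: g_def norm_smult_minus)
    then show ?thesis
      using norm_square_diff[of a b q] that by (simp add: norm_smult)
  qed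
  \<comment> \<open>Both iterates arise by \<open>m\<close> steps from the pair
    \<open>\<zero>\<close>, \<open>s k\<close>, whose distance is at most \<open>q \<le> 1\<close>.
    This gives the Cauchy property without summing a geometric series.\<close>
  have tail: "cnorm A (s m \<ominus> s (m + k)) \<le> q ^ m" for m k
  proof (induction m)
    case 0
    have "cnorm A (\<zero> \<ominus> s k) = cnorm A (s k)"
      by (simp add: a_minus_def)
    then show ?case
      using s[of k] q by (auto simp: s_def[of 0])
  next
    case (Suc m)
    have "cnorm A (s (Suc m) \<ominus> s (Suc m + k)) \<le> q * cnorm A (s m \<ominus> s (m + k))"
      using g_diff[of "s m" "s (m + k)"] s by (simp add: s_Suc)
    also have "\<dots> \<le> q * q ^ m"
      using Suc q by (intro mult_left_mono) auto
    finally show ?case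
      by simp
  qed
  have "\<exists>l\<in>carrier A. cstar_limit A s l"
  proof (rule complete)
    fix e :: real assume "0 < e"
    then obtain N where N: "q ^ N < e"
      using q real_arch_pow_inv by blast
    have *: "cnorm A (s m \<ominus> s n) < e" if "m \<ge> N" "m \<le> n" for m n
    proof -
      have "cnorm A (s m \<ominus> s n) \<le> q ^ m"
        using tail[of m "n - m"] that by simp
      also have "\<dots> \<le> q ^ N"
        using q that by (intro power_decreasing) auto
      finally show ?thesis
        using N by simp
    qed
    have "cnorm A (s m \<ominus> s n) < e" if "m \<ge> N" "n \<ge> N" for m n
      using *[of m n] *[of n m] norm_minus_commute[of "s m" "s n"] that by (cases "m \<le> n") auto
    then show "\<exists>N. \<forall>m\<ge>N. \<forall>n\<ge>N. cnorm A (s m \<ominus> s n) < e"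
      by blast
  qed simp
  then obtain l where l: "l \<in> carrier A" "cstar_limit A s l"
    by blast
  have "adj A l = l"
    using limit_unique[of s "adj A l" l] limit_adj[of s l] l s by simp
  have "x \<otimes> l = l \<otimes> x"
    using limit_unique[of "\<lambda>n. x \<otimes> s n" "x \<otimes> l" "l \<otimes> x"] limit_mult_left[of s l x]
      limit_mult_right[of s l x] l s x by simp
  have norm_l: "cnorm A l \<le> q"
  proof -
    have "(\<lambda>n. cnorm A (s n \<ominus> l) + q) \<longlonglongrightarrow> 0 + q"
      using l(2) unfolding cstar_limit_def by (intro tendsto_add) auto
    moreover have "cnorm A l \<le> cnorm A (s n \<ominus> l) + q" for n
      using norm_le_minus[of l "s n"] norm_minus_commute[of l "s n"] l s[of n] by simp
    ultimately show ?thesis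
      using LIMSEQ_le_const[of "\<lambda>n. cnorm A (s n \<ominus> l) + q" "0 + q" "cnorm A l"] by auto
  qed
  have gl: "g l \<in> carrier A"
    using l t by (simp add: g_def)
  have "cstar_limit A (\<lambda>n. g (s n)) (g l)"
    using limit_bounded_linear[of s l g q, OF sc l _ gl] g_diff[OF sc l(1)] norm_l s
    by (simp flip: s_Suc)
  then have "cstar_limit A (\<lambda>n. s (Suc n)) (g l)"
    by (simp add: s_Suc)
  moreover have "cstar_limit A (\<lambda>n. s (Suc n)) l"
    using l(2) unfolding cstar_limit_def by (rule LIMSEQ_Suc)
  ultimately have "g l = l"
    using limit_unique[of "\<lambda>n. s (Suc n)" "g l" l] l gl by simp
  then have "2 \<odot> l = t \<oplus> l \<otimes> l"
    using smult_assoc[of "t \<oplus> l \<otimes> l" 2 "1/2"] l t by (simp add: g_def)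
  then have ll: "l \<oplus> l = t \<oplus> l \<otimes> l"
    using l by (simp add: smult_two)
  have "t \<oplus> (\<one> \<ominus> l) \<otimes> (\<one> \<ominus> l) = \<one> \<oplus> (t \<oplus> l \<otimes> l) \<ominus> (l \<oplus> l)"
    using l(1) t(1)
    by (simp add: a_minus_def r_distr l_distr r_minus l_minus minus_add a_ac minus_minus)
  then have "t \<oplus> (\<one> \<ominus> l) \<otimes> (\<one> \<ominus> l) = \<one>"
    using l(1) t(1) by (simp add: ll a_minus_def a_assoc r_neg)
  moreover have "adj A (\<one> \<ominus> l) = \<one> \<ominus> l"
    using l \<open>adj A l = l\<close> by (simp add: a_minus_def adj_add adj_minus)
  moreover have "x \<otimes> (\<one> \<ominus> l) = (\<one> \<ominus> l) \<otimes> x"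
    using l x \<open>x \<otimes> l = l \<otimes> x\<close> by (simp add: a_minus_def r_distr l_distr r_minus l_minus)
  ultimately show ?thesis
    using l unfolding t_def by (intro bexI[of _ "\<one> \<ominus> l"]) auto
qed

text \<open>Take \<open>u = x + \<i> y\<close> with \<open>y\<close> from
  \<open>complementary_square\<close>. As \<open>x\<close> and \<open>y\<close> are self-adjoint and
  commute, the product of \<open>adj A u\<close> and \<open>u\<close> is x^2 + y^2 = 1, and the mean
  of \<open>u\<close> and its adjoint is \<open>x\<close>.\<close>

lemma hermitian_average_unitary:
  assumes x: "x \<in> carrier A" "adj A x = x" "cnorm A x < 1"
  shows "\<exists>u\<in>carrier A. adj A u \<otimes> u = \<one> \<and> 2 \<odot> x = u \<oplus> adj A u"
proof -
  obtain y where y: "y \<in> carrier A" "adj A y = y" "x \<otimes> y = y \<otimes> x" "x \<otimes> x \<oplus> y \<otimes> y = \<one>"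
    using complementary_square[OF x] by blast
  define z where "z = \<i> \<odot> y"
  have z: "z \<in> carrier A" "adj A z = \<ominus> z" "x \<otimes> z = z \<otimes> x" "x \<otimes> x \<ominus> z \<otimes> z = \<one>"
    using y x(1) smult_minus_one[of "\<i> \<odot> y"] smult_minus_one[of "y \<otimes> y"]
    by (auto simp: z_def adj_smult smult_mult_left smult_mult_right a_minus_def
        minus_minus simp flip: smult_assoc)
  have "(x \<oplus> \<ominus> z) \<otimes> (x \<oplus> z) = (x \<otimes> x \<ominus> z \<otimes> z) \<oplus> (x \<otimes> z \<ominus> z \<otimes> x)"
    using x(1) z(1) by algebra
  also have "\<dots> = \<one>"
    using x(1) z by (simp add: a_minus_def r_neg)
  finally have "adj A (x \<oplus> z) \<otimes> (x \<oplus> z) = \<one>"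
    using x z by (simp add: adj_add)
  moreover have "x \<oplus> x = (x \<oplus> z) \<oplus> (x \<oplus> \<ominus> z)"
    using x(1) z(1) by algebra
  then have "2 \<odot> x = (x \<oplus> z) \<oplus> adj A (x \<oplus> z)"
    using x z by (simp add: adj_add smult_two)
  ultimately show ?thesis
    using x z by (intro bexI[of _ "x \<oplus> z"]) auto
qed

end

section \<open>Unital star homomorphisms and their contractivity\<close>

lemma star_hom_closed: "\<lbrakk>star_hom A B h; x \<in> carrier A\<rbrakk> \<Longrightarrow> h x \<in> carrier B"
  by (auto simp: star_hom_def ring_hom_def)

lemma star_hom_mult:
  "\<lbrakk>star_hom A B h; x \<in> carrier A; y \<in> carrier A\<rbrakk> \<Longrightarrow> h (x \<otimes>\<^bsub>A\<^esub> y) = h x \<otimes>\<^bsub>B\<^esub> h y"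
  by (auto simp: star_hom_def ring_hom_def)

lemma star_hom_add:
  "\<lbrakk>star_hom A B h; x \<in> carrier A; y \<in> carrier A\<rbrakk> \<Longrightarrow> h (x \<oplus>\<^bsub>A\<^esub> y) = h x \<oplus>\<^bsub>B\<^esub> h y"
  by (auto simp: star_hom_def ring_hom_def)

lemma star_hom_one: "star_hom A B h \<Longrightarrow> h \<one>\<^bsub>A\<^esub> = \<one>\<^bsub>B\<^esub>"
  by (auto simp: star_hom_def ring_hom_def)

lemma star_hom_smult:
  "\<lbrakk>star_hom A B h; x \<in> carrier A\<rbrakk> \<Longrightarrow> h (c \<odot>\<^bsub>A\<^esub> x) = c \<odot>\<^bsub>B\<^esub> h x"
  by (auto simp: star_hom_def)

lemma star_hom_adj: "\<lbrakk>star_hom A B h; x \<in> carrier A\<rbrakk> \<Longrightarrow> h (adj A x) = adj B (h x)"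
  by (auto simp: star_hom_def)

lemma star_hom_comp: "\<lbrakk>star_hom A B g; star_hom B C h\<rbrakk> \<Longrightarrow> star_hom A C (h \<circ> g)"
  by (auto simp: star_hom_def ring_hom_def Pi_iff)

lemma star_hom_zero:
  assumes "cstar_algebra A" "cstar_algebra B" "star_hom A B h"
  shows "h \<zero>\<^bsub>A\<^esub> = \<zero>\<^bsub>B\<^esub>"
proof -
  interpret A: cstar_algebra A by fact
  interpret B: cstar_algebra B by fact
  show ?thesis
    using star_hom_smult[OF assms(3), of "\<zero>\<^bsub>A\<^esub>" 0] star_hom_closed[OF assms(3), of "\<zero>\<^bsub>A\<^esub>"]
    by simp
qed

lemma star_hom_minus:
  assumes "cstar_algebra A" "cstar_algebra B" "star_hom A B h" "x \<in> carrier A" "y \<in> carrier A"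
  shows "h (x \<ominus>\<^bsub>A\<^esub> y) = h x \<ominus>\<^bsub>B\<^esub> h y"
proof -
  interpret A: cstar_algebra A by fact
  interpret B: cstar_algebra B by fact
  have "h (\<ominus>\<^bsub>A\<^esub> y) = \<ominus>\<^bsub>B\<^esub> h y"
    using star_hom_smult[OF assms(3), of y "-1"] star_hom_closed[OF assms(3)] assms(5)
    by (simp add: A.smult_minus_one B.smult_minus_one)
  then show ?thesis
    using assms(4,5) by (simp add: A.minus_eq B.minus_eq star_hom_add[OF assms(3)])
qed

text \<open>A self-adjoint element of norm less than 1 is the mean of a unitary and its adjoint, so its
  image is the mean of two elements of norm at most 1.\<close>

lemma star_hom_contractive:
  assumes "cstar_algebra A" "cstar_algebra B" "star_hom A B h" "x \<in> carrier A"
  shows "cnorm B (h x) \<le> cnorm A x"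
proof -
  interpret A: cstar_algebra A by fact
  interpret B: cstar_algebra B by fact
  note [simp] = star_hom_closed[OF assms(3)]
  have unit: "cnorm B (h z) \<le> 1"
    if z: "z \<in> carrier A" "adj A z = z" "cnorm A z < 1" for z
  proof -
    obtain u where u: "u \<in> carrier A" "adj A u \<otimes>\<^bsub>A\<^esub> u = \<one>\<^bsub>A\<^esub>" "2 \<odot>\<^bsub>A\<^esub> z = u \<oplus>\<^bsub>A\<^esub> adj A u"
      using A.hermitian_average_unitary[OF z] by blast
    have "cnorm B (h u) \<le> 1"
      using u star_hom_mult[OF assms(3), of "adj A u" u] star_hom_adj[OF assms(3), of u]
      by (intro B.norm_unitary_le) (auto simp: star_hom_one[OF assms(3)])
    moreover have "2 \<odot>\<^bsub>B\<^esub> h z = h u \<oplus>\<^bsub>B\<^esub> adj B (h u)"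
      using u z by (simp flip: star_hom_smult[OF assms(3)] star_hom_adj[OF assms(3)]
        add: star_hom_add[OF assms(3)])
    then have "2 * cnorm B (h z) = cnorm B (h u \<oplus>\<^bsub>B\<^esub> adj B (h u))"
      using B.norm_smult[of "h z" 2] z by simp
    ultimately show ?thesis
      using B.norm_add[of "h u" "adj B (h u)"] u by simp
  qed
  have herm: "cnorm B (h z) \<le> cnorm A z" if z: "z \<in> carrier A" "adj A z = z" for z
  proof (rule dense_ge)
    fix c assume c: "cnorm A z < c"
    then have "c > 0"
      using A.norm_nonneg[OF z(1)] by simp
    define w where "w = complex_of_real (1 / c) \<odot>\<^bsub>A\<^esub> z"
    have "cnorm A w < 1"
      using c \<open>c > 0\<close> z by (simp add: w_def A.norm_smult norm_divide)
    then have "cnorm B (h w) \<le> 1"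
      using z by (intro unit) (auto simp: w_def A.adj_smult)
    then show "cnorm B (h z) \<le> c"
      using \<open>c > 0\<close> z
      by (simp add: w_def star_hom_smult[OF assms(3)] B.norm_smult norm_divide)
  qed
  \<comment> \<open>The C*-identity in both algebras turns the bound for this self-adjoint element
    into one for the squared norms of \<open>h x\<close> and \<open>x\<close>.\<close>
  have "cnorm B (h (adj A x \<otimes>\<^bsub>A\<^esub> x)) \<le> cnorm A (adj A x \<otimes>\<^bsub>A\<^esub> x)"
    using assms(4) by (intro herm) (auto simp: A.adj_mult A.adj_adj)
  then have "(cnorm B (h x))\<^sup>2 \<le> (cnorm A x)\<^sup>2"
    using assms(4)
    by (simp add: star_hom_mult[OF assms(3)] star_hom_adj[OF assms(3)] A.cstar_identity
        B.cstar_identity)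
  then show ?thesis
    using A.norm_nonneg[OF assms(4)] power2_le_imp_le by blast
qed

lemma star_hom_limit:
  assumes "cstar_algebra A" "cstar_algebra B" "star_hom A B h"
    and "\<And>n. s n \<in> carrier A" "l \<in> carrier A" "cstar_limit A s l"
  shows "cstar_limit B (\<lambda>n. h (s n)) (h l)"
proof -
  interpret A: cstar_algebra A by fact
  interpret B: cstar_algebra B by fact
  have "cnorm B (h (s n) \<ominus>\<^bsub>B\<^esub> h l) \<le> cnorm A (s n \<ominus>\<^bsub>A\<^esub> l)" for n
    using star_hom_contractive[OF assms(1-3), of "s n \<ominus>\<^bsub>A\<^esub> l"] assms(4,5)
    by (simp add: star_hom_minus[OF assms(1-3)])
  then show ?thesis
    using assms(6) unfolding cstar_limit_def
    by (rule real_null_sequence_comparison[OF B.norm_nonneg, rotated])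
      (use star_hom_closed[OF assms(3)] assms(4,5) in simp)
qed

text \<open>The elements on which \<open>g\<close> and \<open>h\<close> agree form a C*-subalgebra;
  it is norm closed because both maps are contractive.\<close>

lemma star_hom_eq_on_generated:
  assumes "cstar_algebra A" "cstar_algebra B" "star_hom A B g" "star_hom A B h"
    and "cstar_generated A G" "G \<subseteq> carrier A" "\<And>x. x \<in> G \<Longrightarrow> g x = h x" "x \<in> carrier A"
  shows "g x = h x"
proof -
  interpret A: cstar_algebra A by fact
  interpret B: cstar_algebra B by fact
  let ?S = "{x \<in> carrier A. g x = h x}"
  have "cstar_subalgebra ?S A"
    unfolding cstar_subalgebra_def
  proof (intro conjI ballI allI impI)
    fix s l assume l: "l \<in> carrier A" and s: "(\<forall>n. s n \<in> ?S) \<and> cstar_limit A s l"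
    then have "cstar_limit B (\<lambda>n. g (s n)) (g l)" "cstar_limit B (\<lambda>n. g (s n)) (h l)"
      using star_hom_limit[OF assms(1-3), of s l] star_hom_limit[OF assms(1,2,4), of s l] by auto
    then have "g l = h l"
      using B.limit_unique[of "\<lambda>n. g (s n)" "g l" "h l"] s l
      star_hom_closed[OF assms(3)] star_hom_closed[OF assms(4)] by auto
    then show "l \<in> ?S"
      using l by simp
  qed (auto simp: star_hom_one[OF assms(3)] star_hom_one[OF assms(4)]
      star_hom_add[OF assms(3)] star_hom_add[OF assms(4)] star_hom_mult[OF assms(3)]
      star_hom_mult[OF assms(4)] star_hom_smult[OF assms(3)] star_hom_smult[OF assms(4)]
      star_hom_adj[OF assms(3)] star_hom_adj[OF assms(4)])
  then have "?S = carrier A"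
    using assms(5-7) unfolding cstar_generated_def by auto
  then show ?thesis
    using assms(8) by blast
qed

section \<open>The C*-algebra of bounded operators on \<open>\<ell>\<^sup>2\<close>\<close>

text \<open>Square summability and the norm bound are both read off from finite subsets, so that
  Minkowski's inequality is needed only for the finite sums in \<open>L2_set\<close>.\<close>

lemma ell2_I:
  assumes "\<And>i. i \<notin> I \<Longrightarrow> \<phi> i = 0"
    and "\<And>F. \<lbrakk>finite F; F \<subseteq> I\<rbrakk> \<Longrightarrow> L2_set (\<lambda>i. cmod (\<phi> i)) F \<le> c"
  shows "\<phi> \<in> ell2 I" "ell2_norm I \<phi> \<le> c"
proof -
  have c: "0 \<le> c"
    using assms(2)[of "{}"] by simp
  have *: "(\<Sum>i\<in>F. (cmod (\<phi> i))\<^sup>2) \<le> c\<^sup>2" if "finite F" "F \<subseteq> I" for F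
    using assms(2)[OF that] c
    by (auto simp: L2_set_def real_sqrt_le_iff' sum_nonneg)
  then have s: "(\<lambda>i. (cmod (\<phi> i))\<^sup>2) summable_on I"
    by (intro nonneg_bdd_above_summable_on bdd_aboveI[where M="c\<^sup>2"]) auto
  then show "\<phi> \<in> ell2 I"
    using assms(1) by (simp add: ell2_def)
  have "(\<Sum>\<^sub>\<infinity>i\<in>I. (cmod (\<phi> i))\<^sup>2) \<le> c\<^sup>2"
    using * by (intro infsum_le_finite_sums s) auto
  then show "ell2_norm I \<phi> \<le> c"
    using c by (simp add: ell2_norm_def real_le_lsqrt)
qed

lemma ell2_outside: "\<lbrakk>\<phi> \<in> ell2 I; i \<notin> I\<rbrakk> \<Longrightarrow> \<phi> i = 0"
  by (auto simp: ell2_def)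

lemma L2_set_le_ell2_norm:
  assumes "\<phi> \<in> ell2 I" "finite F" "F \<subseteq> I"
  shows "L2_set (\<lambda>i. cmod (\<phi> i)) F \<le> ell2_norm I \<phi>"
  unfolding L2_set_def ell2_norm_def
  using assms by (auto simp: ell2_def intro!: finite_sum_le_infsum)

lemma ell2_norm_nonneg [simp]: "0 \<le> ell2_norm I \<phi>"
  by (simp add: ell2_norm_def infsum_nonneg)

lemma cmod_le_ell2_norm: "\<phi> \<in> ell2 I \<Longrightarrow> cmod (\<phi> i) \<le> ell2_norm I \<phi>"
  using L2_set_le_ell2_norm[of \<phi> I "{i}"] by (cases "i \<in> I") (auto simp: ell2_outside)

lemma ell2_norm_eq_0: "\<lbrakk>\<phi> \<in> ell2 I; ell2_norm I \<phi> = 0\<rbrakk> \<Longrightarrow> \<phi> = (\<lambda>i. 0)"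
  using cmod_le_ell2_norm[of \<phi> I] by fastforce

lemma ell2_zero [simp]: "(\<lambda>i. 0) \<in> ell2 I" and ell2_norm_zero [simp]: "ell2_norm I (\<lambda>i. 0) = 0"
  by (auto simp: ell2_def ell2_norm_def)

lemma ell2_add:
  assumes "\<phi> \<in> ell2 I" "\<psi> \<in> ell2 I"
  shows ell2_add_closed: "(\<lambda>i. \<phi> i + \<psi> i) \<in> ell2 I"
    and ell2_norm_add: "ell2_norm I (\<lambda>i. \<phi> i + \<psi> i) \<le> ell2_norm I \<phi> + ell2_norm I \<psi>"
proof -
  have "L2_set (\<lambda>i. cmod (\<phi> i + \<psi> i)) F \<le> ell2_norm I \<phi> + ell2_norm I \<psi>"
    if F: "finite F" "F \<subseteq> I" for F
  proof -
    have "L2_set (\<lambda>i. cmod (\<phi> i + \<psi> i)) F \<le> L2_set (\<lambda>i. cmod (\<phi> i) + cmod (\<psi> i)) F"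
      by (intro L2_set_mono norm_triangle_ineq) auto
    also have "\<dots> \<le> L2_set (\<lambda>i. cmod (\<phi> i)) F + L2_set (\<lambda>i. cmod (\<psi> i)) F"
      by (rule L2_set_triangle_ineq)
    also have "\<dots> \<le> ell2_norm I \<phi> + ell2_norm I \<psi>"
      using L2_set_le_ell2_norm F assms by (intro add_mono) auto
    finally show ?thesis .
  qed
  then show "(\<lambda>i. \<phi> i + \<psi> i) \<in> ell2 I"
    "ell2_norm I (\<lambda>i. \<phi> i + \<psi> i) \<le> ell2_norm I \<phi> + ell2_norm I \<psi>"
    using ell2_I[of I "\<lambda>i. \<phi> i + \<psi> i"] assms by (auto simp: ell2_outside)
qed

lemma ell2_norm_smult: "ell2_norm I (\<lambda>i. c * \<phi> i) = cmod c * ell2_norm I \<phi>"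
  by (simp add: ell2_norm_def norm_mult power_mult_distrib infsum_cmult_right' real_sqrt_mult)

lemma ell2_smult_closed: "\<phi> \<in> ell2 I \<Longrightarrow> (\<lambda>i. c * \<phi> i) \<in> ell2 I"
  by (auto simp: ell2_def norm_mult power_mult_distrib intro: summable_on_cmult_right)

lemma ell2_minus_closed:
  "\<lbrakk>\<phi> \<in> ell2 I; \<psi> \<in> ell2 I\<rbrakk> \<Longrightarrow> (\<lambda>i. \<phi> i - \<psi> i) \<in> ell2 I"
  using ell2_add_closed[of \<phi> I "\<lambda>i. (-1) * \<psi> i"] ell2_smult_closed[of \<psi> I "-1"] by simp

lemma ell2_dominated:
  assumes "\<phi> \<in> ell2 I" "\<And>i. cmod (\<psi> i) \<le> K * cmod (\<phi> i)" "0 \<le> K"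
  shows "\<psi> \<in> ell2 I" "ell2_norm I \<psi> \<le> K * ell2_norm I \<phi>"
proof -
  have "L2_set (\<lambda>i. cmod (\<psi> i)) F \<le> K * ell2_norm I \<phi>" if F: "finite F" "F \<subseteq> I" for F
  proof -
    have "L2_set (\<lambda>i. cmod (\<psi> i)) F \<le> L2_set (\<lambda>i. K * cmod (\<phi> i)) F"
      using assms by (intro L2_set_mono) auto
    also have "\<dots> = K * L2_set (\<lambda>i. cmod (\<phi> i)) F"
      using assms by (simp add: L2_set_right_distrib)
    also have "\<dots> \<le> K * ell2_norm I \<phi>"
      using L2_set_le_ell2_norm[OF assms(1) F] assms by (intro mult_left_mono) auto
    finally show ?thesis .
  qed
  moreover have "\<psi> i = 0" if "i \<notin> I" for i
    using assms(2)[of i] ell2_outside[OF assms(1) that] by simp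
  ultimately show "\<psi> \<in> ell2 I" "ell2_norm I \<psi> \<le> K * ell2_norm I \<phi>"
    using ell2_I[of I \<psi>] by auto
qed

lemma ell2_inner_abs_summable:
  assumes "\<phi> \<in> ell2 I" "\<psi> \<in> ell2 I"
  shows "(\<lambda>i. cmod (\<phi> i * cnj (\<psi> i))) summable_on I"
    and "(\<Sum>\<^sub>\<infinity>i\<in>I. cmod (\<phi> i * cnj (\<psi> i))) \<le> ell2_norm I \<phi> * ell2_norm I \<psi>"
proof -
  have *: "(\<Sum>i\<in>F. cmod (\<phi> i * cnj (\<psi> i))) \<le> ell2_norm I \<phi> * ell2_norm I \<psi>"
    if F: "finite F" "F \<subseteq> I" for F
  proof -
    have "(\<Sum>i\<in>F. cmod (\<phi> i * cnj (\<psi> i))) = (\<Sum>i\<in>F. \<bar>cmod (\<phi> i)\<bar> * \<bar>cmod (\<psi> i)\<bar>)"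
      by (simp add: norm_mult)
    also have "\<dots> \<le> L2_set (\<lambda>i. cmod (\<phi> i)) F * L2_set (\<lambda>i. cmod (\<psi> i)) F"
      by (rule L2_set_mult_ineq)
    also have "\<dots> \<le> ell2_norm I \<phi> * ell2_norm I \<psi>"
      using L2_set_le_ell2_norm F assms by (intro mult_mono) auto
    finally show ?thesis .
  qed
  then show s: "(\<lambda>i. cmod (\<phi> i * cnj (\<psi> i))) summable_on I"
    by (intro nonneg_bdd_above_summable_on bdd_aboveI[where M="ell2_norm I \<phi> * ell2_norm I \<psi>"]) auto
  show "(\<Sum>\<^sub>\<infinity>i\<in>I. cmod (\<phi> i * cnj (\<psi> i))) \<le> ell2_norm I \<phi> * ell2_norm I \<psi>"
    using * by (intro infsum_le_finite_sums s) auto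
qed

lemma ell2_inner_summable:
  "\<lbrakk>\<phi> \<in> ell2 I; \<psi> \<in> ell2 I\<rbrakk> \<Longrightarrow> (\<lambda>i. \<phi> i * cnj (\<psi> i)) summable_on I"
  by (rule abs_summable_summable[OF ell2_inner_abs_summable(1)])

lemma ell2_cauchy_schwarz:
  assumes "\<phi> \<in> ell2 I" "\<psi> \<in> ell2 I"
  shows "cmod (ell2_inner I \<phi> \<psi>) \<le> ell2_norm I \<phi> * ell2_norm I \<psi>"
  unfolding ell2_inner_def
  using norm_infsum_bound[OF ell2_inner_abs_summable(1)[OF assms]] ell2_inner_abs_summable(2)[OF assms]
  by linarith

lemma ell2_inner_add_left:
  "\<lbrakk>\<phi> \<in> ell2 I; \<phi>' \<in> ell2 I; \<psi> \<in> ell2 I\<rbrakk>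
    \<Longrightarrow> ell2_inner I (\<lambda>i. \<phi> i + \<phi>' i) \<psi> = ell2_inner I \<phi> \<psi> + ell2_inner I \<phi>' \<psi>"
  unfolding ell2_inner_def by (simp add: distrib_right infsum_add ell2_inner_summable)

lemma ell2_inner_smult_left: "ell2_inner I (\<lambda>i. c * \<phi> i) \<psi> = c * ell2_inner I \<phi> \<psi>"
  unfolding ell2_inner_def by (simp add: mult.assoc infsum_cmult_right')

lemma ell2_inner_commute: "ell2_inner I \<psi> \<phi> = cnj (ell2_inner I \<phi> \<psi>)"
  unfolding ell2_inner_def by (simp add: mult.commute flip: infsum_cnj)

lemma ell2_inner_add_right:
  "\<lbrakk>\<phi> \<in> ell2 I; \<psi> \<in> ell2 I; \<psi>' \<in> ell2 I\<rbrakk>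
    \<Longrightarrow> ell2_inner I \<phi> (\<lambda>i. \<psi> i + \<psi>' i) = ell2_inner I \<phi> \<psi> + ell2_inner I \<phi> \<psi>'"
  by (simp add: ell2_inner_commute[of I \<phi>] ell2_inner_add_left)

lemma ell2_inner_smult_right: "ell2_inner I \<phi> (\<lambda>i. c * \<psi> i) = cnj c * ell2_inner I \<phi> \<psi>"
  by (simp add: ell2_inner_commute[of I \<phi>] ell2_inner_smult_left)

lemma ell2_inner_self:
  assumes "\<phi> \<in> ell2 I"
  shows "ell2_inner I \<phi> \<phi> = complex_of_real ((ell2_norm I \<phi>)\<^sup>2)"
proof -
  have "ell2_inner I \<phi> \<phi> = (\<Sum>\<^sub>\<infinity>i\<in>I. complex_of_real ((cmod (\<phi> i))\<^sup>2))"
    unfolding ell2_inner_def by (simp only: complex_norm_square)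
  also have "\<dots> = complex_of_real (\<Sum>\<^sub>\<infinity>i\<in>I. (cmod (\<phi> i))\<^sup>2)"
    using assms by (intro infsumI has_sum_of_real has_sum_infsum) (simp add: ell2_def)
  finally show ?thesis
    by (simp add: ell2_norm_def infsum_nonneg)
qed

definition ell2_unit :: "'i \<Rightarrow> 'i \<Rightarrow> complex" where
  "ell2_unit i = (\<lambda>j. if j = i then 1 else 0)"

lemma ell2_unit_closed [simp]: "i \<in> I \<Longrightarrow> ell2_unit i \<in> ell2 I"
  by (auto simp: ell2_def ell2_unit_def if_distrib cong: if_cong
      intro!: finite_nonzero_values_imp_summable_on)

lemma ell2_inner_unit:
  assumes "i \<in> I"
  shows "ell2_inner I \<phi> (ell2_unit i) = \<phi> i"
proof -
  have "ell2_inner I \<phi> (ell2_unit i) = (\<Sum>\<^sub>\<infinity>j\<in>{i}. \<phi> j)"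
    unfolding ell2_inner_def using assms by (intro infsum_cong_neutral) (auto simp: ell2_unit_def)
  then show ?thesis
    by simp
qed

lemma ell2_norm_unit:
  assumes "i \<in> I"
  shows "ell2_norm I (ell2_unit i) = 1"
proof -
  have "complex_of_real ((ell2_norm I (ell2_unit i))\<^sup>2) = 1"
    using ell2_inner_self[of "ell2_unit i" I] ell2_inner_unit[OF assms, of "ell2_unit i"] assms
    by (simp add: ell2_unit_def[of i, THEN fun_cong, of i])
  then have "(ell2_norm I (ell2_unit i))\<^sup>2 = 1"
    by (simp only: of_real_eq_1_iff)
  then show ?thesis
    using ell2_norm_nonneg[of I "ell2_unit i"] by (auto simp: power2_eq_1_iff)
qed

lemma ell2_tail:
  assumes "\<phi> \<in> ell2 I" "finite F" "F \<subseteq> I"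
  defines "\<psi> \<equiv> \<lambda>i. if i \<in> F then 0 else \<phi> i"
  shows "\<psi> \<in> ell2 I" "(ell2_norm I \<psi>)\<^sup>2 = (\<Sum>\<^sub>\<infinity>i\<in>I. (cmod (\<phi> i))\<^sup>2) - (\<Sum>i\<in>F. (cmod (\<phi> i))\<^sup>2)"
proof -
  show "\<psi> \<in> ell2 I"
    using ell2_dominated(1)[OF assms(1), of \<psi> 1] by (auto simp: \<psi>_def)
  have "(\<Sum>\<^sub>\<infinity>i\<in>I. (cmod (\<psi> i))\<^sup>2) = (\<Sum>\<^sub>\<infinity>i\<in>I - F. (cmod (\<phi> i))\<^sup>2)"
    by (intro infsum_cong_neutral) (auto simp: \<psi>_def)
  also have "\<dots> = (\<Sum>\<^sub>\<infinity>i\<in>I. (cmod (\<phi> i))\<^sup>2) - (\<Sum>\<^sub>\<infinity>i\<in>F. (cmod (\<phi> i))\<^sup>2)"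
    using assms by (intro infsum_Diff) (auto simp: ell2_def)
  finally show "(ell2_norm I \<psi>)\<^sup>2 = (\<Sum>\<^sub>\<infinity>i\<in>I. (cmod (\<phi> i))\<^sup>2) - (\<Sum>i\<in>F. (cmod (\<phi> i))\<^sup>2)"
    using assms(2) real_sqrt_pow2[OF infsum_nonneg[of I "\<lambda>i. (cmod (\<psi> i))\<^sup>2"]]
    unfolding ell2_norm_def by simp
qed

text \<open>The error of the partial sum over \<open>F\<close> is the value of \<open>L\<close> at
  the tail of \<phi> off \<open>F\<close>, hence at most \<open>K\<close> times the norm of that
  tail, which tends to 0. With \<open>L \<phi> = ell2_inner I (T \<phi>) \<psi>\<close> this leads
  to adjoints, with \<open>L \<phi> = R \<phi> i\<close> it shows that matrix coefficients determine
  an operator.\<close>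

lemma ell2_functional_expansion:
  assumes add: "\<And>\<phi> \<psi>. \<lbrakk>\<phi> \<in> ell2 I; \<psi> \<in> ell2 I\<rbrakk> \<Longrightarrow> L (\<lambda>i. \<phi> i + \<psi> i) = L \<phi> + L \<psi>"
    and smult: "\<And>\<phi> c. \<phi> \<in> ell2 I \<Longrightarrow> L (\<lambda>i. c * \<phi> i) = c * L \<phi>"
    and bound: "\<And>\<phi>. \<phi> \<in> ell2 I \<Longrightarrow> cmod (L \<phi>) \<le> K * ell2_norm I \<phi>"
    and \<phi>: "\<phi> \<in> ell2 I"
  shows "((\<lambda>i. \<phi> i * L (ell2_unit i)) has_sum L \<phi>) I"
proof -
  have zero: "L (\<lambda>i. 0) = 0"
    using smult[of "\<lambda>i. 0" 0] by simp
  have trunc: "(\<lambda>i. if i \<in> F then \<phi> i else 0) \<in> ell2 I \<and>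
      L (\<lambda>i. if i \<in> F then \<phi> i else 0) = (\<Sum>i\<in>F. \<phi> i * L (ell2_unit i))"
    if "finite F" "F \<subseteq> I" for F
    using that
  proof (induction F rule: finite_induct)
    case (insert a F)
    have "(\<lambda>i. if i \<in> insert a F then \<phi> i else 0)
        = (\<lambda>i. \<phi> a * ell2_unit a i + (if i \<in> F then \<phi> i else 0))"
      using insert by (auto simp: ell2_unit_def)
    then show ?case
      using insert by (simp add: add smult ell2_smult_closed ell2_add_closed)
  qed (simp add: zero)
  define tail where "tail F = ell2_norm I (\<lambda>i. if i \<in> F then 0 else \<phi> i)" for F
  have "((\<lambda>F. (\<Sum>\<^sub>\<infinity>i\<in>I. (cmod (\<phi> i))\<^sup>2) - (\<Sum>i\<in>F. (cmod (\<phi> i))\<^sup>2)) \<longlongrightarrow>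
      (\<Sum>\<^sub>\<infinity>i\<in>I. (cmod (\<phi> i))\<^sup>2) - (\<Sum>\<^sub>\<infinity>i\<in>I. (cmod (\<phi> i))\<^sup>2)) (finite_subsets_at_top I)"
    using \<phi> by (intro tendsto_diff tendsto_const infsum_tendsto) (auto simp: ell2_def)
  then have "((\<lambda>F. sqrt ((\<Sum>\<^sub>\<infinity>i\<in>I. (cmod (\<phi> i))\<^sup>2) - (\<Sum>i\<in>F. (cmod (\<phi> i))\<^sup>2))) \<longlongrightarrow> sqrt 0)
      (finite_subsets_at_top I)"
    by (intro tendsto_real_sqrt) simp
  moreover have "\<forall>\<^sub>F F in finite_subsets_at_top I.
      sqrt ((\<Sum>\<^sub>\<infinity>i\<in>I. (cmod (\<phi> i))\<^sup>2) - (\<Sum>i\<in>F. (cmod (\<phi> i))\<^sup>2)) = tail F"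
    using ell2_tail(2)[OF \<phi>] unfolding tail_def
    by (intro eventually_finite_subsets_at_top_weakI) (simp flip: ell2_tail(2)[OF \<phi>])
  ultimately have "(tail \<longlongrightarrow> 0) (finite_subsets_at_top I)"
    by (simp add: tendsto_cong)
  then have lim: "((\<lambda>F. K * tail F) \<longlongrightarrow> 0) (finite_subsets_at_top I)"
    using tendsto_mult_left[of tail 0] by simp
  have "cmod (sum (\<lambda>i. \<phi> i * L (ell2_unit i)) F - L \<phi>) \<le> K * tail F"
    if F: "finite F" "F \<subseteq> I" for F
  proof -
    let ?\<phi>1 = "\<lambda>i. if i \<in> F then \<phi> i else 0" and ?\<phi>2 = "\<lambda>i. if i \<in> F then 0 else \<phi> i"
    have "\<phi> = (\<lambda>i. ?\<phi>1 i + ?\<phi>2 i)"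
      by auto
    then have "L \<phi> = L ?\<phi>1 + L ?\<phi>2"
      using add[of ?\<phi>1 ?\<phi>2] trunc[OF F] ell2_tail(1)[OF \<phi> F] by simp
    then show ?thesis
      using bound[of ?\<phi>2] trunc[OF F] ell2_tail(1)[OF \<phi> F] by (simp add: tail_def)
  qed
  then have "((\<lambda>F. sum (\<lambda>i. \<phi> i * L (ell2_unit i)) F - L \<phi>) \<longlongrightarrow> 0) (finite_subsets_at_top I)"
    by (intro Lim_null_comparison[OF _ lim] eventually_finite_subsets_at_top_weakI)
  then show ?thesis
    unfolding has_sum_def using Lim_null by blast
qed

section \<open>The algebra of bounded operators, its norm and adjoints\<close>

lemma bounded_op_closed: "\<lbrakk>bounded_op I T; \<phi> \<in> ell2 I\<rbrakk> \<Longrightarrow> T \<phi> \<in> ell2 I"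
  by (rule PiE_mem[of T "ell2 I"]) (simp_all add: bounded_op_def)

lemma bounded_op_add:
  "\<lbrakk>bounded_op I T; \<phi> \<in> ell2 I; \<psi> \<in> ell2 I\<rbrakk> \<Longrightarrow> T (\<lambda>i. \<phi> i + \<psi> i) = (\<lambda>i. T \<phi> i + T \<psi> i)"
  by (simp add: bounded_op_def)

lemma bounded_op_smult:
  "\<lbrakk>bounded_op I T; \<phi> \<in> ell2 I\<rbrakk> \<Longrightarrow> T (\<lambda>i. c * \<phi> i) = (\<lambda>i. c * T \<phi> i)"
  by (simp add: bounded_op_def)

lemma bounded_op_eqI:
  assumes "bounded_op I S" "bounded_op I T" "\<And>\<phi>. \<phi> \<in> ell2 I \<Longrightarrow> S \<phi> = T \<phi>"
  shows "S = T"
proof (rule PiE_ext)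
  show "S \<in> ell2 I \<rightarrow>\<^sub>E ell2 I" "T \<in> ell2 I \<rightarrow>\<^sub>E ell2 I"
    using assms(1,2) by (simp_all add: bounded_op_def)
qed (rule assms(3))

lemma bounded_opI:
  assumes "\<And>\<phi>. \<phi> \<in> ell2 I \<Longrightarrow> T \<phi> \<in> ell2 I"
    and "\<And>\<phi>. \<phi> \<in> ell2 I \<Longrightarrow> ell2_norm I (T \<phi>) \<le> K * ell2_norm I \<phi>"
    and "\<And>\<phi> \<psi>. \<lbrakk>\<phi> \<in> ell2 I; \<psi> \<in> ell2 I\<rbrakk> \<Longrightarrow> T (\<lambda>i. \<phi> i + \<psi> i) = (\<lambda>i. T \<phi> i + T \<psi> i)"
    and "\<And>\<phi> c. \<phi> \<in> ell2 I \<Longrightarrow> T (\<lambda>i. c * \<phi> i) = (\<lambda>i. c * T \<phi> i)"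
  shows "bounded_op I (\<lambda>\<phi>\<in>ell2 I. T \<phi>)"
proof -
  have "\<exists>K. \<forall>\<phi>\<in>ell2 I. ell2_norm I (T \<phi>) \<le> K * ell2_norm I \<phi>"
    using assms(2) by blast
  then show ?thesis
    using assms(1,3,4) unfolding bounded_op_def by (simp add: ell2_add_closed ell2_smult_closed)
qed

lemma carrier_bounded_ops [simp]: "T \<in> carrier (bounded_ops I) \<longleftrightarrow> bounded_op I T"
  by (simp add: bounded_ops_def)

lemma bounded_ops_apply:
  assumes "\<phi> \<in> ell2 I"
  shows "(S \<otimes>\<^bsub>bounded_ops I\<^esub> T) \<phi> = S (T \<phi>)" "\<one>\<^bsub>bounded_ops I\<^esub> \<phi> = \<phi>"
    "(S \<oplus>\<^bsub>bounded_ops I\<^esub> T) \<phi> = (\<lambda>i. S \<phi> i + T \<phi> i)" "\<zero>\<^bsub>bounded_ops I\<^esub> \<phi> = (\<lambda>i. 0)"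
    "(c \<odot>\<^bsub>bounded_ops I\<^esub> T) \<phi> = (\<lambda>i. c * T \<phi> i)"
  using assms by (simp_all add: bounded_ops_def)

lemma bounded_op_bound:
  assumes "bounded_op I T"
  shows "\<exists>K\<ge>0. \<forall>\<phi>\<in>ell2 I. ell2_norm I (T \<phi>) \<le> K * ell2_norm I \<phi>"
proof -
  have "\<exists>K. \<forall>\<phi>\<in>ell2 I. ell2_norm I (T \<phi>) \<le> K * ell2_norm I \<phi>"
    using assms by (simp add: bounded_op_def)
  then obtain K where K: "\<forall>\<phi>\<in>ell2 I. ell2_norm I (T \<phi>) \<le> K * ell2_norm I \<phi>" ..
  have "ell2_norm I (T \<phi>) \<le> max K 0 * ell2_norm I \<phi>" if "\<phi> \<in> ell2 I" for \<phi>
    using K that mult_right_mono[of K "max K 0" "ell2_norm I \<phi>"] by fastforce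
  then show ?thesis
    by (intro exI[of _ "max K 0"]) simp
qed

lemma bounded_op_compose:
  assumes "bounded_op I S" "bounded_op I T"
  shows "bounded_op I (\<lambda>\<phi>\<in>ell2 I. S (T \<phi>))"
proof -
  obtain K where K: "0 \<le> K" "\<And>\<phi>. \<phi> \<in> ell2 I \<Longrightarrow> ell2_norm I (S \<phi>) \<le> K * ell2_norm I \<phi>"
    using bounded_op_bound[OF assms(1)] by blast
  obtain K' where K': "\<And>\<phi>. \<phi> \<in> ell2 I \<Longrightarrow> ell2_norm I (T \<phi>) \<le> K' * ell2_norm I \<phi>"
    using bounded_op_bound[OF assms(2)] by blast
  have "ell2_norm I (S (T \<phi>)) \<le> (K * K') * ell2_norm I \<phi>" if "\<phi> \<in> ell2 I" for \<phi>
  proof -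
    have "ell2_norm I (S (T \<phi>)) \<le> K * ell2_norm I (T \<phi>)"
      using K(2) bounded_op_closed[OF assms(2) that] .
    also have "\<dots> \<le> K * (K' * ell2_norm I \<phi>)"
      using K'[OF that] K(1) by (rule mult_left_mono)
    finally show ?thesis
      by simp
  qed
  then show ?thesis
    using assms by (intro bounded_opI[where K="K * K'"])
      (simp_all add: bounded_op_closed[of I] bounded_op_add[of I] bounded_op_smult[of I])
qed

lemma bounded_op_sum:
  assumes "bounded_op I S" "bounded_op I T"
  shows "bounded_op I (\<lambda>\<phi>\<in>ell2 I. (\<lambda>i. S \<phi> i + T \<phi> i))"
proof -
  obtain K where K: "\<And>\<phi>. \<phi> \<in> ell2 I \<Longrightarrow> ell2_norm I (S \<phi>) \<le> K * ell2_norm I \<phi>"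
    using bounded_op_bound[OF assms(1)] by blast
  obtain K' where K': "\<And>\<phi>. \<phi> \<in> ell2 I \<Longrightarrow> ell2_norm I (T \<phi>) \<le> K' * ell2_norm I \<phi>"
    using bounded_op_bound[OF assms(2)] by blast
  have "ell2_norm I (\<lambda>i. S \<phi> i + T \<phi> i) \<le> (K + K') * ell2_norm I \<phi>" if "\<phi> \<in> ell2 I" for \<phi>
    using ell2_norm_add[of "S \<phi>" I "T \<phi>"] K[OF that] K'[OF that] assms that
    by (simp add: bounded_op_closed distrib_right)
  then show ?thesis
    using assms by (intro bounded_opI[where K="K + K'"])
      (simp_all add: bounded_op_closed[of I] bounded_op_add[of I] bounded_op_smult[of I] ell2_add_closed
        algebra_simps)
qed

lemma bounded_op_scaled:
  assumes "bounded_op I T"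
  shows "bounded_op I (\<lambda>\<phi>\<in>ell2 I. (\<lambda>i. c * T \<phi> i))"
proof -
  obtain K where K: "\<And>\<phi>. \<phi> \<in> ell2 I \<Longrightarrow> ell2_norm I (T \<phi>) \<le> K * ell2_norm I \<phi>"
    using bounded_op_bound[OF assms(1)] by blast
  have "ell2_norm I (\<lambda>i. c * T \<phi> i) \<le> (cmod c * K) * ell2_norm I \<phi>" if "\<phi> \<in> ell2 I" for \<phi>
    using mult_left_mono[OF K[OF that], of "cmod c"] by (simp add: ell2_norm_smult mult.assoc)
  then show ?thesis
    using assms by (intro bounded_opI[where K="cmod c * K"])
      (simp_all add: bounded_op_closed[of I] bounded_op_add[of I] bounded_op_smult[of I] ell2_smult_closed
        algebra_simps)
qed

lemma bounded_op_id: "bounded_op I (\<lambda>\<phi>\<in>ell2 I. \<phi>)"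
  by (rule bounded_opI[where K=1]) auto

lemma bounded_op_zero: "bounded_op I (\<lambda>\<phi>\<in>ell2 I. (\<lambda>i. 0))"
  by (rule bounded_opI[where K=0]) auto

lemma bounded_ops_closed:
  "\<lbrakk>bounded_op I S; bounded_op I T\<rbrakk> \<Longrightarrow> bounded_op I (S \<otimes>\<^bsub>bounded_ops I\<^esub> T)"
  "\<lbrakk>bounded_op I S; bounded_op I T\<rbrakk> \<Longrightarrow> bounded_op I (S \<oplus>\<^bsub>bounded_ops I\<^esub> T)"
  "bounded_op I T \<Longrightarrow> bounded_op I (c \<odot>\<^bsub>bounded_ops I\<^esub> T)"
  "bounded_op I \<one>\<^bsub>bounded_ops I\<^esub>" "bounded_op I \<zero>\<^bsub>bounded_ops I\<^esub>"
  by (simp_all add: bounded_ops_def bounded_op_compose bounded_op_sum bounded_op_scaled bounded_op_id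
      bounded_op_zero)

lemma bounded_ops_eqI:
  assumes "S \<in> carrier (bounded_ops I)" "T \<in> carrier (bounded_ops I)"
    and "\<And>\<phi> i. \<phi> \<in> ell2 I \<Longrightarrow> S \<phi> i = T \<phi> i"
  shows "S = T"
  using assms by (intro bounded_op_eqI[of I S T] ext) auto

lemma ring_bounded_ops: "ring (bounded_ops I)"
proof -
  let ?B = "bounded_ops I"
  have l_inv: "\<exists>S\<in>carrier ?B. S \<oplus>\<^bsub>?B\<^esub> T = \<zero>\<^bsub>?B\<^esub>" if "T \<in> carrier ?B" for T
    using that
    by (intro bexI[of _ "(-1) \<odot>\<^bsub>?B\<^esub> T"] bounded_ops_eqI[of _ I])
      (simp_all add: bounded_ops_closed bounded_ops_apply)
  have group: "abelian_group ?B"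
  proof (rule abelian_groupI)
    fix x y z assume "x \<in> carrier ?B" "y \<in> carrier ?B" "z \<in> carrier ?B"
    then show "x \<oplus>\<^bsub>?B\<^esub> y \<oplus>\<^bsub>?B\<^esub> z = x \<oplus>\<^bsub>?B\<^esub> (y \<oplus>\<^bsub>?B\<^esub> z)"
      by (intro bounded_ops_eqI[of _ I]) (simp_all add: bounded_ops_closed bounded_ops_apply add.assoc)
  next
    fix x y assume "x \<in> carrier ?B" "y \<in> carrier ?B"
    then show "x \<oplus>\<^bsub>?B\<^esub> y = y \<oplus>\<^bsub>?B\<^esub> x"
      by (intro bounded_ops_eqI[of _ I]) (simp_all add: bounded_ops_closed bounded_ops_apply add.commute)
  next
    fix x assume "x \<in> carrier ?B"
    then show "\<zero>\<^bsub>?B\<^esub> \<oplus>\<^bsub>?B\<^esub> x = x"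
      by (intro bounded_ops_eqI[of _ I]) (simp_all add: bounded_ops_closed bounded_ops_apply)
  qed (simp_all add: bounded_ops_closed l_inv)
  have monoid: "monoid ?B"
  proof (rule monoidI)
    fix x y z assume "x \<in> carrier ?B" "y \<in> carrier ?B" "z \<in> carrier ?B"
    then show "x \<otimes>\<^bsub>?B\<^esub> y \<otimes>\<^bsub>?B\<^esub> z = x \<otimes>\<^bsub>?B\<^esub> (y \<otimes>\<^bsub>?B\<^esub> z)"
      by (intro bounded_ops_eqI[of _ I])
        (simp_all add: bounded_ops_closed bounded_ops_apply bounded_op_closed[of I])
  next
    fix x assume x: "x \<in> carrier ?B"
    show "\<one>\<^bsub>?B\<^esub> \<otimes>\<^bsub>?B\<^esub> x = x" "x \<otimes>\<^bsub>?B\<^esub> \<one>\<^bsub>?B\<^esub> = x"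
      using x by (intro bounded_ops_eqI[of _ I];
        simp add: bounded_ops_closed bounded_ops_apply bounded_op_closed[of I])+
  qed (simp_all add: bounded_ops_closed)
  show ?thesis
  proof (rule ringI[OF group monoid])
    fix x y z assume xyz: "x \<in> carrier ?B" "y \<in> carrier ?B" "z \<in> carrier ?B"
    show "(x \<oplus>\<^bsub>?B\<^esub> y) \<otimes>\<^bsub>?B\<^esub> z = x \<otimes>\<^bsub>?B\<^esub> z \<oplus>\<^bsub>?B\<^esub> y \<otimes>\<^bsub>?B\<^esub> z"
      using xyz by (intro bounded_ops_eqI[of _ I])
        (simp_all add: bounded_ops_closed bounded_ops_apply bounded_op_closed[of I])
    show "z \<otimes>\<^bsub>?B\<^esub> (x \<oplus>\<^bsub>?B\<^esub> y) = z \<otimes>\<^bsub>?B\<^esub> x \<oplus>\<^bsub>?B\<^esub> z \<otimes>\<^bsub>?B\<^esub> y"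
      using xyz by (intro bounded_ops_eqI[of _ I])
        (simp_all add: bounded_ops_closed bounded_ops_apply bounded_op_closed[of I] bounded_op_add[of I])
  qed
qed

lemma cring_complex_ring: "cring complex_ring"
proof (intro cringI abelian_groupI comm_monoidI)
  fix x assume "x \<in> carrier complex_ring"
  show "\<exists>y\<in>carrier complex_ring. y \<oplus>\<^bsub>complex_ring\<^esub> x = \<zero>\<^bsub>complex_ring\<^esub>"
    by (rule bexI[of _ "- x"]) (auto simp: complex_ring_def)
qed (auto simp: complex_ring_def algebra_simps)

lemma module_bounded_ops: "Module.module complex_ring (bounded_ops I)"
proof -
  interpret ring "bounded_ops I" by (rule ring_bounded_ops)
  show ?thesis
    by (intro Module.module.intro cring_complex_ring abelian_group_axioms module_axioms.intro)
      (auto simp: bounded_ops_closed bounded_ops_apply bounded_op_closed bounded_op_add algebra_simps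
        complex_ring_def intro!: bounded_op_eqI[of I])
qed

lemma bounded_ops_minus_apply:
  assumes "bounded_op I S" "bounded_op I T" "\<phi> \<in> ell2 I"
  shows "(S \<ominus>\<^bsub>bounded_ops I\<^esub> T) \<phi> = (\<lambda>i. S \<phi> i - T \<phi> i)"
proof -
  interpret ring "bounded_ops I" by (rule ring_bounded_ops)
  have "\<ominus>\<^bsub>bounded_ops I\<^esub> T = (-1) \<odot>\<^bsub>bounded_ops I\<^esub> T"
    using assms(2) by (intro minus_equality bounded_op_eqI[of I])
      (auto simp: bounded_ops_closed bounded_ops_apply)
  then show ?thesis
    using assms(3) by (simp add: a_minus_def bounded_ops_apply)
qed

text \<open>The real supremum in \<open>cnorm\<close> is meaningful because it runs over a nonempty
  set that is bounded by any operator bound \<open>K\<close>. Together the three facts say that it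
  is the least nonnegative bound, and in this form the norm is used from here on.\<close>

lemma cnorm_bounded_ops:
  assumes "bounded_op I T"
  shows cnorm_bounded_ops_nonneg: "0 \<le> cnorm (bounded_ops I) T"
    and cnorm_bounded_ops_bound:
      "\<phi> \<in> ell2 I \<Longrightarrow> ell2_norm I (T \<phi>) \<le> cnorm (bounded_ops I) T * ell2_norm I \<phi>"
    and cnorm_bounded_ops_le:
      "\<lbrakk>0 \<le> K; \<And>\<phi>. \<phi> \<in> ell2 I \<Longrightarrow> ell2_norm I (T \<phi>) \<le> K * ell2_norm I \<phi>\<rbrakk>
        \<Longrightarrow> cnorm (bounded_ops I) T \<le> K"
proof -
  let ?B = "{\<phi> \<in> ell2 I. ell2_norm I \<phi> \<le> 1}"
  have norm_def: "cnorm (bounded_ops I) T = (SUP \<phi>\<in>?B. ell2_norm I (T \<phi>))"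
    by (simp add: bounded_ops_def)
  have *: "ell2_norm I (T \<phi>) \<le> K"
    if "0 \<le> K" "\<And>\<phi>. \<phi> \<in> ell2 I \<Longrightarrow> ell2_norm I (T \<phi>) \<le> K * ell2_norm I \<phi>" "\<phi> \<in> ?B" for K \<phi>
    using that(2)[of \<phi>] that(3) mult_left_mono[of "ell2_norm I \<phi>" 1 K] that(1) by simp
  obtain K where K: "0 \<le> K" "\<And>\<phi>. \<phi> \<in> ell2 I \<Longrightarrow> ell2_norm I (T \<phi>) \<le> K * ell2_norm I \<phi>"
    using bounded_op_bound[OF assms] by blast
  have bdd: "bdd_above ((\<lambda>\<phi>. ell2_norm I (T \<phi>)) ` ?B)"
    using *[OF K] by (intro bdd_aboveI2[where M=K])
  have zero: "(\<lambda>i. 0) \<in> ?B"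
    by simp
  show nonneg: "0 \<le> cnorm (bounded_ops I) T"
    unfolding norm_def by (rule order_trans[OF ell2_norm_nonneg cSUP_upper[OF zero bdd]])
  show "cnorm (bounded_ops I) T \<le> K'"
    if "0 \<le> K'" "\<And>\<phi>. \<phi> \<in> ell2 I \<Longrightarrow> ell2_norm I (T \<phi>) \<le> K' * ell2_norm I \<phi>" for K'
    unfolding norm_def by (rule cSUP_least) (use zero in blast, rule *[OF that])
  show "ell2_norm I (T \<phi>) \<le> cnorm (bounded_ops I) T * ell2_norm I \<phi>" if \<phi>: "\<phi> \<in> ell2 I"
  proof (cases "ell2_norm I \<phi> = 0")
    case True
    then show ?thesis
      using K(2)[OF \<phi>] by simp
  next
    case False
    define c where "c = ell2_norm I \<phi>"
    have c: "c > 0"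
      using False ell2_norm_nonneg[of I \<phi>] unfolding c_def by linarith
    define \<psi> where "\<psi> = (\<lambda>i. complex_of_real (1 / c) * \<phi> i)"
    have "\<psi> \<in> ?B"
      using c ell2_smult_closed[OF \<phi>] ell2_norm_smult[of I "complex_of_real (1 / c)" \<phi>]
      unfolding \<psi>_def mem_Collect_eq by (metis abs_of_pos c_def divide_pos_pos eq_refl
        less_numeral_extra(1) nonzero_divide_eq_eq norm_of_real order_less_irrefl)
    then have "ell2_norm I (T \<psi>) \<le> cnorm (bounded_ops I) T"
      unfolding norm_def by (intro cSUP_upper bdd)
    moreover have "ell2_norm I (T \<psi>) = ell2_norm I (T \<phi>) / c"
      using bounded_op_smult[OF assms \<phi>, of "complex_of_real (1 / c)"] c
        ell2_norm_smult[of I "complex_of_real (1 / c)" "T \<phi>"]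
      by (simp add: \<psi>_def norm_divide)
    ultimately show ?thesis
      using c by (simp add: c_def field_simps)
  qed
qed

text \<open>\<open>S \<psi>\<close> is prescribed by the coefficients that an adjoint must have. For
  its square summability, \<open>T\<close> is tested on the truncation \<open>a\<close> of
  \<open>S \<psi>\<close> to a finite set \<open>F\<close>: the square of the length
  \<open>l\<close> of this truncation is the inner product of \<open>T a\<close> with \<psi>, hence
  at most \<open>K * l\<close> times the norm of \<psi>. Cancelling \<open>l\<close> leaves a bound
  that does not depend on \<open>F\<close>.\<close>

lemma bounded_op_adjoint_exists:
  assumes T: "bounded_op I T"
  shows "\<exists>S. bounded_op I S \<and> (\<forall>\<phi>\<in>ell2 I. \<forall>\<psi>\<in>ell2 I. ell2_inner I (T \<phi>) \<psi> = ell2_inner I \<phi> (S \<psi>))"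
proof -
  obtain K where K: "0 \<le> K" "\<And>\<phi>. \<phi> \<in> ell2 I \<Longrightarrow> ell2_norm I (T \<phi>) \<le> K * ell2_norm I \<phi>"
    using bounded_op_bound[OF T] by blast
  define S where "S \<psi> = (\<lambda>i. if i \<in> I then ell2_inner I \<psi> (T (ell2_unit i)) else 0)" for \<psi>
  have exp: "((\<lambda>i. \<phi> i * ell2_inner I (T (ell2_unit i)) \<psi>) has_sum ell2_inner I (T \<phi>) \<psi>) I"
    if \<phi>: "\<phi> \<in> ell2 I" and \<psi>: "\<psi> \<in> ell2 I" for \<phi> \<psi>
  proof (rule ell2_functional_expansion[where L="\<lambda>\<phi>. ell2_inner I (T \<phi>) \<psi>" and K="K * ell2_norm I \<psi>"])
    fix \<phi> assume \<phi>: "\<phi> \<in> ell2 I"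
    have "cmod (ell2_inner I (T \<phi>) \<psi>) \<le> ell2_norm I (T \<phi>) * ell2_norm I \<psi>"
      using ell2_cauchy_schwarz bounded_op_closed[OF T \<phi>] \<psi> .
    also have "\<dots> \<le> (K * ell2_norm I \<phi>) * ell2_norm I \<psi>"
      using K(2)[OF \<phi>] by (rule mult_right_mono) simp
    finally show "cmod (ell2_inner I (T \<phi>) \<psi>) \<le> K * ell2_norm I \<psi> * ell2_norm I \<phi>"
      by (simp add: mult_ac)
  qed (use T \<psi> \<phi> in \<open>auto simp: bounded_op_add bounded_op_smult bounded_op_closed ell2_inner_add_left
      ell2_inner_smult_left\<close>)
  have S: "S \<psi> \<in> ell2 I \<and> ell2_norm I (S \<psi>) \<le> K * ell2_norm I \<psi>" if \<psi>: "\<psi> \<in> ell2 I" for \<psi>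
  proof -
    have "L2_set (\<lambda>i. cmod (S \<psi> i)) F \<le> K * ell2_norm I \<psi>" if F: "finite F" "F \<subseteq> I" for F
    proof -
      define a where "a i = (if i \<in> F then S \<psi> i else 0)" for i
      define l where "l = L2_set (\<lambda>i. cmod (S \<psi> i)) F"
      have l2: "l\<^sup>2 = (\<Sum>i\<in>F. (cmod (S \<psi> i))\<^sup>2)"
        unfolding l_def L2_set_def by (simp add: sum_nonneg)
      have la: "L2_set (\<lambda>i. cmod (a i)) G \<le> l" if "finite G" for G
      proof -
        have "(\<Sum>i\<in>G. (cmod (a i))\<^sup>2) = (\<Sum>i\<in>G \<inter> F. (cmod (S \<psi> i))\<^sup>2)"
          using that by (intro sum.mono_neutral_cong_right) (auto simp: a_def)
        also have "\<dots> \<le> (\<Sum>i\<in>F. (cmod (S \<psi> i))\<^sup>2)"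
          using F by (intro sum_mono2) auto
        finally show ?thesis
          by (simp add: L2_set_def l_def)
      qed
      have a_out: "a i = 0" if "i \<notin> I" for i
        using that F by (auto simp: a_def)
      have a: "a \<in> ell2 I" "ell2_norm I a \<le> l"
        using ell2_I[of I a l] la F a_out by blast+
      have "((\<lambda>i. a i * ell2_inner I (T (ell2_unit i)) \<psi>) has_sum 
          (\<Sum>i\<in>F. a i * ell2_inner I (T (ell2_unit i)) \<psi>)) I"
        using F by (intro has_sum_finite_neutralI) (auto simp: a_def)
      then have "ell2_inner I (T a) \<psi> = (\<Sum>i\<in>F. a i * ell2_inner I (T (ell2_unit i)) \<psi>)"
        using exp[OF a(1) \<psi>] has_sum_unique by blast
      also have "\<dots> = (\<Sum>i\<in>F. complex_of_real ((cmod (S \<psi> i))\<^sup>2))"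
      proof (rule sum.cong[OF refl])
        fix i assume "i \<in> F"
        then show "a i * ell2_inner I (T (ell2_unit i)) \<psi> = complex_of_real ((cmod (S \<psi> i))\<^sup>2)"
          using F unfolding complex_norm_square
          by (auto simp: a_def S_def ell2_inner_commute[of I "T (ell2_unit i)"])
      qed
      also have "\<dots> = complex_of_real (l\<^sup>2)"
        by (simp add: l2)
      finally have "l\<^sup>2 = cmod (ell2_inner I (T a) \<psi>)"
        by (metis abs_of_nonneg norm_of_real zero_le_power2)
      also have "\<dots> \<le> ell2_norm I (T a) * ell2_norm I \<psi>"
        using ell2_cauchy_schwarz bounded_op_closed[OF T a(1)] \<psi> .
      also have "\<dots> \<le> (K * ell2_norm I a) * ell2_norm I \<psi>"
        using K(2)[OF a(1)] by (rule mult_right_mono) simp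
      also have "\<dots> \<le> (K * l) * ell2_norm I \<psi>"
        using a(2) K(1) by (intro mult_right_mono mult_left_mono) auto
      finally have "l * l \<le> l * (K * ell2_norm I \<psi>)"
        by (simp add: power2_eq_square mult_ac)
      moreover have "0 \<le> l"
        by (simp add: l_def)
      ultimately have "l \<le> K * ell2_norm I \<psi>"
        using K(1) by (cases "l = 0") auto
      then show ?thesis
        by (simp add: l_def)
    qed
    then show ?thesis
      using ell2_I[of I "S \<psi>"] by (auto simp: S_def)
  qed
  have Te: "i \<in> I \<Longrightarrow> T (ell2_unit i) \<in> ell2 I" for i
    using T by (simp add: bounded_op_closed)
  have "bounded_op I (\<lambda>\<psi>\<in>ell2 I. S \<psi>)"
    using S Te by (intro bounded_opI[where K=K])
      (auto simp: S_def ell2_inner_add_left ell2_inner_smult_left)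
  moreover have "ell2_inner I (T \<phi>) \<psi> = ell2_inner I \<phi> (S \<psi>)" if "\<phi> \<in> ell2 I" "\<psi> \<in> ell2 I" for \<phi> \<psi>
  proof -
    have "ell2_inner I (T \<phi>) \<psi> = (\<Sum>\<^sub>\<infinity>i\<in>I. \<phi> i * ell2_inner I (T (ell2_unit i)) \<psi>)"
      using infsumI[OF exp[OF that]] by simp
    also have "\<dots> = ell2_inner I \<phi> (S \<psi>)"
      unfolding ell2_inner_def[of I \<phi>]
      by (intro infsum_cong) (simp add: S_def ell2_inner_commute[of I "T (ell2_unit _)"])
    finally show ?thesis .
  qed
  ultimately show ?thesis
    by (intro exI[of _ "\<lambda>\<psi>\<in>ell2 I. S \<psi>"]) auto
qed

lemma bounded_op_adjoint_unique:
  assumes "bounded_op I S" "bounded_op I S'"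
    and "\<And>\<phi> \<psi>. \<lbrakk>\<phi> \<in> ell2 I; \<psi> \<in> ell2 I\<rbrakk> \<Longrightarrow> ell2_inner I \<phi> (S \<psi>) = ell2_inner I \<phi> (S' \<psi>)"
  shows "S = S'"
proof (rule bounded_op_eqI[OF assms(1,2)])
  fix \<psi> assume \<psi>: "\<psi> \<in> ell2 I"
  show "S \<psi> = S' \<psi>"
  proof
    fix i
    show "S \<psi> i = S' \<psi> i"
    proof (cases "i \<in> I")
      case True
      then have "cnj (ell2_inner I (S \<psi>) (ell2_unit i)) = cnj (ell2_inner I (S' \<psi>) (ell2_unit i))"
        using assms(3)[of "ell2_unit i" \<psi>] \<psi> by (simp flip: ell2_inner_commute)
      then show ?thesis
        using True by (simp add: ell2_inner_unit)
    qed (simp add: ell2_outside[OF bounded_op_closed[OF assms(1) \<psi>]]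
        ell2_outside[OF bounded_op_closed[OF assms(2) \<psi>]])
  qed
qed

lemma op_adjoint:
  assumes "bounded_op I T"
  shows op_adjoint_bounded: "bounded_op I (op_adjoint I T)"
    and op_adjoint_inner:
      "\<lbrakk>\<phi> \<in> ell2 I; \<psi> \<in> ell2 I\<rbrakk> \<Longrightarrow> ell2_inner I (T \<phi>) \<psi> = ell2_inner I \<phi> (op_adjoint I T \<psi>)"
proof -
  have "\<exists>!S. bounded_op I S \<and>
      (\<forall>\<phi>\<in>ell2 I. \<forall>\<psi>\<in>ell2 I. ell2_inner I (T \<phi>) \<psi> = ell2_inner I \<phi> (S \<psi>))"
    using bounded_op_adjoint_exists[OF assms] bounded_op_adjoint_unique[of I]
    by (metis (lifting))
  from theI'[OF this] show "bounded_op I (op_adjoint I T)"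
    "\<lbrakk>\<phi> \<in> ell2 I; \<psi> \<in> ell2 I\<rbrakk> \<Longrightarrow> ell2_inner I (T \<phi>) \<psi> = ell2_inner I \<phi> (op_adjoint I T \<psi>)"
    unfolding op_adjoint_def by auto
qed

lemma op_adjoint_eqI:
  assumes "bounded_op I T" "bounded_op I S"
    and "\<And>\<phi> \<psi>. \<lbrakk>\<phi> \<in> ell2 I; \<psi> \<in> ell2 I\<rbrakk> \<Longrightarrow> ell2_inner I (T \<phi>) \<psi> = ell2_inner I \<phi> (S \<psi>)"
  shows "op_adjoint I T = S"
  using assms op_adjoint[OF assms(1)] by (intro bounded_op_adjoint_unique[of I]) auto

lemma op_adjoint_inner':
  assumes "bounded_op I T" "\<phi> \<in> ell2 I" "\<psi> \<in> ell2 I"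
  shows "ell2_inner I (op_adjoint I T \<phi>) \<psi> = ell2_inner I \<phi> (T \<psi>)"
  using op_adjoint_inner[OF assms(1,3,2)] by (metis ell2_inner_commute)

lemma adj_bounded_ops [simp]: "adj (bounded_ops I) = op_adjoint I"
  by (simp add: bounded_ops_def)

text \<open>The squared norm of \<open>T \<phi>\<close> is the inner product of
  \<open>op_adjoint I T (T \<phi>)\<close> with \<phi>. This is one half of the C*-identity, and it
  also shows that passing to the adjoint does not decrease the norm.\<close>

lemma bounded_op_square_bound:
  assumes T: "bounded_op I T" and \<phi>: "\<phi> \<in> ell2 I"
  shows "(ell2_norm I (T \<phi>))\<^sup>2
    \<le> cnorm (bounded_ops I) (op_adjoint I T \<otimes>\<^bsub>bounded_ops I\<^esub> T) * (ell2_norm I \<phi>)\<^sup>2"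
proof -
  let ?S = "op_adjoint I T \<otimes>\<^bsub>bounded_ops I\<^esub> T"
  have S: "bounded_op I ?S"
    using T by (simp add: bounded_ops_closed op_adjoint_bounded)
  have "complex_of_real ((ell2_norm I (T \<phi>))\<^sup>2) = ell2_inner I (?S \<phi>) \<phi>"
    using assms
    by (simp add: bounded_ops_apply op_adjoint_inner' bounded_op_closed ell2_inner_self del: of_real_power)
  then have "(ell2_norm I (T \<phi>))\<^sup>2 = cmod (ell2_inner I (?S \<phi>) \<phi>)"
    by (metis abs_of_nonneg norm_of_real zero_le_power2)
  also have "\<dots> \<le> ell2_norm I (?S \<phi>) * ell2_norm I \<phi>"
    using ell2_cauchy_schwarz bounded_op_closed[OF S \<phi>] \<phi> .
  also have "\<dots> \<le> (cnorm (bounded_ops I) ?S * ell2_norm I \<phi>) * ell2_norm I \<phi>"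
    using cnorm_bounded_ops_bound[OF S \<phi>] by (rule mult_right_mono) simp
  finally show ?thesis
    by (simp add: power2_eq_square mult_ac)
qed

lemma cnorm_bounded_ops_mult:
  assumes S: "bounded_op I S" and T: "bounded_op I T"
  shows "cnorm (bounded_ops I) (S \<otimes>\<^bsub>bounded_ops I\<^esub> T)
    \<le> cnorm (bounded_ops I) S * cnorm (bounded_ops I) T"
proof (rule cnorm_bounded_ops_le)
  fix \<phi> assume \<phi>: "\<phi> \<in> ell2 I"
  have "ell2_norm I (S (T \<phi>)) \<le> cnorm (bounded_ops I) S * ell2_norm I (T \<phi>)"
    using cnorm_bounded_ops_bound S bounded_op_closed[OF T \<phi>] .
  also have "\<dots> \<le> cnorm (bounded_ops I) S * (cnorm (bounded_ops I) T * ell2_norm I \<phi>)"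
    using cnorm_bounded_ops_bound[OF T \<phi>] cnorm_bounded_ops_nonneg[OF S] by (rule mult_left_mono)
  finally show "ell2_norm I ((S \<otimes>\<^bsub>bounded_ops I\<^esub> T) \<phi>)
      \<le> cnorm (bounded_ops I) S * cnorm (bounded_ops I) T * ell2_norm I \<phi>"
    using \<phi> by (simp add: bounded_ops_apply mult.assoc)
qed (use assms in \<open>simp_all add: bounded_ops_closed cnorm_bounded_ops_nonneg\<close>)

lemma cnorm_bounded_ops_adjoint_le:
  assumes T: "bounded_op I T"
  shows "cnorm (bounded_ops I) T \<le> cnorm (bounded_ops I) (op_adjoint I T)"
proof -
  let ?n = "cnorm (bounded_ops I)"
  have T': "bounded_op I (op_adjoint I T)"
    using op_adjoint_bounded[OF T] .
  have le: "ell2_norm I (T \<phi>) \<le> sqrt (?n (op_adjoint I T) * ?n T) * ell2_norm I \<phi>" if "\<phi> \<in> ell2 I" for \<phi>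
  proof -
    have "(ell2_norm I (T \<phi>))\<^sup>2 \<le> ?n (op_adjoint I T \<otimes>\<^bsub>bounded_ops I\<^esub> T) * (ell2_norm I \<phi>)\<^sup>2"
      using bounded_op_square_bound[OF T that] .
    also have "\<dots> \<le> (?n (op_adjoint I T) * ?n T) * (ell2_norm I \<phi>)\<^sup>2"
      by (intro mult_right_mono cnorm_bounded_ops_mult T T') simp
    finally have "sqrt ((ell2_norm I (T \<phi>))\<^sup>2) \<le> sqrt ((?n (op_adjoint I T) * ?n T) * (ell2_norm I \<phi>)\<^sup>2)"
      by (rule real_sqrt_le_mono)
    then show ?thesis
      by (simp add: real_sqrt_mult)
  qed
  have "?n T \<le> sqrt (?n (op_adjoint I T) * ?n T)"
    using cnorm_bounded_ops_nonneg[OF T] cnorm_bounded_ops_nonneg[OF T'] le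
    by (intro cnorm_bounded_ops_le[OF T]) auto
  then have "?n T * ?n T \<le> ?n (op_adjoint I T) * ?n T"
    using cnorm_bounded_ops_nonneg[OF T] cnorm_bounded_ops_nonneg[OF T']
    by (metis mult_nonneg_nonneg power2_eq_square power_mono real_sqrt_pow2)
  then show ?thesis
    using cnorm_bounded_ops_nonneg[OF T] cnorm_bounded_ops_nonneg[OF T']
    by (cases "?n T = 0") auto
qed

text \<open>The limit is taken coordinatewise. Norm convergence is recovered by letting
  \<open>m\<close> tend to infinity in the finite sums over \<open>F\<close>, with a bound that is
  uniform in \<open>F\<close>.\<close>

lemma bounded_ops_complete:
  assumes s: "\<And>n. bounded_op I (s n)"
    and cauchy: "\<And>e. 0 < e \<Longrightarrow>
      \<exists>N. \<forall>m\<ge>N. \<forall>n\<ge>N. cnorm (bounded_ops I) (s m \<ominus>\<^bsub>bounded_ops I\<^esub> s n) < e"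
  shows "\<exists>l. bounded_op I l \<and> cstar_limit (bounded_ops I) s l"
proof -
  interpret ring "bounded_ops I" by (rule ring_bounded_ops)
  let ?n = "cnorm (bounded_ops I)"
  have sub: "bounded_op I (S \<ominus>\<^bsub>bounded_ops I\<^esub> T)" if "bounded_op I S" "bounded_op I T" for S T
    using minus_closed[of S T] that by simp
  have diff: "ell2_norm I (\<lambda>i. s m \<phi> i - s n \<phi> i) \<le> ?n (s m \<ominus>\<^bsub>bounded_ops I\<^esub> s n) * ell2_norm I \<phi>"
    if "\<phi> \<in> ell2 I" for m n \<phi>
    using cnorm_bounded_ops_bound[OF sub[OF s s] that, of m n] s that
    by (simp add: bounded_ops_minus_apply)
  have "Cauchy (\<lambda>n. s n \<phi> i)" if \<phi>: "\<phi> \<in> ell2 I" for \<phi> i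
  proof (rule metric_CauchyI)
    fix e :: real assume "0 < e"
    define d where "d = e / (ell2_norm I \<phi> + 1)"
    have pos: "0 < ell2_norm I \<phi> + 1"
      using ell2_norm_nonneg[of I \<phi>] by linarith
    then have "0 < d"
      using \<open>0 < e\<close> by (simp add: d_def)
    then obtain N where N: "\<And>m n. m \<ge> N \<Longrightarrow> n \<ge> N \<Longrightarrow> ?n (s m \<ominus>\<^bsub>bounded_ops I\<^esub> s n) < d"
      using cauchy by blast
    have "dist (s m \<phi> i) (s n \<phi> i) < e" if "m \<ge> N" "n \<ge> N" for m n
    proof -
      have "dist (s m \<phi> i) (s n \<phi> i) \<le> ell2_norm I (\<lambda>i. s m \<phi> i - s n \<phi> i)"
        using cmod_le_ell2_norm[OF ell2_minus_closed[OF bounded_op_closed[OF s[of m] \<phi>]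
            bounded_op_closed[OF s[of n] \<phi>]], of i]
        by (simp add: dist_norm)
      also have "\<dots> \<le> ?n (s m \<ominus>\<^bsub>bounded_ops I\<^esub> s n) * ell2_norm I \<phi>"
        by (rule diff[OF \<phi>])
      also have "\<dots> \<le> d * ell2_norm I \<phi>"
        using N[OF that] by (intro mult_right_mono) auto
      also have "\<dots> < d * (ell2_norm I \<phi> + 1)"
        using \<open>0 < d\<close> by simp
      finally show ?thesis
        using pos by (simp add: d_def)
    qed
    then show "\<exists>M. \<forall>m\<ge>M. \<forall>n\<ge>M. dist (s m \<phi> i) (s n \<phi> i) < e"
      by blast
  qed
  then have conv: "(\<lambda>n. s n \<phi> i) \<longlonglongrightarrow> lim (\<lambda>n. s n \<phi> i)" if "\<phi> \<in> ell2 I" for \<phi> i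
    using that Cauchy_convergent convergent_LIMSEQ_iff by blast
  define l where "l \<phi> i = lim (\<lambda>n. s n \<phi> i)" for \<phi> i
  \<comment> \<open>The threshold \<open>N\<close> serves all \<phi> at once, which is what turns
    this estimate on vectors into convergence in the operator norm.\<close>
  have close: "(\<lambda>i. l \<phi> i - s n \<phi> i) \<in> ell2 I \<and> ell2_norm I (\<lambda>i. l \<phi> i - s n \<phi> i) \<le> e * ell2_norm I \<phi>"
    if \<phi>: "\<phi> \<in> ell2 I" and n: "n \<ge> N"
      and N: "\<And>m n. m \<ge> N \<Longrightarrow> n \<ge> N \<Longrightarrow> ?n (s m \<ominus>\<^bsub>bounded_ops I\<^esub> s n) < e" for \<phi> n N e
  proof -
    have "L2_set (\<lambda>i. cmod (l \<phi> i - s n \<phi> i)) F \<le> e * ell2_norm I \<phi>" if F: "finite F" "F \<subseteq> I" for F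
    proof (rule LIMSEQ_le_const2)
      show "(\<lambda>m. L2_set (\<lambda>i. cmod (s m \<phi> i - s n \<phi> i)) F) \<longlonglongrightarrow> L2_set (\<lambda>i. cmod (l \<phi> i - s n \<phi> i)) F"
        unfolding L2_set_def l_def
        by (intro tendsto_real_sqrt tendsto_sum tendsto_power tendsto_norm tendsto_diff conv \<phi> tendsto_const)
      have "L2_set (\<lambda>i. cmod (s m \<phi> i - s n \<phi> i)) F \<le> e * ell2_norm I \<phi>" if "m \<ge> N" for m
      proof -
        have "L2_set (\<lambda>i. cmod (s m \<phi> i - s n \<phi> i)) F \<le> ell2_norm I (\<lambda>i. s m \<phi> i - s n \<phi> i)"
          using L2_set_le_ell2_norm[OF ell2_minus_closed[OF bounded_op_closed[OF s[of m] \<phi>]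
              bounded_op_closed[OF s[of n] \<phi>]] F]
          by simp
        also have "\<dots> \<le> ?n (s m \<ominus>\<^bsub>bounded_ops I\<^esub> s n) * ell2_norm I \<phi>"
          by (rule diff[OF \<phi>])
        also have "\<dots> \<le> e * ell2_norm I \<phi>"
          using N[OF that n] by (intro mult_right_mono) auto
        finally show ?thesis .
      qed
      then show "\<exists>N. \<forall>m\<ge>N. L2_set (\<lambda>i. cmod (s m \<phi> i - s n \<phi> i)) F \<le> e * ell2_norm I \<phi>"
        by blast
    qed
    moreover have "l \<phi> i - s n \<phi> i = 0" if "i \<notin> I" for i
      using that \<phi> by (simp add: l_def ell2_outside[OF bounded_op_closed[OF s \<phi>]])
    ultimately show ?thesis
      using ell2_I[of I "\<lambda>i. l \<phi> i - s n \<phi> i"] by blast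
  qed
  obtain N0 where N0: "\<And>m n. m \<ge> N0 \<Longrightarrow> n \<ge> N0 \<Longrightarrow> ?n (s m \<ominus>\<^bsub>bounded_ops I\<^esub> s n) < 1"
    using cauchy[of 1] by auto
  have l_split: "l \<phi> = (\<lambda>i. (l \<phi> i - s N0 \<phi> i) + s N0 \<phi> i)" for \<phi>
    by simp
  have l: "l \<phi> \<in> ell2 I" "ell2_norm I (l \<phi>) \<le> (1 + ?n (s N0)) * ell2_norm I \<phi>" if \<phi>: "\<phi> \<in> ell2 I" for \<phi>
  proof -
    note c = close[where n=N0 and N=N0 and e=1, OF \<phi> order_refl N0]
    show "l \<phi> \<in> ell2 I"
      using ell2_add_closed[OF conjunct1[OF c] bounded_op_closed[OF s[of N0] \<phi>]] by simp
    show "ell2_norm I (l \<phi>) \<le> (1 + ?n (s N0)) * ell2_norm I \<phi>"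
      using ell2_norm_add[OF conjunct1[OF c] bounded_op_closed[OF s[of N0] \<phi>]] conjunct2[OF c]
        cnorm_bounded_ops_bound[OF s \<phi>, of N0] by (simp add: distrib_right)
  qed
  have l_add: "l (\<lambda>i. \<phi> i + \<psi> i) = (\<lambda>i. l \<phi> i + l \<psi> i)" if "\<phi> \<in> ell2 I" "\<psi> \<in> ell2 I" for \<phi> \<psi>
  proof
    fix i
    have "(\<lambda>n. s n \<phi> i + s n \<psi> i) \<longlonglongrightarrow> l \<phi> i + l \<psi> i"
      unfolding l_def by (intro tendsto_add conv that)
    then show "l (\<lambda>i. \<phi> i + \<psi> i) i = l \<phi> i + l \<psi> i"
      using that by (simp add: l_def bounded_op_add[OF s] limI)
  qed
  have l_smult: "l (\<lambda>i. c * \<phi> i) = (\<lambda>i. c * l \<phi> i)" if "\<phi> \<in> ell2 I" for \<phi> c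
  proof
    fix i
    have "(\<lambda>n. c * s n \<phi> i) \<longlonglongrightarrow> c * l \<phi> i"
      unfolding l_def by (intro tendsto_mult tendsto_const conv that)
    then show "l (\<lambda>i. c * \<phi> i) i = c * l \<phi> i"
      using that by (simp add: l_def bounded_op_smult[OF s] limI)
  qed
  let ?l = "\<lambda>\<phi>\<in>ell2 I. l \<phi>"
  have L: "bounded_op I ?l"
    using l l_add l_smult by (intro bounded_opI[where K="1 + ?n (s N0)"]) auto
  have "(\<lambda>n. ?n (s n \<ominus>\<^bsub>bounded_ops I\<^esub> ?l)) \<longlonglongrightarrow> 0"
  proof (rule LIMSEQ_I)
    fix e :: real assume "0 < e"
    then obtain N where N: "\<And>m n. m \<ge> N \<Longrightarrow> n \<ge> N \<Longrightarrow> ?n (s m \<ominus>\<^bsub>bounded_ops I\<^esub> s n) < e/2"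
      using cauchy[of "e/2"] by auto
    have "?n (s n \<ominus>\<^bsub>bounded_ops I\<^esub> ?l) \<le> e/2" if "n \<ge> N" for n
    proof (rule cnorm_bounded_ops_le[OF sub[OF s L]])
      fix \<phi> assume \<phi>: "\<phi> \<in> ell2 I"
      have "ell2_norm I (\<lambda>i. s n \<phi> i - l \<phi> i) = ell2_norm I (\<lambda>i. l \<phi> i - s n \<phi> i)"
        by (simp add: ell2_norm_def norm_minus_commute)
      then show "ell2_norm I ((s n \<ominus>\<^bsub>bounded_ops I\<^esub> ?l) \<phi>) \<le> e/2 * ell2_norm I \<phi>"
        using close[OF \<phi> that N] \<phi> by (simp add: bounded_ops_minus_apply[OF s L \<phi>])
    qed (use \<open>0 < e\<close> in simp)
    then show "\<exists>no. \<forall>n\<ge>no. norm (?n (s n \<ominus>\<^bsub>bounded_ops I\<^esub> ?l) - 0) < e"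
      using \<open>0 < e\<close> cnorm_bounded_ops_nonneg[OF sub[OF s L]] by (intro exI[of _ N]) fastforce
  qed
  then show ?thesis
    using L unfolding cstar_limit_def by blast
qed

lemma cstar_algebra_bounded_ops: "cstar_algebra (bounded_ops I)"
proof (rule cstar_algebra.intro)
  let ?B = "bounded_ops I"
  show "ring ?B"
    by (rule ring_bounded_ops)
  show "Module.module complex_ring ?B"
    by (rule module_bounded_ops)
  fix S T assume "S \<in> carrier ?B" "T \<in> carrier ?B"
  then have S: "bounded_op I S" and T: "bounded_op I T"
    by simp_all
  note adj = op_adjoint_bounded[OF S] op_adjoint_bounded[OF T]
  show "(c \<odot>\<^bsub>?B\<^esub> S) \<otimes>\<^bsub>?B\<^esub> T = c \<odot>\<^bsub>?B\<^esub> (S \<otimes>\<^bsub>?B\<^esub> T)" for c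
    using S T by (intro bounded_op_eqI[of I])
      (auto simp: bounded_ops_closed bounded_ops_apply bounded_op_closed)
  show "S \<otimes>\<^bsub>?B\<^esub> (c \<odot>\<^bsub>?B\<^esub> T) = c \<odot>\<^bsub>?B\<^esub> (S \<otimes>\<^bsub>?B\<^esub> T)" for c
    using S T by (intro bounded_op_eqI[of I])
      (auto simp: bounded_ops_closed bounded_ops_apply bounded_op_closed bounded_op_smult)
  show "adj ?B S \<in> carrier ?B"
    using adj by simp
  show "adj ?B (adj ?B S) = S"
    using S adj by (simp add: op_adjoint_eqI op_adjoint_inner')
  show "adj ?B (S \<oplus>\<^bsub>?B\<^esub> T) = adj ?B S \<oplus>\<^bsub>?B\<^esub> adj ?B T"
    unfolding adj_bounded_ops using S T adj
    by (intro op_adjoint_eqI) (auto simp: bounded_ops_closed bounded_ops_apply bounded_op_closed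
        ell2_inner_add_left ell2_inner_add_right op_adjoint_inner)
  show "adj ?B (c \<odot>\<^bsub>?B\<^esub> S) = cnj c \<odot>\<^bsub>?B\<^esub> adj ?B S" for c
    unfolding adj_bounded_ops using S adj
    by (intro op_adjoint_eqI) (auto simp: bounded_ops_closed bounded_ops_apply bounded_op_closed
        ell2_inner_smult_left ell2_inner_smult_right op_adjoint_inner)
  show "adj ?B (S \<otimes>\<^bsub>?B\<^esub> T) = adj ?B T \<otimes>\<^bsub>?B\<^esub> adj ?B S"
    unfolding adj_bounded_ops using S T adj
    by (intro op_adjoint_eqI) (auto simp: bounded_ops_closed bounded_ops_apply bounded_op_closed
        op_adjoint_inner)
  show "0 \<le> cnorm ?B S"
    using S by (rule cnorm_bounded_ops_nonneg)
  show "cnorm ?B S = 0 \<longleftrightarrow> S = \<zero>\<^bsub>?B\<^esub>"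
  proof
    assume "cnorm ?B S = 0"
    then have "S \<phi> = (\<lambda>i. 0)" if "\<phi> \<in> ell2 I" for \<phi>
      using cnorm_bounded_ops_bound[OF S that] ell2_norm_nonneg[of I "S \<phi>"]
        ell2_norm_eq_0[OF bounded_op_closed[OF S that]] by simp
    then show "S = \<zero>\<^bsub>?B\<^esub>"
      using S by (intro bounded_op_eqI[of I]) (auto simp: bounded_ops_closed bounded_ops_apply)
  next
    assume "S = \<zero>\<^bsub>?B\<^esub>"
    then have "cnorm ?B S \<le> 0"
      using S by (intro cnorm_bounded_ops_le) (auto simp: bounded_ops_apply)
    then show "cnorm ?B S = 0"
      using cnorm_bounded_ops_nonneg[OF S] by simp
  qed
  show "cnorm ?B (S \<oplus>\<^bsub>?B\<^esub> T) \<le> cnorm ?B S + cnorm ?B T"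
  proof (rule cnorm_bounded_ops_le)
    fix \<phi> assume \<phi>: "\<phi> \<in> ell2 I"
    show "ell2_norm I ((S \<oplus>\<^bsub>?B\<^esub> T) \<phi>) \<le> (cnorm ?B S + cnorm ?B T) * ell2_norm I \<phi>"
      using cnorm_bounded_ops_bound[OF S \<phi>] cnorm_bounded_ops_bound[OF T \<phi>]
        ell2_norm_add[OF bounded_op_closed[OF S \<phi>] bounded_op_closed[OF T \<phi>]] \<phi>
      by (simp add: bounded_ops_apply distrib_right)
  qed (use S T in \<open>simp_all add: bounded_ops_closed cnorm_bounded_ops_nonneg\<close>)
  show "cnorm ?B (c \<odot>\<^bsub>?B\<^esub> S) = cmod c * cnorm ?B S" for c
  proof (rule antisym)
    have le: "cnorm ?B (c \<odot>\<^bsub>?B\<^esub> R) \<le> cmod c * cnorm ?B R" if R: "bounded_op I R" for c R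
    proof (rule cnorm_bounded_ops_le)
      fix \<phi> assume \<phi>: "\<phi> \<in> ell2 I"
      show "ell2_norm I ((c \<odot>\<^bsub>?B\<^esub> R) \<phi>) \<le> cmod c * cnorm ?B R * ell2_norm I \<phi>"
        using mult_left_mono[OF cnorm_bounded_ops_bound[OF R \<phi>], of "cmod c"] \<phi>
        by (simp add: bounded_ops_apply ell2_norm_smult mult.assoc)
    qed (use R in \<open>simp_all add: bounded_ops_closed cnorm_bounded_ops_nonneg\<close>)
    show "cnorm ?B (c \<odot>\<^bsub>?B\<^esub> S) \<le> cmod c * cnorm ?B S"
      using le[OF S] .
    show "cmod c * cnorm ?B S \<le> cnorm ?B (c \<odot>\<^bsub>?B\<^esub> S)"
    proof (cases "c = 0")
      case False
      have "inverse c \<odot>\<^bsub>?B\<^esub> (c \<odot>\<^bsub>?B\<^esub> S) = S"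
        using S False by (intro bounded_op_eqI[of I])
          (auto simp: bounded_ops_closed bounded_ops_apply simp flip: mult.assoc)
      then show ?thesis
        using le[of "c \<odot>\<^bsub>?B\<^esub> S" "inverse c"] S False
        by (simp add: bounded_ops_closed norm_inverse)
          (simp add: inverse_eq_divide pos_le_divide_eq mult.commute)
    qed (use S in \<open>simp add: bounded_ops_closed cnorm_bounded_ops_nonneg\<close>)
  qed
  show "cnorm ?B (S \<otimes>\<^bsub>?B\<^esub> T) \<le> cnorm ?B S * cnorm ?B T"
    using S T by (rule cnorm_bounded_ops_mult)
  show "cnorm ?B (adj ?B S \<otimes>\<^bsub>?B\<^esub> S) = (cnorm ?B S)\<^sup>2"
  proof (rule antisym)
    have "cnorm ?B (op_adjoint I S) \<le> cnorm ?B S"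
      using cnorm_bounded_ops_adjoint_le[OF adj(1)] S adj
      by (simp add: op_adjoint_eqI op_adjoint_inner')
    then have "cnorm ?B (op_adjoint I S) * cnorm ?B S \<le> cnorm ?B S * cnorm ?B S"
      using cnorm_bounded_ops_nonneg[OF S] by (rule mult_right_mono)
    then show "cnorm ?B (adj ?B S \<otimes>\<^bsub>?B\<^esub> S) \<le> (cnorm ?B S)\<^sup>2"
      using cnorm_bounded_ops_mult[OF adj(1) S] by (simp add: power2_eq_square)
    let ?c = "cnorm ?B (op_adjoint I S \<otimes>\<^bsub>?B\<^esub> S)"
    have c: "0 \<le> ?c"
      using S adj by (intro cnorm_bounded_ops_nonneg bounded_ops_closed)
    have "ell2_norm I (S \<phi>) \<le> sqrt ?c * ell2_norm I \<phi>" if "\<phi> \<in> ell2 I" for \<phi>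
      using real_sqrt_le_mono[OF bounded_op_square_bound[OF S that]] by (simp add: real_sqrt_mult)
    then have "cnorm ?B S \<le> sqrt ?c"
      using S c by (intro cnorm_bounded_ops_le) auto
    then have "(cnorm ?B S)\<^sup>2 \<le> (sqrt ?c)\<^sup>2"
      using cnorm_bounded_ops_nonneg[OF S] by (rule power_mono)
    then show "(cnorm ?B S)\<^sup>2 \<le> cnorm ?B (adj ?B S \<otimes>\<^bsub>?B\<^esub> S)"
      using c by simp
  qed
next
  fix s :: "nat \<Rightarrow> ('a \<Rightarrow> complex) \<Rightarrow> 'a \<Rightarrow> complex"
  assume "\<And>n. s n \<in> carrier (bounded_ops I)"
    and "\<And>e. 0 < e \<Longrightarrow> \<exists>N. \<forall>m\<ge>N. \<forall>n\<ge>N. cnorm (bounded_ops I) (s m \<ominus>\<^bsub>bounded_ops I\<^esub> s n) < e"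
  then show "\<exists>l\<in>carrier (bounded_ops I). cstar_limit (bounded_ops I) s l"
    using bounded_ops_complete[of I s] by auto
qed

section \<open>The \<open>p\<close>-adic integers and their roots of unity\<close>

lemma Zp_carrier_iff:
  "a \<in> carrier (Zp p) \<longleftrightarrow> (\<forall>n. 0 \<le> a n \<and> a n < int p ^ n \<and> a (Suc n) mod int p ^ n = a n)"
  by (simp add: Zp_def)

lemma Zp_mult_apply: "(a \<otimes>\<^bsub>Zp p\<^esub> b) n = (a n * b n) mod int p ^ n"
  by (simp add: Zp_def)

lemma Zp_one_apply: "\<one>\<^bsub>Zp p\<^esub> n = 1 mod int p ^ n"
  by (simp add: Zp_def)

lemma Zp_mod_self: "a \<in> carrier (Zp p) \<Longrightarrow> a n mod int p ^ n = a n"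
  by (simp add: Zp_carrier_iff)

lemma Zp_carrierI:
  assumes "0 < p" "\<And>n. a (Suc n) mod int p ^ n = a n"
  shows "a \<in> carrier (Zp p)"
  unfolding Zp_carrier_iff using assms by (metis of_nat_0_less_iff pos_mod_bound pos_mod_sign zero_less_power)

lemma mod_power_Suc: "(x mod int p ^ Suc n) mod int p ^ n = x mod int p ^ n"
  by (rule mod_mod_cancel) simp

lemma Zp_mod_le:
  assumes "a \<in> carrier (Zp p)" "n \<le> m"
  shows "a m mod int p ^ n = a n"
  using assms(2)
proof (induction m rule: dec_induct)
  case base
  show ?case
    using assms(1) by (rule Zp_mod_self)
next
  case (step m)
  have "a (Suc m) mod int p ^ n = (a (Suc m) mod int p ^ m) mod int p ^ n"
    using step by (simp add: mod_mod_cancel le_imp_power_dvd)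
  also have "a (Suc m) mod int p ^ m = a m"
    using assms(1) by (simp add: Zp_carrier_iff)
  finally show ?case
    using step by simp
qed

lemma Zp_mult_closed:
  assumes "0 < p" "a \<in> carrier (Zp p)" "b \<in> carrier (Zp p)"
  shows "a \<otimes>\<^bsub>Zp p\<^esub> b \<in> carrier (Zp p)"
proof (rule Zp_carrierI[OF assms(1)])
  fix n
  have "(a \<otimes>\<^bsub>Zp p\<^esub> b) (Suc n) mod int p ^ n = (a (Suc n) * b (Suc n)) mod int p ^ n"
    unfolding Zp_mult_apply by (rule mod_power_Suc)
  also have "\<dots> = (a (Suc n) mod int p ^ n * (b (Suc n) mod int p ^ n)) mod int p ^ n"
    by (simp add: mod_mult_eq)
  finally show "(a \<otimes>\<^bsub>Zp p\<^esub> b) (Suc n) mod int p ^ n = (a \<otimes>\<^bsub>Zp p\<^esub> b) n"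
    using assms by (simp add: Zp_carrier_iff Zp_mult_apply)
qed

lemma Zp_of_int_closed: "0 < p \<Longrightarrow> Zp_of_int p x \<in> carrier (Zp p)"
  by (rule Zp_carrierI) (simp_all only: Zp_of_int_def mod_power_Suc)

lemma Zp_one_eq: "\<one>\<^bsub>Zp p\<^esub> = Zp_of_int p 1"
  by (simp add: Zp_def Zp_of_int_def)

lemma Zp_comm_monoid:
  assumes "0 < p"
  shows "comm_monoid (Zp p)"
proof (rule comm_monoidI)
  show "\<one>\<^bsub>Zp p\<^esub> \<in> carrier (Zp p)"
    using assms by (simp add: Zp_one_eq Zp_of_int_closed)
  fix x y z assume "x \<in> carrier (Zp p)"
  then show "\<one>\<^bsub>Zp p\<^esub> \<otimes>\<^bsub>Zp p\<^esub> x = x"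
    by (intro ext) (simp add: Zp_mult_apply Zp_one_apply mod_mult_left_eq Zp_mod_self)
qed (use assms in \<open>auto simp: Zp_mult_closed Zp_mult_apply mod_mult_left_eq mod_mult_right_eq
    mult_ac intro!: ext\<close>)

lemma Zp_pow_apply: "(u [^]\<^bsub>Zp p\<^esub> N) n = u n ^ N mod int p ^ n" for N :: nat
proof (induction N)
  case 0
  show ?case
    by (simp add: nat_pow_def Zp_one_apply)
next
  case (Suc N)
  have "u [^]\<^bsub>Zp p\<^esub> Suc N = u [^]\<^bsub>Zp p\<^esub> N \<otimes>\<^bsub>Zp p\<^esub> u"
    by (simp add: nat_pow_def)
  then show ?case
    by (simp add: Zp_mult_apply Suc mod_mult_left_eq mult.commute[of "u n"])
qed

lemma pow_eq_one_imp_unit: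
  fixes N :: nat
  assumes "comm_monoid G" "u \<in> carrier G" "0 < N" "u [^]\<^bsub>G\<^esub> N = \<one>\<^bsub>G\<^esub>"
  shows "u \<in> Units G"
proof -
  interpret comm_monoid G by fact
  have "u [^]\<^bsub>G\<^esub> Suc (N - 1) = \<one>\<^bsub>G\<^esub>"
    using assms(3,4) by simp
  then have "u [^]\<^bsub>G\<^esub> (N - 1) \<otimes>\<^bsub>G\<^esub> u = \<one>\<^bsub>G\<^esub>"
    by simp
  then show ?thesis
    using assms(2) m_comm[of "u [^]\<^bsub>G\<^esub> (N - 1)" u] unfolding Units_def
    by (auto intro!: bexI[of _ "u [^]\<^bsub>G\<^esub> (N - 1)"])
qed

section \<open>The group of roots of unity and Teichmueller representatives\<close>

lemma roots_Zp_carrier: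
  "u \<in> carrier (roots_Zp p) \<longleftrightarrow> u \<in> Units (Zp p) \<and> (\<exists>n::nat. 0 < n \<and> u [^]\<^bsub>Zp p\<^esub> n = \<one>\<^bsub>Zp p\<^esub>)"
  by (simp add: roots_Zp_def)

lemma roots_Zp_mult [simp]: "x \<otimes>\<^bsub>roots_Zp p\<^esub> y = x \<otimes>\<^bsub>Zp p\<^esub> y"
  by (simp add: roots_Zp_def units_of_def)

lemma roots_subgroup:
  assumes "0 < p"
  shows "subgroup (carrier (roots_Zp p)) (units_of (Zp p))"
proof -
  interpret Z: comm_monoid "Zp p"
    using assms by (rule Zp_comm_monoid)
  interpret U: comm_group "units_of (Zp p)"
    by (rule Z.units_comm_group)
  show ?thesis
  proof (rule U.subgroupI)
    show "carrier (roots_Zp p) \<subseteq> carrier (units_of (Zp p))"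
      by (auto simp: roots_Zp_carrier units_of_carrier)
    have "\<one>\<^bsub>Zp p\<^esub> \<in> carrier (roots_Zp p)"
      by (auto simp: roots_Zp_carrier intro: exI[of _ 1])
    then show "carrier (roots_Zp p) \<noteq> {}"
      by blast
  next
    fix a assume "a \<in> carrier (roots_Zp p)"
    then obtain n :: nat where a: "a \<in> Units (Zp p)" "0 < n" "a [^]\<^bsub>Zp p\<^esub> n = \<one>\<^bsub>Zp p\<^esub>"
      by (auto simp: roots_Zp_carrier)
    have "(a \<otimes>\<^bsub>Zp p\<^esub> inv\<^bsub>Zp p\<^esub> a) [^]\<^bsub>Zp p\<^esub> n = \<one>\<^bsub>Zp p\<^esub>"
      using a by simp
    then have "(inv\<^bsub>Zp p\<^esub> a) [^]\<^bsub>Zp p\<^esub> n = \<one>\<^bsub>Zp p\<^esub>"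
      using a Z.nat_pow_distrib[of a "inv\<^bsub>Zp p\<^esub> a" n]
      by (simp del: Z.Units_r_inv add: Z.Units_closed)
    then show "inv\<^bsub>units_of (Zp p)\<^esub> a \<in> carrier (roots_Zp p)"
      using a by (auto simp: roots_Zp_carrier Z.units_of_inv)
  next
    fix a b assume "a \<in> carrier (roots_Zp p)" "b \<in> carrier (roots_Zp p)"
    then obtain m n :: nat where a: "a \<in> Units (Zp p)" "0 < m" "a [^]\<^bsub>Zp p\<^esub> m = \<one>\<^bsub>Zp p\<^esub>"
      and b: "b \<in> Units (Zp p)" "0 < n" "b [^]\<^bsub>Zp p\<^esub> n = \<one>\<^bsub>Zp p\<^esub>"
      by (auto simp: roots_Zp_carrier)
    have "a [^]\<^bsub>Zp p\<^esub> (m * n) = \<one>\<^bsub>Zp p\<^esub>" "b [^]\<^bsub>Zp p\<^esub> (n * m) = \<one>\<^bsub>Zp p\<^esub>"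
      using a(3) b(3) Z.nat_pow_pow[OF Z.Units_closed[OF a(1)], of m n]
        Z.nat_pow_pow[OF Z.Units_closed[OF b(1)], of n m] by (metis Z.nat_pow_one)+
    then have "(a \<otimes>\<^bsub>Zp p\<^esub> b) [^]\<^bsub>Zp p\<^esub> (m * n) = \<one>\<^bsub>Zp p\<^esub>"
      using a b by (simp add: Z.nat_pow_distrib Z.Units_closed mult.commute)
    then show "a \<otimes>\<^bsub>units_of (Zp p)\<^esub> b \<in> carrier (roots_Zp p)"
      using a b by (auto simp: roots_Zp_carrier units_of_mult intro!: exI[of _ "m * n"])
  qed
qed

lemma roots_Zp_eq: "roots_Zp p = (units_of (Zp p))\<lparr>carrier := carrier (roots_Zp p)\<rparr>"
  by (simp add: roots_Zp_def)

lemma roots_group: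
  assumes "0 < p"
  shows "group (roots_Zp p)"
proof -
  interpret Z: comm_monoid "Zp p"
    using assms by (rule Zp_comm_monoid)
  interpret U: comm_group "units_of (Zp p)"
    by (rule Z.units_comm_group)
  show ?thesis
    using U.subgroup_imp_group[OF roots_subgroup[OF assms]] roots_Zp_eq by metis
qed

text \<open>The subgroup generated by \<open>r\<close> consists of powers taken in
  \<open>roots_Zp p\<close>, whereas \<open>sample_point\<close> takes powers in
  \<open>units_of (Zp p)\<close>; this identifies the two.\<close>

lemma roots_int_pow:
  assumes "0 < p" "r \<in> carrier (roots_Zp p)"
  shows "r [^]\<^bsub>roots_Zp p\<^esub> (k::int) = r [^]\<^bsub>units_of (Zp p)\<^esub> k"
proof -
  interpret Z: comm_monoid "Zp p"
    using assms(1) by (rule Zp_comm_monoid)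
  interpret U: comm_group "units_of (Zp p)"
    by (rule Z.units_comm_group)
  show ?thesis
    using U.int_pow_consistent[OF roots_subgroup[OF assms(1)] assms(2), of k] roots_Zp_eq by metis
qed

text \<open>The representative is the p-adic limit of \<open>u ^ (p ^ n)\<close>, whose
  \<open>n\<close>-th term already has the right residue modulo \<open>p ^ n\<close>. Euler's
  theorem makes these residues coherent and their power with exponent \<open>p - 1\<close> equal to
  1; Fermat's theorem gives the residue modulo \<open>p\<close>. At \<open>m = 0\<close> the only
  residue is 0, hence \<open>m \<ge> 1\<close>.\<close>

lemma Zp_teichmueller:
  assumes p: "prime p" and u: "\<not> p dvd u"
  shows "\<exists>\<omega>\<in>carrier (roots_Zp p). \<forall>m\<ge>1. \<omega> m mod int p = int u mod int p"
proof -
  define \<omega> where "\<omega> n = int (u ^ (p ^ n)) mod int p ^ n" for n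
  have euler: "[u ^ (p ^ n * (p - 1)) = 1] (mod p ^ n)" for n
  proof (cases n)
    case (Suc k)
    have "coprime u (p ^ n)"
      using p u by (simp add: coprime_commute prime_imp_coprime coprime_power_right_iff)
    then have "[u ^ totient (p ^ n) = 1] (mod p ^ n)"
      by (rule euler_theorem)
    then have "[u ^ (p ^ k * (p - 1)) = 1] (mod p ^ n)"
      unfolding Suc totient_prime_power_Suc[OF p] .
    then have "[(u ^ (p ^ k * (p - 1))) ^ p = 1 ^ p] (mod p ^ n)"
      by (rule cong_pow)
    then show ?thesis
      by (simp add: Suc mult_ac flip: power_mult)
  qed simp
  have carr: "\<omega> \<in> carrier (Zp p)"
  proof (rule Zp_carrierI)
    show "0 < p"
      using p by (rule prime_gt_0_nat)
    fix n
    have "p ^ Suc n = p ^ n * (p - 1) + p ^ n"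
      using prime_gt_0_nat[OF p] by (cases p) (simp_all add: algebra_simps)
    then have "u ^ (p ^ Suc n) = u ^ (p ^ n * (p - 1)) * u ^ (p ^ n)"
      by (simp only: power_add)
    also have "[\<dots> = 1 * u ^ (p ^ n)] (mod p ^ n)"
      using euler by (rule cong_mult) simp
    finally have "[int (u ^ (p ^ Suc n)) = int (u ^ (p ^ n))] (mod int (p ^ n))"
      by (simp only: cong_int_iff mult_1)
    then show "\<omega> (Suc n) mod int p ^ n = \<omega> n"
      unfolding \<omega>_def mod_power_Suc by (simp add: cong_def)
  qed
  have "\<omega> [^]\<^bsub>Zp p\<^esub> (p - 1) = \<one>\<^bsub>Zp p\<^esub>"
  proof
    fix n
    have "(\<omega> [^]\<^bsub>Zp p\<^esub> (p - 1)) n = int (u ^ (p ^ n * (p - 1))) mod int (p ^ n)"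
      by (simp add: Zp_pow_apply \<omega>_def power_mod power_mult)
    also have "\<dots> = 1 mod int (p ^ n)"
      using euler[of n] by (metis cong_def cong_int_iff of_nat_1)
    finally show "(\<omega> [^]\<^bsub>Zp p\<^esub> (p - 1)) n = \<one>\<^bsub>Zp p\<^esub> n"
      by (simp add: Zp_one_apply)
  qed
  moreover have "0 < p - 1"
    using prime_gt_1_nat[OF p] by simp
  ultimately have "\<omega> \<in> carrier (roots_Zp p)"
    using pow_eq_one_imp_unit[OF Zp_comm_monoid[OF prime_gt_0_nat[OF p]] carr]
    unfolding roots_Zp_carrier by blast
  moreover have "\<omega> m mod int p = int u mod int p" if "m \<ge> 1" for m
  proof -
    have "\<omega> m mod int p ^ 1 = \<omega> 1"
      using carr that by (rule Zp_mod_le)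
    moreover have "[u ^ (p - 1) * u = 1 * u] (mod p)"
      using fermat_theorem[OF p u] by (rule cong_mult) simp
    then have "[u ^ p = u] (mod p)"
      unfolding power_minus_mult[OF prime_gt_0_nat[OF p]] by simp
    then have "int (u ^ p) mod int p = int u mod int p"
      by (metis cong_def cong_int_iff)
    ultimately show ?thesis
      by (simp add: \<omega>_def)
  qed
  ultimately show ?thesis
    by blast
qed

text \<open>If \<open>u \<noteq> v\<close> agree exactly to order \<open>k\<close>, say \<open>u = v + p ^ k * w\<close>, then
  \<open>u ^ N - v ^ N = N * v ^ (N - 1) * p ^ k * w\<close> modulo \<open>p ^ (2 * k)\<close>, which is non-zero as soon as
  \<open>p ^ k\<close> exceeds \<open>N\<close>.\<close>

lemma roots_determined_by_residue:
  fixes N :: nat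
  assumes p: "prime p" and u: "u \<in> carrier (Zp p)" "u [^]\<^bsub>Zp p\<^esub> N = \<one>\<^bsub>Zp p\<^esub>"
    and v: "v \<in> carrier (Zp p)" "v [^]\<^bsub>Zp p\<^esub> N = \<one>\<^bsub>Zp p\<^esub>"
    and N: "0 < N" "u N = v N"
  shows "u = v"
proof (rule ccontr)
  assume "u \<noteq> v"
  then obtain m where m: "u m \<noteq> v m"
    by blast
  \<comment> \<open>Counting from \<open>Suc j\<close> makes \<open>k\<close> the exact order of
    agreement: equal residues modulo \<open>p ^ k\<close>, different ones modulo
    \<open>p ^ Suc k\<close>.\<close>
  define k where "k = (LEAST j. u (Suc j) \<noteq> v (Suc j))"
  have p1: "1 < p"
    using p by (rule prime_gt_1_nat)
  have zero: "w 0 = 0" if "w \<in> carrier (Zp p)" for w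
    using that Zp_mod_self[of w p 0] by simp
  have "m \<noteq> 0"
    using m zero[OF u(1)] zero[OF v(1)] by (cases m) auto
  then have "u (Suc (m - 1)) \<noteq> v (Suc (m - 1))"
    using m by simp
  then have k: "u (Suc k) \<noteq> v (Suc k)"
    unfolding k_def by (rule LeastI)
  \<comment> \<open>Here the equality \<open>u N = v N\<close> enters. The divisibility at the end
    will force \<open>p ^ k \<le> N\<close>, hence \<open>k < N\<close>.\<close>
  have N_le: "N \<le> k"
  proof (rule ccontr)
    assume "\<not> N \<le> k"
    then have "u (Suc k) = v (Suc k)"
      using Zp_mod_le[OF u(1), of "Suc k" N] Zp_mod_le[OF v(1), of "Suc k" N] N(2) by simp
    then show False
      using k by simp
  qed
  then have k0: "0 < k"
    using N by simp
  have "u (Suc (k - 1)) = v (Suc (k - 1))"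
    using not_less_Least[of "k - 1" "\<lambda>j. u (Suc j) \<noteq> v (Suc j)"] k0 unfolding k_def[symmetric] by simp
  then have uvk: "u k = v k"
    using k0 by simp
  let ?u = "u (2 * k)" and ?v = "v (2 * k)" and ?P = "int p ^ k"
  have "?u mod ?P = ?v mod ?P"
    using Zp_mod_le[OF u(1), of k "2 * k"] Zp_mod_le[OF v(1), of k "2 * k"] uvk by simp
  then obtain w where w: "?u = ?v + ?P * w"
    by (metis mod_eqE)
  have "\<not> int p dvd w"
  proof
    assume "int p dvd w"
    then have "?u mod int p ^ Suc k = ?v mod int p ^ Suc k"
      unfolding w mod_eq_dvd_iff by (simp add: mult_dvd_mono mult.commute[of "int p"])
    then show False
      using k k0 Zp_mod_le[OF u(1), of "Suc k" "2 * k"] Zp_mod_le[OF v(1), of "Suc k" "2 * k"] by simp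
  qed
  have pow: "?u ^ N mod int p ^ (2 * k) = 1 mod int p ^ (2 * k)"
    "?v ^ N mod int p ^ (2 * k) = 1 mod int p ^ (2 * k)"
    using fun_cong[OF u(2), of "2 * k"] fun_cong[OF v(2), of "2 * k"]
    by (simp_all add: Zp_pow_apply Zp_one_apply)
  have "\<not> int p dvd ?v"
  proof
    assume "int p dvd ?v"
    then have "int p dvd ?v ^ N"
      using N by (simp add: dvd_power_iff_le prime_dvd_power_iff p)
    moreover have "int p dvd int p ^ (2 * k)"
      using k0 by simp
    moreover have "int p ^ (2 * k) dvd ?v ^ N - 1"
      using pow(2) by (simp add: mod_eq_dvd_iff)
    ultimately have "int p dvd 1"
      by (metis dvd_diff_right_iff dvd_trans)
    then show False
      using p1 by simp
  qed
  have binom: "int p ^ (2 * k) dvd (?v + ?P * w) ^ N - ?v ^ N - int N * ?v ^ (N - 1) * (?P * w)"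
  proof -
    \<comment> \<open>Binomial expansion to first order. The remainder carries
      \<open>b\<^sup>2\<close>, which for \<open>b = ?P * w\<close> is a multiple of
      \<open>p ^ (2 * k)\<close>.\<close>
    have "\<exists>c. (a + b) ^ n = a ^ n + int n * a ^ (n - 1) * b + b\<^sup>2 * c" for a b :: int and n
    proof (induction n)
      case (Suc n)
      then obtain c where c: "(a + b) ^ n = a ^ n + int n * a ^ (n - 1) * b + b\<^sup>2 * c"
        by blast
      have "n = 0 \<or> a * a ^ (n - 1) = a ^ n"
        by (cases n) auto
      then have "(a + b) ^ Suc n = a ^ Suc n + int (Suc n) * a ^ (Suc n - 1) * b
          + b\<^sup>2 * (int n * a ^ (n - 1) + (a + b) * c)"
        by (auto simp: c algebra_simps power2_eq_square)
      then show ?case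
        by blast
    qed simp
    then obtain c where "(?v + ?P * w) ^ N = ?v ^ N + int N * ?v ^ (N - 1) * (?P * w) + (?P * w)\<^sup>2 * c"
      by blast
    then have "(?v + ?P * w) ^ N - ?v ^ N - int N * ?v ^ (N - 1) * (?P * w) = int p ^ (2 * k) * (w\<^sup>2 * c)"
      by (simp add: power_mult_distrib power_mult[of _ 2 k] mult.assoc mult.commute[of 2 k] flip: power_mult)
    then show ?thesis
      by simp
  qed
  have "int p ^ (2 * k) dvd ?u ^ N - ?v ^ N"
    using pow by (simp add: mod_eq_dvd_iff[symmetric])
  then have "int p ^ (2 * k) dvd int N * ?v ^ (N - 1) * (?P * w)"
    using binom unfolding w by (metis dvd_diff_commute dvd_diff_right_iff)
  moreover have "int p ^ (2 * k) = ?P * ?P"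
    by (simp add: mult_2 power_add)
  moreover have "int N * ?v ^ (N - 1) * (?P * w) = ?P * (int N * ?v ^ (N - 1) * w)"
    by (simp only: mult_ac)
  ultimately have "?P * ?P dvd ?P * (int N * ?v ^ (N - 1) * w)"
    by (simp only:)
  moreover have "?P \<noteq> 0"
    using p1 by simp
  ultimately have "?P dvd int N * ?v ^ (N - 1) * w"
    using dvd_times_left_cancel_iff by blast
  moreover have "coprime (int p ^ k) (?v ^ (N - 1) * w)"
    using \<open>\<not> int p dvd w\<close> \<open>\<not> int p dvd ?v\<close> p
    by (simp add: coprime_mult_right_iff prime_imp_coprime)
  ultimately have "?P dvd int N"
    by (metis coprime_dvd_mult_left_iff mult.assoc)
  then have "p ^ k dvd N"
    by (metis of_nat_dvd_iff of_nat_power)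
  then have "p ^ k \<le> N"
    using N by (intro dvd_imp_le)
  moreover have "k < p ^ k"
    using p1 by (intro power_gt_expt) simp
  ultimately show False
    using N_le by simp
qed

text \<open>A root \<open>u\<close> is coded by an exponent \<open>N u\<close> that sends it to 1
  and by its residue at the same level \<open>N u\<close>; the code is injective by
  \<open>roots_determined_by_residue\<close>. Countability of the index set is what lets the
  operators be carried over to the type of the crossed product.\<close>

lemma countable_roots:
  assumes "prime p"
  shows "countable (carrier (roots_Zp p))"
proof -
  define N where "N u = (SOME n::nat. 0 < n \<and> u [^]\<^bsub>Zp p\<^esub> n = \<one>\<^bsub>Zp p\<^esub>)" for u
  have N: "0 < N u \<and> u [^]\<^bsub>Zp p\<^esub> N u = \<one>\<^bsub>Zp p\<^esub>" if "u \<in> carrier (roots_Zp p)" for u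
    unfolding N_def by (rule someI_ex) (use that in \<open>auto simp: roots_Zp_carrier\<close>)
  have "inj_on (\<lambda>u. (N u, u (N u))) (carrier (roots_Zp p))"
  proof (rule inj_onI)
    fix u v assume uv: "u \<in> carrier (roots_Zp p)" "v \<in> carrier (roots_Zp p)"
      "(N u, u (N u)) = (N v, v (N v))"
    then show "u = v"
      using roots_determined_by_residue[of p u "N u" v] N[of u] N[of v] assms
      by (auto simp: roots_Zp_carrier Units_def)
  qed
  then show ?thesis
    by (rule countableI')
qed

lemma countable_roots_quotient: "prime p \<Longrightarrow> countable (carrier (roots_quotient p r))"
  by (simp add: roots_quotient_def carrier_FactGroup countable_roots)

section \<open>The sample points and their density\<close>

lemma sample_point_closed:
  assumes "0 < p" "r \<in> carrier (roots_Zp p)" "is_section p r \<gamma>" "c \<in> carrier (roots_quotient p r)"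
  shows "sample_point p r \<gamma> k L c x \<in> carrier (Zp p)"
proof -
  interpret Z: comm_monoid "Zp p"
    using assms(1) by (rule Zp_comm_monoid)
  interpret U: comm_group "units_of (Zp p)"
    by (rule Z.units_comm_group)
  have "r [^]\<^bsub>units_of (Zp p)\<^esub> k \<in> Units (Zp p)"
    using U.int_pow_closed[of r k] assms(2) by (simp add: units_of_carrier roots_Zp_carrier)
  moreover have "\<gamma> c \<in> carrier (Zp p)"
    using assms(3,4) Z.Units_closed by (auto simp: is_section_def roots_Zp_carrier Pi_iff)
  ultimately show ?thesis
    using assms(1) by (simp add: sample_point_def Zp_of_int_closed Z.Units_closed)
qed

text \<open>Write a nonzero residue as \<open>p ^ L * u\<close> with \<open>u\<close> prime to
  \<open>p\<close>, and let \<omega> be the Teichmueller representative of \<open>u\<close>. Then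
  u/\<omega> is 1 modulo \<open>p\<close>, so it has the form 1 + p t, while \<omega> is a power of
  \<open>r\<close> times the section value of its coset.\<close>

lemma sample_point_approximates:
  assumes p: "prime p" and r: "r \<in> carrier (roots_Zp p)" and \<gamma>: "is_section p r \<gamma>"
    and x: "x \<in> carrier (Zp p)"
  shows "\<exists>k L. \<exists>c\<in>carrier (roots_quotient p r). \<exists>t. sample_point p r \<gamma> k L c t m = x m"
proof -
  have p0: "0 < p"
    using p by (rule prime_gt_0_nat)
  interpret Z: comm_monoid "Zp p"
    using p0 by (rule Zp_comm_monoid)
  interpret R: group "roots_Zp p"
    using p0 by (rule roots_group)
  define H where "H = generate (roots_Zp p) {r}"
  have H: "subgroup H (roots_Zp p)"
    unfolding H_def using r by (intro R.generate_is_subgroup) simp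
  have coset: "H #>\<^bsub>roots_Zp p\<^esub> \<omega> \<in> carrier (roots_quotient p r)" if "\<omega> \<in> carrier (roots_Zp p)" for \<omega>
    using that by (auto simp: roots_quotient_def carrier_FactGroup H_def)
  show ?thesis
  proof (cases "x m = 0")
    case True
    \<comment> \<open>With \<open>L = m\<close> the factor \<open>p ^ m\<close> vanishes at level
      \<open>m\<close>, whatever the other factors are.\<close>
    have "sample_point p r \<gamma> 0 m (H #>\<^bsub>roots_Zp p\<^esub> \<one>\<^bsub>roots_Zp p\<^esub>) 0 m = 0"
      by (simp add: sample_point_def Zp_mult_apply Zp_of_int_def)
    then show ?thesis
      using coset[OF R.one_closed] True by metis
  next
    case False
    then have pos: "0 < x m" "x m < int p ^ m"
      using x by (auto simp: Zp_carrier_iff order_less_le)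
    then have m: "m \<ge> 1"
      by (cases m) auto
    define L where "L = multiplicity p (nat (x m))"
    have "\<not> is_unit p"
      using prime_gt_1_nat[OF p] by auto
    then obtain u where u: "nat (x m) = p ^ L * u" "\<not> p dvd u"
      using multiplicity_decompose'[of "nat (x m)" p] pos unfolding L_def by auto
    have xm: "x m = int p ^ L * int u"
      using u(1) pos by (metis int_nat_eq of_nat_mult of_nat_power order_less_imp_le)
    obtain \<omega> where \<omega>: "\<omega> \<in> carrier (roots_Zp p)" "\<omega> m mod int p = int u mod int p"
      using Zp_teichmueller[OF p u(2)] m by blast
    have \<omega>U: "\<omega> \<in> Units (Zp p)"
      using \<omega> by (simp add: roots_Zp_carrier)
    \<comment> \<open>\<open>v\<close> is an integer inverse of \<omega> modulo
      \<open>p ^ m\<close>. Thus \<open>int u * v = 1 + int p * t\<close> holds exactly, with the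
      integer \<open>t\<close> that a sample point requires.\<close>
    define v where "v = (inv\<^bsub>Zp p\<^esub> \<omega>) m"
    have \<omega>v: "(\<omega> m * v) mod int p ^ m = 1 mod int p ^ m"
      using fun_cong[OF Z.Units_r_inv[OF \<omega>U], of m] by (simp add: Zp_mult_apply Zp_one_apply v_def)
    have "(int u * v) mod int p = (\<omega> m * v) mod int p"
      using \<omega>(2) by (metis mod_mult_left_eq)
    also have "\<dots> = ((\<omega> m * v) mod int p ^ m) mod int p"
      using m by (simp add: mod_mod_cancel)
    also have "\<dots> = 1 mod int p"
      using m unfolding \<omega>v by (simp add: mod_mod_cancel)
    finally obtain t where t: "int u * v = 1 + int p * t"
      by (metis mod_eqE)
    let ?c = "H #>\<^bsub>roots_Zp p\<^esub> \<omega>"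
    have "\<omega> \<in> ?c"
      using \<omega>(1) H by (rule R.rcos_self)
    moreover have "H #>\<^bsub>roots_Zp p\<^esub> \<gamma> ?c = ?c"
      using \<gamma> coset[OF \<omega>(1)] by (simp add: is_section_def H_def)
    ultimately have "\<omega> \<in> H #>\<^bsub>roots_Zp p\<^esub> \<gamma> ?c"
      by simp
    then obtain h where h: "h \<in> H" "\<omega> = h \<otimes>\<^bsub>Zp p\<^esub> \<gamma> ?c"
      by (auto simp: r_coset_def)
    obtain k :: int where "h = r [^]\<^bsub>roots_Zp p\<^esub> k"
      using h(1) R.generate_pow[OF r] unfolding H_def by auto
    then have hk: "h = r [^]\<^bsub>units_of (Zp p)\<^esub> k"
      using roots_int_pow[OF p0 r] by simp
    have "sample_point p r \<gamma> k L ?c t m = (h m * int p ^ L * (\<gamma> ?c m * (1 + int p * t))) mod int p ^ m"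
      unfolding sample_point_def Zp_mult_apply Zp_of_int_def hk
      by (simp add: mod_mult_left_eq mod_mult_right_eq mult.assoc)
    also have "\<dots> = ((h m * \<gamma> ?c m) * (int p ^ L * (int u * v))) mod int p ^ m"
      unfolding t by (simp only: mult_ac)
    also have "\<dots> = (\<omega> m * (int p ^ L * (int u * v))) mod int p ^ m"
      by (subst (2) h(2)) (simp add: Zp_mult_apply mod_mult_left_eq)
    also have "\<dots> = ((\<omega> m * v) * (int p ^ L * int u)) mod int p ^ m"
      by (simp only: mult_ac)
    also have "\<dots> = ((\<omega> m * v) mod int p ^ m * (int p ^ L * int u)) mod int p ^ m"
      by (simp only: mod_mult_left_eq)
    also have "\<dots> = x m mod int p ^ m"
      unfolding \<omega>v xm by (simp add: mod_mult_left_eq)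
    also have "\<dots> = x m"
      using x by (rule Zp_mod_self)
    finally show ?thesis
      using coset[OF \<omega>(1)] by blast
  qed
qed

section \<open>Topology of the p-adic integers\<close>

lemma compact_Zp: "compact (carrier (Zp p))"
proof -
  let ?B = "PiE UNIV (\<lambda>n. {0..<int p ^ n})"
  have "compactin (product_topology (\<lambda>n. euclidean) UNIV) ?B"
    by (simp add: compactin_PiE compactin_euclidean_iff finite_imp_compact)
  then have B: "compact ?B"
    by (simp add: euclidean_product_topology compactin_euclidean_iff)
  have "closed {a :: nat \<Rightarrow> int. a (Suc n) mod int p ^ n = a n}" for n
  proof (rule closed_Collect_eq)
    have "continuous_on UNIV ((\<lambda>i. i mod int p ^ n) \<circ> (\<lambda>a :: nat \<Rightarrow> int. a (Suc n)))"
      by (intro continuous_on_compose continuous_on_product_coordinates) simp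
    then show "continuous_on UNIV (\<lambda>a :: nat \<Rightarrow> int. a (Suc n) mod int p ^ n)"
      by (simp add: o_def)
  qed (rule continuous_on_product_coordinates)
  then have "closed (\<Inter>n. {a :: nat \<Rightarrow> int. a (Suc n) mod int p ^ n = a n})"
    by (intro closed_INT) simp
  then have "compact (?B \<inter> (\<Inter>n. {a :: nat \<Rightarrow> int. a (Suc n) mod int p ^ n = a n}))"
    by (rule compact_Int_closed[OF B])
  moreover have "carrier (Zp p) = ?B \<inter> (\<Inter>n. {a :: nat \<Rightarrow> int. a (Suc n) mod int p ^ n = a n})"
    by (auto simp: Zp_carrier_iff PiE_iff)
  ultimately show ?thesis
    by simp
qed

lemma continuous_on_Zp_mult:
  "continuous_on (carrier (Zp p)) (\<lambda>x. x \<otimes>\<^bsub>Zp p\<^esub> a)"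
proof (rule continuous_on_coordinatewise_then_product)
  fix n
  have "continuous_on (carrier (Zp p)) ((\<lambda>i. (i * a n) mod int p ^ n) \<circ> (\<lambda>x. x n))"
    by (intro continuous_on_compose continuous_on_subset[OF continuous_on_product_coordinates subset_UNIV]) simp
  then show "continuous_on (carrier (Zp p)) (\<lambda>x. (x \<otimes>\<^bsub>Zp p\<^esub> a) n)"
    by (simp add: o_def Zp_mult_apply)
qed

text \<open>Density is asked level by level: agreement at level \<open>m\<close> entails agreement
  at all lower levels, so points of \<open>D\<close> that match \<open>x\<close> at level
  \<open>m\<close> converge to \<open>x\<close> coordinatewise.\<close>

lemma Zp_dense_bound:
  fixes f :: "(nat \<Rightarrow> int) \<Rightarrow> complex"
  assumes f: "continuous_on (carrier (Zp p)) f" and D: "D \<subseteq> carrier (Zp p)"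
    and dense: "\<And>x m. x \<in> carrier (Zp p) \<Longrightarrow> \<exists>d\<in>D. d m = x m"
    and bound: "\<And>d. d \<in> D \<Longrightarrow> cmod (f d) \<le> K" and x: "x \<in> carrier (Zp p)"
  shows "cmod (f x) \<le> K"
proof -
  obtain s where s: "\<And>m. s m \<in> D" "\<And>m. s m m = x m"
    using dense[OF x] by metis
  have sc: "s m \<in> carrier (Zp p)" for m
    using s(1) D by blast
  have "s \<longlonglongrightarrow> x"
  proof -
    have "limitin (product_topology (\<lambda>n. euclidean) UNIV) s x sequentially"
      unfolding limitin_componentwise
    proof (intro conjI ballI)
      fix n
      have "s m n = x n" if "m \<ge> n" for m
        using Zp_mod_le[OF sc that, of m] Zp_mod_le[OF x that] s(2)[of m] by simp
      then have "\<forall>\<^sub>F m in sequentially. s m n = x n"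
        using eventually_sequentially by blast
      then show "limitin euclidean (\<lambda>m. s m n) (x n) sequentially"
        by (simp add: tendsto_eventually)
    qed (auto simp: extensional_def)
    then show ?thesis
      by (simp add: euclidean_product_topology)
  qed
  then have "(\<lambda>m. f (s m)) \<longlonglongrightarrow> f x"
    using f sc x by (intro continuous_on_tendsto_compose[OF f]) auto
  then show ?thesis
    using bound s(1) by (intro LIMSEQ_le_const2[OF tendsto_norm]) auto
qed

section \<open>Covariant pairs\<close>

lemma CZp_carrier:
  "f \<in> carrier (CZp p) \<longleftrightarrow> f \<in> extensional (carrier (Zp p)) \<and> continuous_on (carrier (Zp p)) f"
  by (simp add: CZp_def)

lemma CZp_apply:
  assumes "x \<in> carrier (Zp p)"
  shows "(f \<otimes>\<^bsub>CZp p\<^esub> g) x = f x * g x" "\<one>\<^bsub>CZp p\<^esub> x = 1" "(f \<oplus>\<^bsub>CZp p\<^esub> g) x = f x + g x"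
    "\<zero>\<^bsub>CZp p\<^esub> x = 0" "(c \<odot>\<^bsub>CZp p\<^esub> f) x = c * f x" "adj (CZp p) f x = cnj (f x)"
  using assms by (simp_all add: CZp_def)

lemma CZp_restrict: "continuous_on (carrier (Zp p)) f \<Longrightarrow> restrict f (carrier (Zp p)) \<in> carrier (CZp p)"
  by (simp add: CZp_carrier cong: continuous_on_cong)

lemma CZp_closed:
  "\<lbrakk>f \<in> carrier (CZp p); g \<in> carrier (CZp p)\<rbrakk> \<Longrightarrow> f \<otimes>\<^bsub>CZp p\<^esub> g \<in> carrier (CZp p)"
  "\<lbrakk>f \<in> carrier (CZp p); g \<in> carrier (CZp p)\<rbrakk> \<Longrightarrow> f \<oplus>\<^bsub>CZp p\<^esub> g \<in> carrier (CZp p)"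
  "f \<in> carrier (CZp p) \<Longrightarrow> c \<odot>\<^bsub>CZp p\<^esub> f \<in> carrier (CZp p)"
  "f \<in> carrier (CZp p) \<Longrightarrow> adj (CZp p) f \<in> carrier (CZp p)"
  "\<one>\<^bsub>CZp p\<^esub> \<in> carrier (CZp p)" "\<zero>\<^bsub>CZp p\<^esub> \<in> carrier (CZp p)"
  unfolding CZp_def
  by (auto intro!: CZp_restrict[unfolded CZp_def, simplified] continuous_intros)

lemma CZp_eqI:
  assumes "f \<in> carrier (CZp p)" "g \<in> carrier (CZp p)" "\<And>x. x \<in> carrier (Zp p) \<Longrightarrow> f x = g x"
  shows "f = g"
  using assms by (auto simp: CZp_carrier intro: extensionalityI)

lemma CZp_bounded:
  assumes "f \<in> carrier (CZp p)"
  shows "\<exists>K\<ge>0. \<forall>x\<in>carrier (Zp p). cmod (f x) \<le> K"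
proof -
  have "bounded (f ` carrier (Zp p))"
    using assms compact_continuous_image[OF _ compact_Zp] compact_imp_bounded
    by (auto simp: CZp_carrier)
  then obtain K where "\<forall>x\<in>carrier (Zp p). cmod (f x) \<le> K"
    by (auto simp: bounded_iff)
  then show ?thesis
    by (intro exI[of _ "max K 0"]) fastforce
qed

lemma alpha_closed:
  assumes "0 < p" "r \<in> Units (Zp p)" "f \<in> carrier (CZp p)"
  shows "alpha p r f \<in> carrier (CZp p)"
proof -
  interpret Z: comm_monoid "Zp p"
    using assms(1) by (rule Zp_comm_monoid)
  have "continuous_on (carrier (Zp p)) (f \<circ> (\<lambda>x. x \<otimes>\<^bsub>Zp p\<^esub> inv\<^bsub>Zp p\<^esub> r))"
    using assms by (intro continuous_on_compose continuous_on_Zp_mult)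
      (auto simp: CZp_carrier intro!: continuous_on_subset[of "carrier (Zp p)" f])
  then show ?thesis
    unfolding alpha_def by (intro CZp_restrict) (simp add: o_def)
qed

lemma alpha_inverse:
  assumes "0 < p" "r \<in> Units (Zp p)" "f \<in> carrier (CZp p)"
  shows "alpha p r (alpha p (inv\<^bsub>Zp p\<^esub> r) f) = f"
proof -
  interpret Z: comm_monoid "Zp p"
    using assms(1) by (rule Zp_comm_monoid)
  show ?thesis
    using assms by (intro CZp_eqI[of _ p] alpha_closed)
      (auto simp: alpha_def Z.m_assoc Z.Units_closed)
qed

text \<open>The modulus \<open>n = 0\<close> covers the crossed product by \<open>\<int>\<close>: then \<open>V\<^sup>n = 1\<close> holds trivially and
  \<open>k mod n = k\<close>.\<close>

definition crossed_relations ::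
  "nat \<Rightarrow> (nat \<Rightarrow> int) \<Rightarrow> nat \<Rightarrow> 'a cstar \<Rightarrow> (((nat \<Rightarrow> int) \<Rightarrow> complex) \<Rightarrow> 'a) \<Rightarrow> 'a \<Rightarrow> bool" where
  "crossed_relations p r n A M V \<longleftrightarrow> star_hom (CZp p) A M \<and> V \<in> carrier A \<and>
     adj A V \<otimes>\<^bsub>A\<^esub> V = \<one>\<^bsub>A\<^esub> \<and> V \<otimes>\<^bsub>A\<^esub> adj A V = \<one>\<^bsub>A\<^esub> \<and>
     V [^]\<^bsub>A\<^esub> n = \<one>\<^bsub>A\<^esub> \<and>
     (\<forall>f \<in> carrier (CZp p). V \<otimes>\<^bsub>A\<^esub> M f \<otimes>\<^bsub>A\<^esub> adj A V = M (alpha p r f))"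

lemma cyclic_relations_eq: "cyclic_relations p r = crossed_relations p r (root_ord p r)"
  by (intro ext) (simp add: cyclic_relations_def crossed_relations_def)

lemma alpha_one:
  assumes "0 < p" "r \<in> Units (Zp p)"
  shows "alpha p r \<one>\<^bsub>CZp p\<^esub> = \<one>\<^bsub>CZp p\<^esub>"
proof -
  interpret Z: comm_monoid "Zp p"
    using assms(1) by (rule Zp_comm_monoid)
  show ?thesis
    using assms by (intro CZp_eqI[of _ p] alpha_closed CZp_closed) (auto simp: alpha_def CZp_apply)
qed

text \<open>The constant function 1 is fixed by \<open>alpha\<close>, so the covariance relation at
  1 reads \<open>V \<otimes> adj A V = \<one>\<close> and the isometry is unitary. This is why the
  crossed products by \<nat> and by \<int> agree.\<close>

lemma N_relations_iff:
  assumes "cstar_algebra A" "0 < p" "r \<in> Units (Zp p)"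
  shows "N_relations p r A M V \<longleftrightarrow> crossed_relations p r 0 A M V"
proof
  interpret cstar_algebra A by fact
  assume N: "N_relations p r A M V"
  then have M: "star_hom (CZp p) A M" and V: "V \<in> carrier A"
    by (simp_all add: N_relations_def)
  have "V \<otimes>\<^bsub>A\<^esub> M \<one>\<^bsub>CZp p\<^esub> \<otimes>\<^bsub>A\<^esub> adj A V = M \<one>\<^bsub>CZp p\<^esub>"
    using N CZp_closed(5) alpha_one[OF assms(2,3)] by (metis N_relations_def)
  then show "crossed_relations p r 0 A M V"
    using N V by (simp add: crossed_relations_def N_relations_def star_hom_one[OF M])
qed (simp add: N_relations_def crossed_relations_def)

lemma star_hom_nat_pow:
  assumes "cstar_algebra A" "cstar_algebra B" "star_hom A B h" "x \<in> carrier A"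
  shows "h (x [^]\<^bsub>A\<^esub> n) = h x [^]\<^bsub>B\<^esub> (n::nat)"
proof -
  interpret A: cstar_algebra A by fact
  interpret B: cstar_algebra B by fact
  show ?thesis
    using assms(4) by (induction n)
      (simp_all add: star_hom_one[OF assms(3)] star_hom_mult[OF assms(3)])
qed

lemma crossed_relations_transfer:
  assumes "cstar_algebra A" "cstar_algebra B" "star_hom A B h" "crossed_relations p r n A M V"
  shows "crossed_relations p r n B (h \<circ> M) (h V)"
proof -
  interpret A: cstar_algebra A by fact
  interpret B: cstar_algebra B by fact
  have M: "star_hom (CZp p) A M" and V: "V \<in> carrier A" "adj A V \<otimes>\<^bsub>A\<^esub> V = \<one>\<^bsub>A\<^esub>"
    "V \<otimes>\<^bsub>A\<^esub> adj A V = \<one>\<^bsub>A\<^esub>" "V [^]\<^bsub>A\<^esub> n = \<one>\<^bsub>A\<^esub>"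
    and cov: "\<And>f. f \<in> carrier (CZp p) \<Longrightarrow> V \<otimes>\<^bsub>A\<^esub> M f \<otimes>\<^bsub>A\<^esub> adj A V = M (alpha p r f)"
    using assms(4) by (auto simp: crossed_relations_def)
  have "h V \<otimes>\<^bsub>B\<^esub> h (M f) \<otimes>\<^bsub>B\<^esub> adj B (h V) = h (M (alpha p r f))" if "f \<in> carrier (CZp p)" for f
    using that V(1) star_hom_closed[OF M that]
    by (simp flip: cov star_hom_adj[OF assms(3)] star_hom_mult[OF assms(3)])
  then show ?thesis
    using star_hom_comp[OF M assms(3)] V star_hom_closed[OF assms(3)]
    by (simp add: crossed_relations_def flip: star_hom_adj[OF assms(3)] star_hom_mult[OF assms(3)]
        star_hom_nat_pow[OF assms(1-3)] star_hom_one[OF assms(3)])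
qed

section \<open>Density of subalgebras that contain the generators\<close>

context cstar_algebra
begin

lemma norm_finsum_le:
  assumes "finite J" "\<And>j. j \<in> J \<Longrightarrow> f j \<in> carrier A"
  shows "cnorm A (finsum A f J) \<le> (\<Sum>j\<in>J. cnorm A (f j))"
  using assms
proof (induction J rule: finite_induct)
  case (insert j J)
  then show ?case
    using norm_add[of "f j" "finsum A f J"] by (simp add: Pi_iff)
qed simp

text \<open>The norm closure \<open>S\<close> of \<open>T\<close> is a C*-subalgebra that contains
  the generators, hence everything.\<close>

lemma dense_cstar_subalgebra:
  assumes T: "T \<subseteq> carrier A" "\<one> \<in> T"
    and add: "\<And>s t. \<lbrakk>s \<in> T; t \<in> T\<rbrakk> \<Longrightarrow> s \<oplus> t \<in> T"
    and mult: "\<And>s t. \<lbrakk>s \<in> T; t \<in> T\<rbrakk> \<Longrightarrow> s \<otimes> t \<in> T"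
    and smult: "\<And>c t. t \<in> T \<Longrightarrow> c \<odot> t \<in> T"
    and adjoint: "\<And>t. t \<in> T \<Longrightarrow> adj A t \<in> T"
    and gen: "cstar_generated A G" "G \<subseteq> T" and a: "a \<in> carrier A" and e: "0 < e"
  shows "\<exists>t\<in>T. cnorm A (a \<ominus> t) < e"
proof -
  define S where "S = {a \<in> carrier A. \<forall>e>0. \<exists>t\<in>T. cnorm A (a \<ominus> t) < e}"
  have S_carrier: "S \<subseteq> carrier A"
    by (auto simp: S_def)
  have approx: "\<exists>t\<in>T. cnorm A (a \<ominus> t) < e" if "a \<in> S" "0 < e" for a e
    using that by (simp add: S_def)
  have Tc: "t \<in> carrier A" if "t \<in> T" for t
    using that T(1) by blast
  have "T \<subseteq> S"
    using Tc by (force simp: S_def a_minus_def r_neg)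
  have "cstar_subalgebra S A"
    unfolding cstar_subalgebra_def
  proof (intro conjI ballI allI impI)
    show "S \<subseteq> carrier A" "\<one> \<in> S"
      using \<open>T \<subseteq> S\<close> T(2) S_carrier by auto
  next
    fix x y assume xy: "x \<in> S" "y \<in> S"
    then have xyc: "x \<in> carrier A" "y \<in> carrier A"
      using S_carrier by auto
    have "\<exists>t\<in>T. cnorm A ((x \<oplus> y) \<ominus> t) < e" if "0 < e" for e
    proof -
      have "0 < e/2"
        using that by simp
      then obtain s t where st: "s \<in> T" "t \<in> T" "cnorm A (x \<ominus> s) < e/2" "cnorm A (y \<ominus> t) < e/2"
        using approx[OF xy(1)] approx[OF xy(2)] by blast
      have "(x \<oplus> y) \<ominus> (s \<oplus> t) = (x \<ominus> s) \<oplus> (y \<ominus> t)"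
        using xyc Tc[OF st(1)] Tc[OF st(2)] by algebra
      then have "cnorm A ((x \<oplus> y) \<ominus> (s \<oplus> t)) < e"
        using norm_add[of "x \<ominus> s" "y \<ominus> t"] st xyc Tc by simp
      then show ?thesis
        using add[OF st(1,2)] by blast
    qed
    then show "x \<oplus> y \<in> S"
      using xyc by (simp add: S_def)
    have "\<exists>t\<in>T. cnorm A (x \<otimes> y \<ominus> t) < e" if "0 < e" for e
    proof -
      \<comment> \<open>\<open>t\<close> is chosen first, because the tolerance \<open>d'\<close>
        for \<open>s\<close> depends on the norm of \<open>t\<close>. Adding 1 keeps both
        denominators positive.\<close>
      define d where "d = e / (2 * (cnorm A x + 1))"
      have "0 < d"
        using that norm_nonneg[OF xyc(1)] by (simp add: d_def)
      then obtain t where t: "t \<in> T" "cnorm A (y \<ominus> t) < d"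
        using approx[OF xy(2)] by blast
      define d' where "d' = e / (2 * (cnorm A t + 1))"
      have "0 < d'"
        using that norm_nonneg[OF Tc[OF t(1)]] by (simp add: d'_def)
      then obtain s where s: "s \<in> T" "cnorm A (x \<ominus> s) < d'"
        using approx[OF xy(1)] by blast
      have "x \<otimes> y \<ominus> s \<otimes> t = x \<otimes> (y \<ominus> t) \<oplus> (x \<ominus> s) \<otimes> t"
        using xyc Tc[OF s(1)] Tc[OF t(1)] by algebra
      then have "cnorm A (x \<otimes> y \<ominus> s \<otimes> t)
          \<le> cnorm A x * cnorm A (y \<ominus> t) + cnorm A (x \<ominus> s) * cnorm A t"
        using norm_add[of "x \<otimes> (y \<ominus> t)" "(x \<ominus> s) \<otimes> t"] norm_mult[of x "y \<ominus> t"]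
          norm_mult[of "x \<ominus> s" t] xyc Tc s t by simp
      also have "\<dots> \<le> cnorm A x * d + d' * cnorm A t"
        using s t norm_nonneg[OF xyc(1)] norm_nonneg[OF Tc[OF t(1)]]
        by (intro add_mono mult_left_mono mult_right_mono) auto
      also have "\<dots> < (cnorm A x + 1) * d + d' * (cnorm A t + 1)"
        using \<open>0 < d\<close> \<open>0 < d'\<close> by (simp add: distrib_left distrib_right)
      also have "(cnorm A x + 1) * d = e / 2"
        using norm_nonneg[OF xyc(1)] by (simp add: d_def divide_simps)
      also have "d' * (cnorm A t + 1) = e / 2"
        using norm_nonneg[OF Tc[OF t(1)]] by (simp add: d'_def divide_simps)
      finally show ?thesis
        using mult[OF s(1) t(1)] by auto
    qed
    then show "x \<otimes> y \<in> S"
      using xyc by (simp add: S_def)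
  next
    fix x c assume x: "x \<in> S"
    then have xc: "x \<in> carrier A"
      using S_carrier by auto
    have "\<exists>t\<in>T. cnorm A (c \<odot> x \<ominus> t) < e" if "0 < e" for e
    proof -
      have "0 < e / (cmod c + 1)"
        using that by (simp add: add_nonneg_pos)
      then obtain t where t: "t \<in> T" "cnorm A (x \<ominus> t) < e / (cmod c + 1)"
        using approx[OF x] by blast
      have "cnorm A (c \<odot> x \<ominus> c \<odot> t) = cmod c * cnorm A (x \<ominus> t)"
        using xc Tc[OF t(1)] by (simp add: norm_smult_minus norm_smult)
      also have "\<dots> \<le> (cmod c + 1) * cnorm A (x \<ominus> t)"
        using xc Tc[OF t(1)] by (simp add: norm_nonneg mult_right_mono)
      also have "\<dots> < e"
        using t(2) by (simp add: pos_less_divide_eq add_nonneg_pos mult.commute)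
      finally show ?thesis
        using smult[OF t(1)] by blast
    qed
    then show "c \<odot> x \<in> S"
      using xc by (simp add: S_def)
  next
    fix x assume x: "x \<in> S"
    then have xc: "x \<in> carrier A"
      using S_carrier by auto
    have "\<exists>t\<in>T. cnorm A (adj A x \<ominus> t) < e" if e: "0 < e" for e
    proof -
      obtain t where t: "t \<in> T" "cnorm A (x \<ominus> t) < e"
        using approx[OF x e] by blast
      have "cnorm A (adj A x \<ominus> adj A t) = cnorm A (x \<ominus> t)"
        using norm_adj[of "x \<ominus> t"] xc Tc[OF t(1)] by (simp add: a_minus_def adj_add adj_minus)
      then show ?thesis
        using t(2) adjoint[OF t(1)] by (intro bexI[of _ "adj A t"]) simp_all
    qed
    then show "adj A x \<in> S"
      using xc by (simp add: S_def)
  next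
    fix s l assume l: "l \<in> carrier A" and s: "(\<forall>n. s n \<in> S) \<and> cstar_limit A s l"
    have "\<exists>t\<in>T. cnorm A (l \<ominus> t) < e" if e: "0 < e" for e
    proof -
      have e2: "0 < e/2"
        using e by simp
      have "(\<lambda>n. cnorm A (s n \<ominus> l)) \<longlonglongrightarrow> 0"
        using s by (simp add: cstar_limit_def)
      then have "\<forall>\<^sub>F n in sequentially. cnorm A (s n \<ominus> l) < e/2"
        using e2 by (rule order_tendstoD)
      then obtain n where n: "cnorm A (s n \<ominus> l) < e/2"
        unfolding eventually_sequentially by blast
      obtain t where t: "t \<in> T" "cnorm A (s n \<ominus> t) < e/2"
        using approx[OF _ e2, of "s n"] s by blast
      have "s n \<in> carrier A"
        using s S_carrier by auto
      then have "cnorm A (l \<ominus> t) < e"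
        using norm_minus_triangle[of l "s n" t] norm_minus_commute[of l "s n"] l Tc[OF t(1)] n t
        by simp
      then show ?thesis
        using t(1) by blast
    qed
    then show "l \<in> S"
      using l by (simp add: S_def)
  qed
  then have "S = carrier A"
    using gen \<open>T \<subseteq> S\<close> unfolding cstar_generated_def by blast
  then show ?thesis
    using approx a e by blast
qed

end

section \<open>Monomials and polynomials of a covariant pair\<close>

locale covariant_pair = cstar_algebra A for A :: "'a cstar" (structure) +
  fixes p :: nat and r :: "nat \<Rightarrow> int" and n :: nat
    and M :: "((nat \<Rightarrow> int) \<Rightarrow> complex) \<Rightarrow> 'a" and V :: 'a
  assumes p_pos: "0 < p" and r_unit: "r \<in> Units (Zp p)"
    and relations: "crossed_relations p r n A M V"
begin

lemma M_hom: "star_hom (CZp p) A M"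
  and V_closed [simp]: "V \<in> carrier A"
  and V_isometry: "adj A V \<otimes> V = \<one>"
  and V_coisometry: "V \<otimes> adj A V = \<one>"
  and V_pow: "V [^] n = \<one>"
  and V_conj: "f \<in> carrier (CZp p) \<Longrightarrow> V \<otimes> M f \<otimes> adj A V = M (alpha p r f)"
  using relations by (auto simp: crossed_relations_def)

lemmas M_closed [simp] = star_hom_closed[OF M_hom]

text \<open>The averaging behind \<open>star_hom_contractive\<close> is repeated with explicit
  functions, which avoids making \<open>CZp p\<close> an instance of \<open>cstar_algebra\<close>:
  for |g| <= 1, the function |g|^2 is the mean of two functions of modulus 1.\<close>

lemma M_norm_le:
  assumes f: "f \<in> carrier (CZp p)" and K: "\<And>x. x \<in> carrier (Zp p) \<Longrightarrow> cmod (f x) \<le> K"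
  shows "cnorm A (M f) \<le> K"
proof -
  have "\<one>\<^bsub>Zp p\<^esub> \<in> carrier (Zp p)"
    using Zp_of_int_closed[OF p_pos] by (simp add: Zp_one_eq)
  then have K0: "0 \<le> K"
    using K norm_ge_zero order_trans by blast
  have unit: "cnorm A (M g) \<le> 1"
    if g: "g \<in> carrier (CZp p)" "\<And>x. x \<in> carrier (Zp p) \<Longrightarrow> cmod (g x) = 1" for g
  proof (rule norm_unitary_le)
    have "adj (CZp p) g \<otimes>\<^bsub>CZp p\<^esub> g = \<one>\<^bsub>CZp p\<^esub>"
      using g complex_norm_square[of "g _"] by (intro CZp_eqI[of _ p] CZp_closed)
        (auto simp: CZp_apply CZp_closed mult.commute[of "cnj _"] simp flip: complex_norm_square)
    then show "adj A (M g) \<otimes> M g = \<one>"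
      using g(1) by (simp flip: star_hom_adj[OF M_hom] star_hom_mult[OF M_hom] star_hom_one[OF M_hom]
          add: CZp_closed)
  qed (use g in simp)
  have bound: "cnorm A (M g) \<le> 1"
    if g: "g \<in> carrier (CZp p)" "\<And>x. x \<in> carrier (Zp p) \<Longrightarrow> cmod (g x) \<le> 1" for g
  proof -
    \<comment> \<open>With \<open>s = 1\<close> and \<open>s = -1\<close> the values are
      \<open>\<bar>g\<bar>\<^sup>2 \<plusminus> \<i> sqrt (1 - \<bar>g\<bar>\<^sup>4)\<close>, of
      modulus 1. Working with |g|^2 instead of \<open>g\<close> makes the real part real-valued and
      fits the C*-identity.\<close>
    define u where "u s = (\<lambda>x\<in>carrier (Zp p). complex_of_real ((cmod (g x))\<^sup>2)
        + s * \<i> * complex_of_real (sqrt (1 - (cmod (g x))\<^sup>2 * (cmod (g x))\<^sup>2)))" for s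
    have cont: "continuous_on (carrier (Zp p)) g"
      using g by (simp add: CZp_carrier)
    have uc: "u s \<in> carrier (CZp p)" for s
      unfolding u_def using cont by (intro CZp_restrict continuous_intros)
    have "cnorm A (M (u s)) \<le> 1" if "s = 1 \<or> s = -1" for s
    proof (rule unit[OF uc])
      fix x assume x: "x \<in> carrier (Zp p)"
      have "(cmod (g x))\<^sup>2 * (cmod (g x))\<^sup>2 \<le> 1"
        using g(2)[OF x] by (simp add: mult_le_one power_le_one)
      then show "cmod (u s x) = 1"
        using x that by (auto simp: u_def cmod_def power2_eq_square)
    qed
    from this[of 1] this[of "-1"] have "cnorm A (M (u 1) \<oplus> M (u (-1))) \<le> 2"
      using norm_add[of "M (u 1)" "M (u (-1))"] uc by simp
    moreover have "2 \<odot>\<^bsub>CZp p\<^esub> (adj (CZp p) g \<otimes>\<^bsub>CZp p\<^esub> g) = u 1 \<oplus>\<^bsub>CZp p\<^esub> u (-1)"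
    proof (rule CZp_eqI)
      fix x assume x: "x \<in> carrier (Zp p)"
      then show "(2 \<odot>\<^bsub>CZp p\<^esub> (adj (CZp p) g \<otimes>\<^bsub>CZp p\<^esub> g)) x = (u 1 \<oplus>\<^bsub>CZp p\<^esub> u (-1)) x"
        unfolding CZp_apply[OF x] u_def
        by (simp add: complex_norm_square mult.commute[of "g x"] del: of_real_power)
    qed (intro CZp_closed uc g(1))+
    then have "2 \<odot> (adj A (M g) \<otimes> M g) = M (u 1) \<oplus> M (u (-1))"
      using g(1) uc by (simp add: CZp_closed flip: star_hom_adj[OF M_hom] star_hom_mult[OF M_hom]
          star_hom_smult[OF M_hom] star_hom_add[OF M_hom])
    ultimately have "2 * (cnorm A (M g))\<^sup>2 \<le> 2"
      using g(1) norm_smult[of "adj A (M g) \<otimes> M g" 2] by (simp add: cstar_identity)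
    then show ?thesis
      using norm_nonneg[of "M g"] g(1) by (simp add: abs_square_le_1)
  qed
  show ?thesis
  proof (rule dense_ge)
    fix c assume c: "K < c"
    then have c0: "0 < c"
      using K0 by simp
    have "cnorm A (M (complex_of_real (1 / c) \<odot>\<^bsub>CZp p\<^esub> f)) \<le> 1"
    proof (rule bound)
      fix x assume x: "x \<in> carrier (Zp p)"
      show "cmod ((complex_of_real (1 / c) \<odot>\<^bsub>CZp p\<^esub> f) x) \<le> 1"
        using K[OF x] c c0 x by (simp add: CZp_apply norm_divide norm_mult)
    qed (use f in \<open>simp add: CZp_closed\<close>)
    then show "cnorm A (M f) \<le> c"
      using c0 f by (simp add: star_hom_smult[OF M_hom] norm_smult norm_divide)
  qed
qed

definition W :: "int \<Rightarrow> 'a" where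
  "W k = V [^]\<^bsub>units_of A\<^esub> k"

lemma V_unit: "V \<in> Units A"
  using V_isometry V_coisometry by (auto simp: Units_def)

lemma W_props:
  shows W_closed [simp]: "W k \<in> carrier A" and W_zero [simp]: "W 0 = \<one>" and W_one: "W 1 = V"
    and W_add: "W (k + l) = W k \<otimes> W l" and W_minus_one: "W (-1) = adj A V"
    and W_mod: "W (k mod int n) = W k"
proof -
  interpret U: group "units_of A"
    by (rule units_group)
  have V: "V \<in> carrier (units_of A)"
    using V_unit by (simp add: units_of_carrier)
  have cl: "W j \<in> Units A" for j
    using U.int_pow_closed[OF V, of j] by (simp add: W_def units_of_carrier)
  then show "W k \<in> carrier A"
    by (rule Units_closed)
  show "W 0 = \<one>"
    by (simp add: W_def units_of_one)
  show "W 1 = V"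
    using V by (simp add: W_def U.int_pow_1)
  have add: "W (i + j) = W i \<otimes> W j" for i j
    using U.int_pow_mult[OF V, of i j] by (simp add: W_def units_of_mult)
  then show "W (k + l) = W k \<otimes> W l" .
  have "W (-1) = inv V"
    using V V_unit U.int_pow_neg[of V 1] by (simp add: W_def units_of_inv U.int_pow_1)
  also have "\<dots> = adj A V"
    using V_isometry V_coisometry by (intro inv_char) simp_all
  finally show "W (-1) = adj A V" .
  have "W (int j) = V [^] j" for j
    by (induction j) (simp_all add: \<open>W 0 = \<one>\<close> \<open>W 1 = V\<close> add add.commute[of 1])
  then have "W (int n) = \<one>"
    using V_pow by simp
  then have "V [^]\<^bsub>units_of A\<^esub> int n = \<one>\<^bsub>units_of A\<^esub>"
    by (simp add: W_def units_of_one)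
  then have "W (int n * j) = \<one>" for j
    using U.int_pow_pow[OF V, of "int n" j] U.int_pow_one[of j] by (simp add: W_def units_of_one)
  then show "W (k mod int n) = W k"
    using add[of "int n * (k div int n)" "k mod int n"] cl by (simp add: Units_closed)
qed

lemma W_adj: "adj A (W k) = W (- k)"
proof (induction k rule: int_induct[where k=0])
  case (step1 i)
  have "adj A (W (i + 1)) = W (-1) \<otimes> W (- i)"
    using step1 by (simp add: W_add W_one W_minus_one adj_mult)
  then show ?case
    by (simp add: algebra_simps flip: W_add)
next
  case (step2 i)
  have "adj A (W (i - 1)) = W 1 \<otimes> W (- i)"
    using step2 W_add[of i "-1"] by (simp add: W_one W_minus_one adj_mult adj_adj)
  then show ?case
    by (simp add: algebra_simps flip: W_add)
qed simp

lemma W_norm_le: "cnorm A (W k) \<le> 1"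
  using W_add[of "- k" k] by (intro norm_unitary_le) (simp_all add: W_adj)

text \<open>The function \<open>g\<close> is the \<open>k\<close>-th iterate of
  \<open>alpha p r\<close> at \<open>f\<close>, with the inverse automorphism for negative
  \<open>k\<close>. Its mere existence is enough to keep the span closed under products and
  adjoints.\<close>

lemma W_M_commute:
  assumes "f \<in> carrier (CZp p)"
  shows "\<exists>g\<in>carrier (CZp p). W k \<otimes> M f = M g \<otimes> W k"
proof -
  have up: "V \<otimes> M g = M (alpha p r g) \<otimes> V" if "g \<in> carrier (CZp p)" for g
  proof -
    have "V \<otimes> M g = V \<otimes> M g \<otimes> (adj A V \<otimes> V)"
      using that by (simp add: V_isometry)
    also have "\<dots> = (V \<otimes> M g \<otimes> adj A V) \<otimes> V"
      using that by (simp add: m_assoc)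
    finally show ?thesis
      using that by (simp add: V_conj)
  qed
  \<comment> \<open>To move \<open>M g\<close> past \<open>adj A V\<close>, the function
    \<open>g\<close> has to be in the image of \<open>alpha p r\<close>;
    \<open>alpha_inverse\<close> provides the preimage.\<close>
  have down: "\<exists>h\<in>carrier (CZp p). adj A V \<otimes> M g = M h \<otimes> adj A V" if g: "g \<in> carrier (CZp p)" for g
  proof -
    interpret Z: comm_monoid "Zp p"
      using p_pos by (rule Zp_comm_monoid)
    let ?h = "alpha p (inv\<^bsub>Zp p\<^esub> r) g"
    have h: "?h \<in> carrier (CZp p)"
      using p_pos r_unit g by (intro alpha_closed) simp_all
    have "adj A V \<otimes> M g = adj A V \<otimes> (V \<otimes> M ?h \<otimes> adj A V)"
      using h g r_unit p_pos by (simp add: V_conj alpha_inverse)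
    also have "\<dots> = (adj A V \<otimes> V) \<otimes> M ?h \<otimes> adj A V"
      using h by (simp add: m_assoc)
    finally have "adj A V \<otimes> M g = M ?h \<otimes> adj A V"
      using h by (simp add: V_isometry)
    then show ?thesis
      using h by blast
  qed
  show ?thesis
  proof (induction k rule: int_induct[where k=0])
    case base
    show ?case
      using assms by (intro bexI[of _ f]) simp_all
  next
    case (step1 i)
    then obtain g where g: "g \<in> carrier (CZp p)" "W i \<otimes> M f = M g \<otimes> W i"
      by blast
    have "W (i + 1) \<otimes> M f = V \<otimes> (W i \<otimes> M f)"
      using W_add[of 1 i] assms by (simp add: add.commute W_one m_assoc)
    also have "\<dots> = (V \<otimes> M g) \<otimes> W i"
      using g by (simp add: m_assoc)
    also have "\<dots> = M (alpha p r g) \<otimes> (V \<otimes> W i)"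
      using g alpha_closed[OF p_pos r_unit g(1)] by (simp add: up m_assoc)
    also have "V \<otimes> W i = W (i + 1)"
      using W_add[of 1 i] by (simp add: add.commute W_one)
    finally show ?case
      using alpha_closed[OF p_pos r_unit g(1)] by blast
  next
    case (step2 i)
    then obtain g where g: "g \<in> carrier (CZp p)" "W i \<otimes> M f = M g \<otimes> W i"
      by blast
    obtain h where h: "h \<in> carrier (CZp p)" "adj A V \<otimes> M g = M h \<otimes> adj A V"
      using down[OF g(1)] by blast
    have "W (i - 1) \<otimes> M f = adj A V \<otimes> (W i \<otimes> M f)"
      using W_add[of "-1" i] assms by (simp add: W_minus_one m_assoc)
    also have "\<dots> = (adj A V \<otimes> M g) \<otimes> W i"
      using g by (simp add: m_assoc)
    also have "\<dots> = M h \<otimes> (adj A V \<otimes> W i)"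
      using h by (simp add: m_assoc)
    also have "adj A V \<otimes> W i = W (i - 1)"
      using W_add[of "-1" i] by (simp add: W_minus_one)
    finally show ?case
      using h(1) by blast
  qed
qed

text \<open>Scalars are absorbed into the functions \<open>f\<close>, see \<open>span_smult\<close>.
  Exponents range over all integers here and are reduced modulo \<open>n\<close> only in
  \<open>span_normal_form\<close>.\<close>

inductive_set span :: "'a set" where
  monomial: "f \<in> carrier (CZp p) \<Longrightarrow> M f \<otimes> W k \<in> span"
| sum: "\<lbrakk>s \<in> span; t \<in> span\<rbrakk> \<Longrightarrow> s \<oplus> t \<in> span"

lemma span_closed: "t \<in> span \<Longrightarrow> t \<in> carrier A"
  by (induction rule: span.induct) auto

lemma span_mult_monomial:
  assumes "t \<in> span" "f \<in> carrier (CZp p)"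
  shows "M f \<otimes> W k \<otimes> t \<in> span"
  using assms(1)
proof induction
  case (monomial g l)
  obtain h where h: "h \<in> carrier (CZp p)" "W k \<otimes> M g = M h \<otimes> W k"
    using W_M_commute[OF monomial] by blast
  have "M f \<otimes> W k \<otimes> (M g \<otimes> W l) = M f \<otimes> (W k \<otimes> M g) \<otimes> W l"
    using assms(2) monomial by (simp add: m_assoc)
  also have "\<dots> = M (f \<otimes>\<^bsub>CZp p\<^esub> h) \<otimes> W (k + l)"
    using assms(2) h by (simp add: star_hom_mult[OF M_hom] W_add m_assoc)
  finally show ?case
    using assms(2) h by (simp add: span.monomial CZp_closed)
next
  case (sum s t)
  then show ?case
    using assms(2) span_closed by (simp add: r_distr span.sum)
qed

lemma span_mult:
  assumes "s \<in> span" "t \<in> span"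
  shows "s \<otimes> t \<in> span"
  using assms(1)
proof induction
  case (sum s s')
  then show ?case
    using assms(2) span_closed by (simp add: l_distr span.sum)
qed (use assms(2) span_mult_monomial in blast)

lemma span_smult: "t \<in> span \<Longrightarrow> c \<odot> t \<in> span"
proof (induction rule: span.induct)
  case (monomial f k)
  then have "c \<odot> (M f \<otimes> W k) = M (c \<odot>\<^bsub>CZp p\<^esub> f) \<otimes> W k"
    by (simp add: star_hom_smult[OF M_hom] smult_mult_left)
  then show ?case
    using monomial by (simp add: span.monomial CZp_closed)
qed (simp add: span_closed smult_add_right span.sum)

lemma span_adj: "t \<in> span \<Longrightarrow> adj A t \<in> span"
proof (induction rule: span.induct)
  case (monomial f k)
  obtain g where g: "g \<in> carrier (CZp p)" "W (- k) \<otimes> M (adj (CZp p) f) = M g \<otimes> W (- k)"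
    using W_M_commute[of "adj (CZp p) f"] monomial by (auto simp: CZp_closed)
  have "adj A (M f \<otimes> W k) = M g \<otimes> W (- k)"
    using monomial g(2) by (simp add: adj_mult W_adj star_hom_adj[OF M_hom])
  then show ?case
    using g(1) by (simp add: span.monomial)
qed (simp add: span_closed adj_add span.sum)

lemma span_dense:
  assumes gen: "cstar_generated A (insert V (M ` carrier (CZp p)))" and "a \<in> carrier A" "0 < e"
  shows "\<exists>t\<in>span. cnorm A (a \<ominus> t) < e"
proof (rule dense_cstar_subalgebra[OF _ _ _ _ _ _ gen _ assms(2,3)])
  have f: "M f \<in> span" if "f \<in> carrier (CZp p)" for f
    using span.monomial[OF that, of 0] that by simp
  moreover have "V \<in> span"
    using span.monomial[OF CZp_closed(5), where k=1] by (simp add: star_hom_one[OF M_hom] W_one)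
  ultimately show "insert V (M ` carrier (CZp p)) \<subseteq> span"
    by auto
  show "\<one> \<in> span"
    using f[OF CZp_closed(5)] by (simp add: star_hom_one[OF M_hom])
qed (use span_closed span.sum span_mult span_smult span_adj in auto)

text \<open>Exponents are normalized so that distinct elements of \<open>J\<close> are distinct
  modulo \<open>n\<close>; \<open>coefficient_bound\<close> relies on this to isolate a single
  coefficient. For a sum, both families are padded with the zero function to the union of the
  exponent sets.\<close>

lemma span_normal_form:
  assumes "t \<in> span"
  shows "\<exists>J F. finite J \<and> J \<subseteq> range (\<lambda>k. k mod int n) \<and> (\<forall>k. F k \<in> carrier (CZp p)) \<and>
    t = (\<Oplus>k\<in>J. M (F k) \<otimes> W k)"
  using assms
proof induction
  case (monomial f k)
  then show ?case
    by (intro exI[of _ "{k mod int n}"] exI[of _ "\<lambda>_. f"]) (simp add: W_mod)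
next
  case (sum s t)
  then obtain J F J' F' where J: "finite J" "J \<subseteq> range (\<lambda>k. k mod int n)"
    "\<And>k. F k \<in> carrier (CZp p)" "s = (\<Oplus>k\<in>J. M (F k) \<otimes> W k)"
    and J': "finite J'" "J' \<subseteq> range (\<lambda>k. k mod int n)"
    "\<And>k. F' k \<in> carrier (CZp p)" "t = (\<Oplus>k\<in>J'. M (F' k) \<otimes> W k)"
    by blast
  define G where "G k = (if k \<in> J then F k else \<zero>\<^bsub>CZp p\<^esub>)" for k
  define G' where "G' k = (if k \<in> J' then F' k else \<zero>\<^bsub>CZp p\<^esub>)" for k
  have G: "G k \<in> carrier (CZp p)" "G' k \<in> carrier (CZp p)" for k
    using J(3) J'(3) by (simp_all add: G_def G'_def CZp_closed)
  \<comment> \<open>\<open>star_hom_zero\<close> asks for C*-algebras on both sides, so that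
    \<open>M\<close> kills the zero function is taken from homogeneity with the scalar 0.\<close>
  have "0 \<odot>\<^bsub>CZp p\<^esub> \<zero>\<^bsub>CZp p\<^esub> = \<zero>\<^bsub>CZp p\<^esub>"
    by (simp add: CZp_def)
  then have M0: "M \<zero>\<^bsub>CZp p\<^esub> = \<zero>"
    using star_hom_smult[OF M_hom CZp_closed(6), of 0] by (simp add: CZp_closed)
  have "s = (\<Oplus>k\<in>J \<union> J'. M (G k) \<otimes> W k)"
    unfolding J(4) using J(1,3) J'(1) M0
    by (intro add.finprod_mono_neutral_cong_left) (auto simp: G_def CZp_closed)
  moreover have "t = (\<Oplus>k\<in>J \<union> J'. M (G' k) \<otimes> W k)"
    unfolding J'(4) using J(1) J'(1,3) M0
    by (intro add.finprod_mono_neutral_cong_left) (auto simp: G'_def CZp_closed)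
  ultimately have "s \<oplus> t = (\<Oplus>k\<in>J \<union> J'. M (G k) \<otimes> W k \<oplus> M (G' k) \<otimes> W k)"
    using G by (simp add: finsum_addf Pi_iff)
  also have "\<dots> = (\<Oplus>k\<in>J \<union> J'. M (G k \<oplus>\<^bsub>CZp p\<^esub> G' k) \<otimes> W k)"
    using G by (intro finsum_cong') (auto simp: star_hom_add[OF M_hom] l_distr)
  finally show ?case
    using J(1,2) J'(1,2) G by (intro exI[of _ "J \<union> J'"] exI[of _ "\<lambda>k. G k \<oplus>\<^bsub>CZp p\<^esub> G' k"])
      (auto simp: CZp_closed)
qed

end

section \<open>Transport of C*-algebras along injections\<close>

definition transport :: "('a \<Rightarrow> 'b) \<Rightarrow> 'a cstar \<Rightarrow> 'b cstar" where
  "transport j A = (let i = inv_into (carrier A) j in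
     \<lparr>carrier = j ` carrier A,
      Group.monoid.mult = (\<lambda>x y. j (i x \<otimes>\<^bsub>A\<^esub> i y)),
      one = j \<one>\<^bsub>A\<^esub>,
      zero = j \<zero>\<^bsub>A\<^esub>,
      add = (\<lambda>x y. j (i x \<oplus>\<^bsub>A\<^esub> i y)),
      smult = (\<lambda>c x. j (c \<odot>\<^bsub>A\<^esub> i x)),
      adj = (\<lambda>x. j (adj A (i x))),
      cnorm = (\<lambda>x. cnorm A (i x))\<rparr>)"

lemma transport_simps:
  "carrier (transport j A) = j ` carrier A" "\<one>\<^bsub>transport j A\<^esub> = j \<one>\<^bsub>A\<^esub>" "\<zero>\<^bsub>transport j A\<^esub> = j \<zero>\<^bsub>A\<^esub>"
  by (simp_all add: transport_def Let_def)

lemma transport_ops: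
  assumes "inj_on j (carrier A)" "a \<in> carrier A"
  shows "inv_into (carrier A) j (j a) = a"
    "b \<in> carrier A \<Longrightarrow> j a \<otimes>\<^bsub>transport j A\<^esub> j b = j (a \<otimes>\<^bsub>A\<^esub> b)"
    "b \<in> carrier A \<Longrightarrow> j a \<oplus>\<^bsub>transport j A\<^esub> j b = j (a \<oplus>\<^bsub>A\<^esub> b)"
    "c \<odot>\<^bsub>transport j A\<^esub> j a = j (c \<odot>\<^bsub>A\<^esub> a)"
    "adj (transport j A) (j a) = j (adj A a)"
    "cnorm (transport j A) (j a) = cnorm A a"
  using assms by (simp_all add: transport_def Let_def)

lemma cstar_algebra_transport:
  assumes "cstar_algebra A" and inj: "inj_on j (carrier A)"
  shows "cstar_algebra (transport j A)"
proof -
  interpret cstar_algebra A by fact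
  let ?B = "transport j A"
  note ops = transport_simps transport_ops[OF inj]
  have ring: "ring ?B"
  proof (intro ringI abelian_groupI monoidI)
    fix x assume "x \<in> carrier ?B"
    then obtain a where "a \<in> carrier A" "x = j a"
      by (auto simp: ops)
    then show "\<exists>y\<in>carrier ?B. y \<oplus>\<^bsub>?B\<^esub> x = \<zero>\<^bsub>?B\<^esub>"
      by (intro bexI[of _ "j (\<ominus>\<^bsub>A\<^esub> a)"]) (simp_all add: ops l_neg)
  qed (auto simp: ops a_assoc m_assoc l_distr r_distr a_ac)
  interpret B: ring ?B by (rule ring)
  have minus: "j a \<ominus>\<^bsub>?B\<^esub> j b = j (a \<ominus>\<^bsub>A\<^esub> b)" if "a \<in> carrier A" "b \<in> carrier A" for a b
  proof -
    have "\<ominus>\<^bsub>?B\<^esub> j b = j (\<ominus>\<^bsub>A\<^esub> b)"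
      using that by (intro B.minus_equality) (simp_all add: ops l_neg)
    then show ?thesis
      using that by (simp add: a_minus_def ops)
  qed
  have limit: "cstar_limit ?B (\<lambda>n. j (s n)) (j l) \<longleftrightarrow> cstar_limit A s l"
    if "\<And>n. s n \<in> carrier A" "l \<in> carrier A" for s l
    using that by (simp add: cstar_limit_def minus ops)
  show ?thesis
  proof (rule cstar_algebra.intro)
    show "ring ?B"
      by (rule ring)
    show "Module.module complex_ring ?B"
      by (intro Module.module.intro cring_complex_ring B.abelian_group_axioms module_axioms.intro)
        (auto simp: ops complex_ring_def smult_add_left smult_add_right smult_assoc)
    fix s :: "nat \<Rightarrow> 'b"
    assume s: "\<And>n. s n \<in> carrier ?B"
      and cauchy: "\<And>e. 0 < e \<Longrightarrow> \<exists>N. \<forall>m\<ge>N. \<forall>n\<ge>N. cnorm ?B (s m \<ominus>\<^bsub>?B\<^esub> s n) < e"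
    have "\<exists>a. a \<in> carrier A \<and> s n = j a" for n
      using s[of n] by (auto simp: ops)
    then obtain t where t: "\<And>n. t n \<in> carrier A" "\<And>n. s n = j (t n)"
      by metis
    have "\<exists>l\<in>carrier A. cstar_limit A t l"
      using t(1) cauchy by (intro complete) (simp_all add: t(2) minus ops)
    then show "\<exists>l\<in>carrier ?B. cstar_limit ?B s l"
      using limit[OF t(1)] by (auto simp: ops t(2)[abs_def])
  qed (auto simp: ops smult_mult_left smult_mult_right adj_adj adj_add adj_smult adj_mult
      norm_nonneg norm_eq_0 norm_add norm_smult norm_mult cstar_identity inj_on_eq_iff[OF inj])
qed

lemma star_hom_transport:
  assumes "cstar_algebra A" and inj: "inj_on j (carrier A)"
  shows "star_hom A (transport j A) j" "star_hom (transport j A) A (inv_into (carrier A) j)"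
proof -
  interpret cstar_algebra A by fact
  note ops = transport_simps transport_ops[OF inj]
  show "star_hom A (transport j A) j"
    by (auto simp: star_hom_def ring_hom_def ops)
  show "star_hom (transport j A) A (inv_into (carrier A) j)"
    by (auto simp: star_hom_def ring_hom_def ops)
qed

text \<open>Over a countable index set an operator is determined by its countably many matrix
  coefficients, and a real number by the set of rationals below it.\<close>

lemma bounded_op_embedding:
  fixes c :: "complex \<Rightarrow> 'a"
  assumes "countable I" "inj c"
  shows "\<exists>j :: (('i \<Rightarrow> complex) \<Rightarrow> 'i \<Rightarrow> complex) \<Rightarrow> 'a. inj_on j (carrier (bounded_ops I))"
proof -
  define X where "X = (I \<times> I) \<times> ((UNIV :: bool set) \<times> (UNIV :: rat set))"
  define S where "S T = {((i, k), b, q) | i k b q. i \<in> I \<and> k \<in> I \<and>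
      real_of_rat q < (if b then Re else Im) (T (ell2_unit k) i)}"
    for T :: "('i \<Rightarrow> complex) \<Rightarrow> 'i \<Rightarrow> complex"
  have rat: "x = y" if "\<And>q. real_of_rat q < x \<longleftrightarrow> real_of_rat q < y" for x y :: real
    using that of_rat_dense[of x y] of_rat_dense[of y x] by (metis linorder_neqE_linordered_idom less_asym)
  have "countable X"
    using assms(1) by (simp add: X_def)
  then have nat: "inj_on (to_nat_on X) X"
    by (rule inj_on_to_nat_on)
  have SX: "S T \<subseteq> X" for T
    by (auto simp: S_def X_def)
  obtain h :: "nat set \<Rightarrow> real" where h: "inj h"
    using nat_sets_eqpoll_reals unfolding eqpoll_def bij_betw_def by blast
  have S_inj: "T = T'" if T: "bounded_op I T" "bounded_op I T'" and S: "S T = S T'" for T T'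
  proof -
    have "real_of_rat q < (if b then Re else Im) (T (ell2_unit k) i) \<longleftrightarrow>
        real_of_rat q < (if b then Re else Im) (T' (ell2_unit k) i)" if "i \<in> I" "k \<in> I" for i k b q
      using that arg_cong[OF S, of "\<lambda>s. ((i, k), b, q) \<in> s"] by (simp add: S_def)
    from this[where b=True] this[where b=False]
    have coeff: "T (ell2_unit k) i = T' (ell2_unit k) i" if "i \<in> I" "k \<in> I" for i k
      using that by (intro complex_eqI rat) simp_all
    have exp: "((\<lambda>k. \<phi> k * R (ell2_unit k) i) has_sum R \<phi> i) I"
      if R: "bounded_op I R" and \<phi>: "\<phi> \<in> ell2 I" for R \<phi> i
    proof (rule ell2_functional_expansion[where K="cnorm (bounded_ops I) R"])
      fix \<phi> assume "\<phi> \<in> ell2 I"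
      then show "cmod (R \<phi> i) \<le> cnorm (bounded_ops I) R * ell2_norm I \<phi>"
        using cmod_le_ell2_norm[OF bounded_op_closed[OF R], of \<phi> i] cnorm_bounded_ops_bound[OF R, of \<phi>]
        by linarith
    qed (use \<phi> in \<open>simp_all add: bounded_op_add[OF R] bounded_op_smult[OF R]\<close>)
    show ?thesis
    proof (rule bounded_ops_eqI)
      fix \<phi> i assume \<phi>: "\<phi> \<in> ell2 I"
      show "T \<phi> i = T' \<phi> i"
      proof (cases "i \<in> I")
        case True
        then have "((\<lambda>k. \<phi> k * T (ell2_unit k) i) has_sum T' \<phi> i) I"
          using exp[OF T(2) \<phi>, of i] coeff by (simp cong: has_sum_cong)
        then show ?thesis
          using exp[OF T(1) \<phi>, of i] has_sum_unique by blast
      qed (simp add: ell2_outside[OF bounded_op_closed[OF T(1) \<phi>]]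
          ell2_outside[OF bounded_op_closed[OF T(2) \<phi>]])
    qed (use T in simp_all)
  qed
  \<comment> \<open>From an operator to a set of cuts, a set of natural numbers, a real number, a
    complex number and an element of \<open>'a\<close>: each passage is injective.\<close>
  have "inj_on (\<lambda>T. c (complex_of_real (h (to_nat_on X ` S T)))) (carrier (bounded_ops I))"
  proof (rule inj_onI)
    fix T T' assume T: "T \<in> carrier (bounded_ops I)" "T' \<in> carrier (bounded_ops I)"
      and "c (complex_of_real (h (to_nat_on X ` S T))) = c (complex_of_real (h (to_nat_on X ` S T')))"
    then have "to_nat_on X ` S T = to_nat_on X ` S T'"
      using assms(2) h by (simp add: inj_eq)
    then have "S T = S T'"
      using inj_on_image_eq_iff[OF nat SX SX] by simp
    then show "T = T'"
      using S_inj T by simp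
  qed
  then show ?thesis
    by blast
qed

section \<open>Fejer means\<close>

lemma sum_cis_roots_of_unity:
  assumes "0 < Q"
  shows "(\<Sum>j<Q. cis (2 * pi * real j * real_of_int m / real Q)) = (if int Q dvd m then of_nat Q else 0)"
proof -
  define z where "z = cis (2 * pi * real_of_int m / real Q)"
  have pow: "cis (2 * pi * real j * real_of_int m / real Q) = z ^ j" for j
    unfolding z_def Complex.DeMoivre by (simp add: mult_ac)
  have zQ: "z ^ Q = 1"
    using assms by (simp add: z_def Complex.DeMoivre)
  have z1: "z = 1 \<longleftrightarrow> int Q dvd m"
  proof
    assume "int Q dvd m"
    then obtain k where "m = int Q * k"
      by blast
    then show "z = 1"
      using assms cis_multiple_2pi[of "real_of_int k"] by (simp add: z_def mult.assoc)
  next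
    assume "z = 1"
    then have "cos (2 * pi * real_of_int m / real Q) = 1"
      by (metis z_def cis.sel(1) one_complex.sel(1))
    then obtain k :: int where "2 * pi * real_of_int m / real Q = real_of_int k * 2 * pi"
      using cos_one_2pi_int by blast
    then have "real_of_int m = real_of_int (int Q * k)"
      using assms by (simp add: field_simps)
    then have "m = int Q * k"
      by (simp only: of_int_eq_iff)
    then show "int Q dvd m"
      by simp
  qed
  show ?thesis
    using zQ z1 geometric_sum[of z Q] by (auto simp: pow)
qed

text \<open>The value of the Fejer kernel of order \<open>R\<close> at a \<open>Q\<close>-th root of unity, divided by \<open>Q\<close>. If
  \<open>Q > \<bar>k\<bar> + R\<close>, there is no aliasing, and \<open>fejer_coeff Q R k\<close> is the \<open>k\<close>-th Fourier coefficient of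
  the kernel.\<close>

definition fejer_weight :: "nat \<Rightarrow> nat \<Rightarrow> nat \<Rightarrow> real" where
  "fejer_weight Q R j =
     (cmod (\<Sum>s\<le>R. cis (2 * pi * real j * real s / real Q)))\<^sup>2 / (real Q * real (Suc R))"

lemma fejer_weight_nonneg: "0 \<le> fejer_weight Q R j"
  by (simp add: fejer_weight_def)

definition fejer_coeff :: "nat \<Rightarrow> nat \<Rightarrow> int \<Rightarrow> complex" where
  "fejer_coeff Q R k =
     (\<Sum>j<Q. complex_of_real (fejer_weight Q R j) * cis (real_of_int k * (2 * pi * real j / real Q)))"

text \<open>The squared modulus of the Dirichlet sum is a double sum over \<open>s\<close> and
  \<open>t\<close>, and summing over the \<open>Q\<close>-th roots of unity keeps the pairs with
  \<open>t = s + k\<close>. Their number is R + 1 - |k|, or 0 where this is negative.\<close>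

lemma fejer_coeff_eq:
  assumes "\<bar>k\<bar> + int R < int Q"
  shows "fejer_coeff Q R k = of_nat (card {s. s \<le> R \<and> 0 \<le> int s + k \<and> int s + k \<le> int R}) / of_nat (Suc R)"
proof -
  have Q: "0 < Q"
    using assms by linarith
  define e where "e j m = cis (2 * pi * real j * real_of_int m / real Q)" for j m
  have e_mult: "e j l * e j m = e j (l + m)" for j l m
    by (simp add: e_def cis_mult distrib_left add_divide_distrib)
  have e_cnj: "cnj (e j m) = e j (- m)" for j m
    by (simp add: e_def cis_cnj)
  have weight: "complex_of_real (fejer_weight Q R j)
      = (\<Sum>s\<le>R. \<Sum>t\<le>R. e j (int s - int t)) / (of_nat Q * of_nat (Suc R))" for j
  proof -
    let ?D = "\<Sum>s\<le>R. e j (int s)"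
    have "?D * cnj ?D = (\<Sum>s\<le>R. \<Sum>t\<le>R. e j (int s - int t))"
      by (simp add: sum_product e_cnj e_mult)
    moreover have "complex_of_real ((cmod ?D)\<^sup>2) = ?D * cnj ?D"
      by (rule complex_norm_square)
    ultimately show ?thesis
      by (simp add: fejer_weight_def e_def)
  qed
  have "fejer_coeff Q R k
      = (\<Sum>j<Q. (\<Sum>s\<le>R. \<Sum>t\<le>R. e j (int s + k - int t)) / (of_nat Q * of_nat (Suc R)))"
  proof -
    have "cis (real_of_int k * (2 * pi * real j / real Q)) = e j k" for j
      by (simp add: e_def mult_ac)
    moreover have "(\<Sum>s\<le>R. \<Sum>t\<le>R. e j (int s - int t)) * e j k = (\<Sum>s\<le>R. \<Sum>t\<le>R. e j (int s + k - int t))" for j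
      unfolding sum_distrib_right e_mult by (simp add: algebra_simps)
    ultimately show ?thesis
      unfolding fejer_coeff_def weight by (simp only: times_divide_eq_left)
  qed
  also have "\<dots> = (\<Sum>s\<le>R. \<Sum>t\<le>R. \<Sum>j<Q. e j (int s + k - int t)) / (of_nat Q * of_nat (Suc R))"
    by (simp add: sum_divide_distrib[symmetric] sum.swap[of _ _ "{..<Q}"])
  also have "(\<Sum>s\<le>R. \<Sum>t\<le>R. \<Sum>j<Q. e j (int s + k - int t))
      = (\<Sum>s\<le>R. of_nat Q * (if 0 \<le> int s + k \<and> int s + k \<le> int R then 1 else 0))"
  proof (rule sum.cong[OF refl])
    fix s assume "s \<in> {..R}"
    \<comment> \<open>As \<open>\<bar>int s + k - int t\<bar> \<le> \<bar>k\<bar> + int R < int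
      Q\<close>, the only multiple of \<open>Q\<close> within reach is 0.\<close>
    then have dvd: "int Q dvd int s + k - int t \<longleftrightarrow> int t = int s + k" if "t \<le> R" for t
      using that assms zdvd_imp_le[of "int Q" "\<bar>int s + k - int t\<bar>"] by fastforce
    have "(\<Sum>t\<le>R. \<Sum>j<Q. e j (int s + k - int t)) = (\<Sum>t\<le>R. if int t = int s + k then of_nat Q else 0)"
      unfolding e_def sum_cis_roots_of_unity[OF Q] by (intro sum.cong) (auto simp: dvd)
    also have "\<dots> = of_nat Q * (if 0 \<le> int s + k \<and> int s + k \<le> int R then 1 else 0)"
    proof (cases "0 \<le> int s + k \<and> int s + k \<le> int R")
      case True
      then have "int t = int s + k \<longleftrightarrow> t = nat (int s + k)" for t
        by auto
      then show ?thesis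
        using True by (simp add: nat_le_iff)
    next
      case False
      then have "(\<Sum>t\<le>R. if int t = int s + k then of_nat Q else (0::complex)) = 0"
        by (intro sum.neutral) auto
      then show ?thesis
        unfolding if_not_P[OF False] by simp
    qed
    finally show "(\<Sum>t\<le>R. \<Sum>j<Q. e j (int s + k - int t))
        = of_nat Q * (if 0 \<le> int s + k \<and> int s + k \<le> int R then 1 else 0)" .
  qed
  also have "\<dots> = of_nat Q * of_nat (card {s. s \<le> R \<and> 0 \<le> int s + k \<and> int s + k \<le> int R})"
  proof -
    have "{s. s \<le> R \<and> 0 \<le> int s + k \<and> int s + k \<le> int R}
        = {s \<in> {..R}. 0 \<le> int s + k \<and> int s + k \<le> int R}"
      by auto
    then show ?thesis
      by (simp add: sum.If_cases Int_def flip: sum_distrib_left)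
  qed
  finally show ?thesis
    using Q by simp
qed

text \<open>Together with \<open>fejer_weight_nonneg\<close> this makes the weights a convex
  combination, so that Fejer means are contractive. Plain truncation of a polynomial has no such
  uniform bound.\<close>

lemma sum_fejer_weight:
  assumes "R < Q"
  shows "(\<Sum>j<Q. fejer_weight Q R j) = 1"
proof -
  have "complex_of_real (\<Sum>j<Q. fejer_weight Q R j) = fejer_coeff Q R 0"
    by (simp add: fejer_coeff_def)
  also have "\<dots> = 1"
    using assms fejer_coeff_eq[of 0 R Q] by (simp del: of_nat_Suc flip: atMost_def)
  finally show ?thesis
    by (simp only: of_real_eq_1_iff)
qed

lemma fejer_coeff_zero: "\<lbrakk>\<bar>k\<bar> + int R < int Q; int R < \<bar>k\<bar>\<rbrakk> \<Longrightarrow> fejer_coeff Q R k = 0"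
  by (auto simp: fejer_coeff_eq)

lemma norm_fejer_coeff_le: "R < Q \<Longrightarrow> cmod (fejer_coeff Q R k) \<le> 1"
proof -
  assume "R < Q"
  have "cmod (fejer_coeff Q R k) \<le> (\<Sum>j<Q. fejer_weight Q R j)"
    unfolding fejer_coeff_def
    by (rule order_trans[OF norm_sum]) (simp add: norm_mult fejer_weight_nonneg)
  then show ?thesis
    using sum_fejer_weight[OF \<open>R < Q\<close>] by simp
qed

text \<open>Of the \<open>R + 1\<close> indices \<open>s\<close>, those missing from the count lie
  in an interval of at most \<bar>k\<bar> integers, at the lower end for \<open>k < 0\<close> and at
  the upper end for \<open>k > 0\<close>.\<close>

lemma fejer_coeff_near_one:
  assumes "\<bar>k\<bar> + int R < int Q"
  shows "cmod (fejer_coeff Q R k - 1) \<le> real_of_int \<bar>k\<bar> / real (Suc R)"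
proof -
  let ?S = "{s. s \<le> R \<and> 0 \<le> int s + k \<and> int s + k \<le> int R}"
  have "card ({..R} - ?S)
      \<le> card {nat (if k < 0 then 0 else int R - k + 1)..<nat (if k < 0 then - k else int R + 1)}"
    by (intro card_mono) (auto simp: nat_le_iff)
  also have "\<dots> \<le> nat \<bar>k\<bar>"
    by auto
  finally have "card ({..R} - ?S) \<le> nat \<bar>k\<bar>" .
  moreover have "card ({..R} - ?S) = Suc R - card ?S"
    by (subst card_Diff_subset) (auto intro: finite_subset[of _ "{..R}"])
  moreover have le: "card ?S \<le> Suc R"
    using card_mono[of "{..R}" ?S] by auto
  ultimately have bound: "real (Suc R) - real (card ?S) \<le> real_of_int \<bar>k\<bar>"
    by linarith
  have "fejer_coeff Q R k - 1 = complex_of_real ((real (card ?S) - real (Suc R)) / real (Suc R))"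
    unfolding fejer_coeff_eq[OF assms] by (simp add: diff_divide_distrib del: of_nat_Suc)
  then have "cmod (fejer_coeff Q R k - 1) = \<bar>(real (card ?S) - real (Suc R)) / real (Suc R)\<bar>"
    by (simp only: norm_of_real)
  also have "\<dots> = (real (Suc R) - real (card ?S)) / real (Suc R)"
    using le by simp
  also have "\<dots> \<le> real_of_int \<bar>k\<bar> / real (Suc R)"
    using bound by (intro divide_right_mono) simp_all
  finally show ?thesis .
qed

context cstar_algebra
begin

lemma finsum_smult_left:
  assumes "x \<in> carrier A" "finite J"
  shows "(\<Oplus>j\<in>J. c j \<odot> x) = (\<Sum>j\<in>J. c j) \<odot> x"
  using assms(2)
proof (induction J rule: finite_induct)
  case (insert j J)
  then show ?case
    using assms(1) by (simp add: smult_add_left Pi_iff)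
qed (use assms(1) in simp)

text \<open>Stated for additive maps because it is applied to \<open>fejer_mean\<close> as well as
  to star homomorphisms.\<close>

lemma additive_finsum:
  assumes "cstar_algebra B" and closed: "\<And>x. x \<in> carrier A \<Longrightarrow> h x \<in> carrier B"
    and add: "\<And>x y. \<lbrakk>x \<in> carrier A; y \<in> carrier A\<rbrakk> \<Longrightarrow> h (x \<oplus> y) = h x \<oplus>\<^bsub>B\<^esub> h y"
    and zero: "h \<zero> = \<zero>\<^bsub>B\<^esub>"
    and J: "finite J" "\<And>j. j \<in> J \<Longrightarrow> f j \<in> carrier A"
  shows "h (finsum A f J) = finsum B (\<lambda>j. h (f j)) J"
proof -
  interpret B: cstar_algebra B by fact
  show ?thesis
    using J by (induction J rule: finite_induct) (simp_all add: zero add closed Pi_iff)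
qed

end

section \<open>The gauge action and its Fejer means\<close>

context covariant_pair
begin

lemma monomial_norm_le:
  assumes "f \<in> carrier (CZp p)"
  shows "cnorm A (M f \<otimes> W k) \<le> cnorm A (M f)"
  using norm_mult[of "M f" "W k"] W_norm_le[of k] norm_nonneg[of "M f"] assms
    mult_left_mono[of "cnorm A (W k)" 1 "cnorm A (M f)"] by simp

text \<open>The scalars \<open>c\<close> and \<open>cnj c\<close> cancel in the other relations, but
  \<open>V\<^sup>n = 1\<close> would demand \<open>c\<^sup>n = 1\<close>. So the whole circle acts
  when \<open>n = 0\<close>.\<close>

lemma gauge_relations:
  assumes "n = 0" "cmod c = 1"
  shows "crossed_relations p r n A M (c \<odot> V)"
proof -
  have c: "cnj c * c = 1" "c * cnj c = 1"
    using assms(2) complex_norm_square[of c] by (simp_all add: mult.commute)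
  have "(c \<odot> V) \<otimes> M f \<otimes> (cnj c \<odot> adj A V) = (c * cnj c) \<odot> (V \<otimes> M f \<otimes> adj A V)"
    if "f \<in> carrier (CZp p)" for f
    using that by (simp add: smult_mult_left smult_mult_right mult.commute flip: smult_assoc)
  moreover have "(cnj c \<odot> adj A V) \<otimes> (c \<odot> V) = (cnj c * c) \<odot> (adj A V \<otimes> V)"
    "(c \<odot> V) \<otimes> (cnj c \<odot> adj A V) = (c * cnj c) \<odot> (V \<otimes> adj A V)"
    by (simp_all add: smult_mult_left smult_mult_right mult.commute flip: smult_assoc)
  ultimately show ?thesis
    unfolding crossed_relations_def using assms(1) M_hom
    by (simp add: adj_smult c V_isometry V_coisometry V_conj alpha_closed[OF p_pos r_unit])
qed

lemma gauge_W:
  assumes h: "star_hom A A h" "h V = cis \<theta> \<odot> V"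
  shows "h (W k) = cis (real_of_int k * \<theta>) \<odot> W k"
proof (induction k rule: int_induct[where k=0])
  case base
  show ?case
    using star_hom_one[OF h(1)] by simp
next
  case (step1 i)
  then have "h (W (i + 1)) = (cis (real_of_int i * \<theta>) * cis \<theta>) \<odot> W (i + 1)"
    by (simp add: W_add W_one star_hom_mult[OF h(1)] h(2) smult_mult_left smult_mult_right
        mult.commute flip: smult_assoc)
  then show ?case
    by (simp add: cis_mult distrib_right)
next
  case (step2 i)
  have "h (adj A V) = cis (- \<theta>) \<odot> adj A V"
    by (simp add: star_hom_adj[OF h(1)] h(2) adj_smult cis_cnj)
  then have "h (W (i - 1)) = (cis (real_of_int i * \<theta>) * cis (- \<theta>)) \<odot> W (i - 1)"
    using step2 W_add[of i "-1"]
    by (simp add: W_minus_one star_hom_mult[OF h(1)] smult_mult_left smult_mult_right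
        mult.commute flip: smult_assoc)
  then show ?case
    by (simp add: cis_mult left_diff_distrib)
qed

end

text \<open>Nothing relates \<open>gauge \<theta>\<close> for different angles, so each can be
  chosen separately from the universal property; a Fejer mean uses finitely many of them.\<close>

locale gauge_covariant_pair = covariant_pair +
  fixes gauge :: "real \<Rightarrow> 'a \<Rightarrow> 'a"
  assumes gauge_hom: "star_hom A A (gauge \<theta>)"
    and gauge_M: "f \<in> carrier (CZp p) \<Longrightarrow> gauge \<theta> (M f) = M f"
    and gauge_V: "gauge \<theta> V = cis \<theta> \<odot> V"
begin

text \<open>The integral of the gauge orbit of \<open>a\<close> against the Fejer kernel of order
  \<open>R\<close>, as a sum over the \<open>Q\<close>-th roots of unity. A monomial with exponent
  \<open>k\<close> is multiplied by \<open>fejer_coeff Q R k\<close>.\<close>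

definition fejer_mean :: "nat \<Rightarrow> nat \<Rightarrow> 'a \<Rightarrow> 'a" where
  "fejer_mean Q R a =
     (\<Oplus>j\<in>{..<Q}. complex_of_real (fejer_weight Q R j) \<odot> gauge (2 * pi * real j / real Q) a)"

lemmas gauge_closed [simp] = star_hom_closed[OF gauge_hom]

lemma fejer_mean_closed [simp]: "a \<in> carrier A \<Longrightarrow> fejer_mean Q R a \<in> carrier A"
  unfolding fejer_mean_def by (intro finsum_closed) auto

lemma fejer_mean_norm_le:
  assumes "a \<in> carrier A" "R < Q"
  shows "cnorm A (fejer_mean Q R a) \<le> cnorm A a"
proof -
  have "cnorm A (fejer_mean Q R a)
      \<le> (\<Sum>j<Q. cnorm A (complex_of_real (fejer_weight Q R j) \<odot> gauge (2 * pi * real j / real Q) a))"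
    unfolding fejer_mean_def using assms(1) by (intro norm_finsum_le) auto
  also have "\<dots> \<le> (\<Sum>j<Q. fejer_weight Q R j * cnorm A a)"
    using assms(1) star_hom_contractive[OF cstar_algebra_axioms cstar_algebra_axioms gauge_hom]
    by (intro sum_mono) (simp add: norm_smult fejer_weight_nonneg mult_left_mono)
  also have "\<dots> = cnorm A a"
    using assms(2) by (simp add: sum_fejer_weight flip: sum_distrib_right)
  finally show ?thesis .
qed

lemma fejer_mean_add:
  assumes "a \<in> carrier A" "b \<in> carrier A"
  shows "fejer_mean Q R (a \<oplus> b) = fejer_mean Q R a \<oplus> fejer_mean Q R b"
proof -
  have "fejer_mean Q R (a \<oplus> b) = (\<Oplus>j\<in>{..<Q}.
      complex_of_real (fejer_weight Q R j) \<odot> gauge (2 * pi * real j / real Q) a \<oplus>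
      complex_of_real (fejer_weight Q R j) \<odot> gauge (2 * pi * real j / real Q) b)"
    unfolding fejer_mean_def using assms
    by (intro finsum_cong') (auto simp: star_hom_add[OF gauge_hom] smult_add_right)
  then show ?thesis
    using assms by (simp add: fejer_mean_def finsum_addf Pi_iff)
qed

lemma fejer_mean_monomial:
  assumes "f \<in> carrier (CZp p)"
  shows "fejer_mean Q R (M f \<otimes> W k) = fejer_coeff Q R k \<odot> (M f \<otimes> W k)"
proof -
  have "gauge \<theta> (M f \<otimes> W k) = cis (real_of_int k * \<theta>) \<odot> (M f \<otimes> W k)" for \<theta>
    using assms gauge_W[OF gauge_hom gauge_V]
    by (simp add: star_hom_mult[OF gauge_hom] gauge_M smult_mult_right)
  then have "fejer_mean Q R (M f \<otimes> W k) = (\<Oplus>j\<in>{..<Q}. (complex_of_real (fejer_weight Q R j) *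
      cis (real_of_int k * (2 * pi * real j / real Q))) \<odot> (M f \<otimes> W k))"
    unfolding fejer_mean_def using assms by (intro finsum_cong') (auto simp: smult_assoc)
  then show ?thesis
    using assms by (simp only: finsum_smult_left m_closed M_closed W_closed finite_lessThan fejer_coeff_def)
qed

lemma fejer_mean_polynomial:
  assumes "finite J" "\<And>k. F k \<in> carrier (CZp p)"
  shows "fejer_mean Q R (\<Oplus>k\<in>J. M (F k) \<otimes> W k) = (\<Oplus>k\<in>J. fejer_coeff Q R k \<odot> (M (F k) \<otimes> W k))"
proof -
  have "gauge \<theta> \<zero> = \<zero>" for \<theta>
    using star_hom_zero[OF cstar_algebra_axioms cstar_algebra_axioms gauge_hom] .
  then have "fejer_mean Q R \<zero> = \<zero>"
    by (simp add: fejer_mean_def smult_zero_right)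
  then have "fejer_mean Q R (\<Oplus>k\<in>J. M (F k) \<otimes> W k) = (\<Oplus>k\<in>J. fejer_mean Q R (M (F k) \<otimes> W k))"
    using assms by (intro additive_finsum cstar_algebra_axioms) (auto simp: fejer_mean_add)
  also have "\<dots> = (\<Oplus>k\<in>J. fejer_coeff Q R k \<odot> (M (F k) \<otimes> W k))"
    using assms by (intro finsum_cong') (auto simp: fejer_mean_monomial)
  finally show ?thesis .
qed

end

section \<open>Injectivity from bounds on the coefficients\<close>

context covariant_pair
begin

text \<open>If \<open>h a\<close> vanishes and \<open>t\<close> is within \<open>d\<close> of
  \<open>a\<close>, then \<open>h t\<close> has norm below \<open>d\<close> by contractivity, and by
  \<open>bound\<close> so has every coefficient of \<open>t\<close>. From this the norm of
  \<open>a\<close> is shown to be arbitrarily small.\<close>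

lemma faithful_if_coefficients_bounded:
  assumes B: "cstar_algebra B" and h: "star_hom A B h"
    and gen: "cstar_generated A (insert V (M ` carrier (CZp p)))"
    and bound: "\<And>J F k. \<lbrakk>finite J; J \<subseteq> range (\<lambda>k. k mod int n); \<And>k. F k \<in> carrier (CZp p); k \<in> J\<rbrakk>
      \<Longrightarrow> cnorm A (M (F k)) \<le> cnorm B (h (\<Oplus>k\<in>J. M (F k) \<otimes> W k))"
    and gauge: "n = 0 \<Longrightarrow> \<exists>g. gauge_covariant_pair A p r n M V g"
  shows "inj_on h (carrier A)"
proof -
  interpret B: cstar_algebra B by fact
  note minus = star_hom_minus[OF cstar_algebra_axioms B h]
  have norm_image: "cnorm B (h t) < d"
    if a: "a \<in> carrier A" "h a = \<zero>\<^bsub>B\<^esub>" and t: "t \<in> carrier A" "cnorm A (a \<ominus> t) < d" for a t d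
  proof -
    have "h t = h (t \<ominus> a)"
      using a t star_hom_closed[OF h t(1)] by (simp add: minus B.minus_eq)
    then have "cnorm B (h t) \<le> cnorm A (t \<ominus> a)"
      using star_hom_contractive[OF cstar_algebra_axioms B h, of "t \<ominus> a"] a t by simp
    then show ?thesis
      using t norm_minus_commute[OF a(1) t(1)] by simp
  qed
  have small: "cnorm A a \<le> 5 * e" if a: "a \<in> carrier A" "h a = \<zero>\<^bsub>B\<^esub>" and e: "0 < e" for a e
  proof (cases "n = 0")
    case False
    \<comment> \<open>At most \<open>n\<close> monomials of norm at most \<open>d\<close>, and the
      distance from \<open>a\<close> to \<open>t\<close>, add up to \<open>e\<close>.\<close>
    define d where "d = e / real (Suc n)"
    have d: "0 < d"
      using e by (simp add: d_def)
    obtain t where t: "t \<in> span" "cnorm A (a \<ominus> t) < d"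
      using span_dense[OF gen a(1) d] by blast
    obtain J F where J: "finite J" "J \<subseteq> range (\<lambda>k. k mod int n)" "\<And>k. F k \<in> carrier (CZp p)"
      "t = (\<Oplus>k\<in>J. M (F k) \<otimes> W k)"
      using span_normal_form[OF t(1)] by blast
    have "J \<subseteq> {0..<int n}"
      using J(2) False by auto
    then have "card J \<le> n"
      using card_mono[of "{0..<int n}" J] by simp
    have "cnorm A t \<le> (\<Sum>k\<in>J. cnorm A (M (F k) \<otimes> W k))"
      unfolding J(4) using J by (intro norm_finsum_le) auto
    also have "\<dots> \<le> (\<Sum>k\<in>J. d)"
    proof (rule sum_mono)
      fix k assume "k \<in> J"
      then have "cnorm A (M (F k)) \<le> cnorm B (h t)"
        unfolding J(4) using J(1-3) by (intro bound)
      then show "cnorm A (M (F k) \<otimes> W k) \<le> d"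
        using monomial_norm_le[OF J(3), of k k] norm_image[OF a span_closed[OF t(1)] t(2)] by simp
    qed
    also have "\<dots> \<le> real n * d"
      using \<open>card J \<le> n\<close> d by (simp add: mult_right_mono)
    finally have "cnorm A a \<le> d + real n * d"
      using norm_le_minus[OF a(1) span_closed[OF t(1)]] t(2) by simp
    also have "\<dots> = e"
      by (simp add: d_def divide_simps) (simp add: algebra_simps)
    finally show ?thesis
      using e by simp
  next
    case True
    then obtain g where "gauge_covariant_pair A p r n M V g"
      using gauge by blast
    then interpret gauge_covariant_pair A p r n M V g .
    obtain t0 where t0: "t0 \<in> span" "cnorm A (a \<ominus> t0) < e"
      using span_dense[OF gen a(1) e] by blast
    obtain J0 F0 where J0: "finite J0" "\<And>k. F0 k \<in> carrier (CZp p)"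
      "t0 = (\<Oplus>k\<in>J0. M (F0 k) \<otimes> W k)"
      using span_normal_form[OF t0(1)] by blast
    \<comment> \<open>\<open>R\<close> depends on the coarse approximation \<open>t0\<close> alone,
      and is so large that the mean moves \<open>t0\<close> by less than \<open>e\<close>.\<close>
    have "\<exists>R::nat. (\<Sum>k\<in>J0. real_of_int \<bar>k\<bar> * cnorm A (M (F0 k) \<otimes> W k)) / e < real R"
      by (rule reals_Archimedean2)
    then obtain R :: nat where "(\<Sum>k\<in>J0. real_of_int \<bar>k\<bar> * cnorm A (M (F0 k) \<otimes> W k)) / e < real R"
      by blast
    then have R: "(\<Sum>k\<in>J0. real_of_int \<bar>k\<bar> * cnorm A (M (F0 k) \<otimes> W k)) < e * real (Suc R)"
      using e by (simp add: divide_less_eq algebra_simps)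
    \<comment> \<open>There are \<open>2 * R + 1\<close> exponents of absolute value at most
      \<open>R\<close>; the mean kills all others.\<close>
    define d where "d = e / real (2 * R + 1)"
    have d: "0 < d" "d \<le> e"
      using e by (simp_all add: d_def divide_le_eq mult_left_le)
    obtain t where t: "t \<in> span" "cnorm A (a \<ominus> t) < d"
      using span_dense[OF gen a(1) d(1)] by blast
    obtain J F where J: "finite J" "J \<subseteq> range (\<lambda>k. k mod int n)" "\<And>k. F k \<in> carrier (CZp p)"
      "t = (\<Oplus>k\<in>J. M (F k) \<otimes> W k)"
      using span_normal_form[OF t(1)] by blast
    \<comment> \<open>Large enough that \<open>\<bar>k\<bar> + R < Q\<close> for every exponent of
      \<open>t0\<close> and of \<open>t\<close>; it comes last because it depends on both
      polynomials.\<close>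
    define Q where "Q = Suc R + (\<Sum>k\<in>J0 \<union> J. nat \<bar>k\<bar>)"
    have Q: "R < Q"
      by (simp add: Q_def)
    have Qk: "\<bar>k\<bar> + int R < int Q" if "k \<in> J0 \<union> J" for k
    proof -
      have "nat \<bar>k\<bar> \<le> (\<Sum>k\<in>J0 \<union> J. nat \<bar>k\<bar>)"
        using member_le_sum[of k "J0 \<union> J" "\<lambda>k. nat \<bar>k\<bar>"] that J0(1) J(1) by simp
      then show ?thesis
        unfolding Q_def by linarith
    qed
    note c = a(1) span_closed[OF t0(1)] span_closed[OF t(1)]
    have mono_c: "M (F0 k) \<otimes> W k \<in> carrier A" "M (F k) \<otimes> W k \<in> carrier A" for k
      using J0(2) J(3) by simp_all
    let ?\<sigma> = "fejer_mean Q R"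
    have diff: "?\<sigma> (x \<ominus> y) = ?\<sigma> x \<ominus> ?\<sigma> y" if "x \<in> carrier A" "y \<in> carrier A" for x y
    proof -
      have "?\<sigma> (x \<ominus> y) \<oplus> ?\<sigma> y = ?\<sigma> (x \<ominus> y \<oplus> y)"
        using that by (simp add: fejer_mean_add)
      also have "x \<ominus> y \<oplus> y = x"
        using that by (simp add: a_minus_def a_assoc l_neg)
      finally show ?thesis
        using that by (metis a_minus_def a_assoc a_inv_closed fejer_mean_closed minus_closed r_neg r_zero)
    qed
    have "?\<sigma> t0 \<ominus> t0 = (\<Oplus>k\<in>J0. (fejer_coeff Q R k - 1) \<odot> (M (F0 k) \<otimes> W k))"
    proof -
      have "(\<Oplus>k\<in>J0. (fejer_coeff Q R k - 1) \<odot> (M (F0 k) \<otimes> W k)) \<oplus> t0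
          = (\<Oplus>k\<in>J0. (fejer_coeff Q R k - 1) \<odot> (M (F0 k) \<otimes> W k) \<oplus> M (F0 k) \<otimes> W k)"
        unfolding J0(3) using mono_c by (simp add: finsum_addf Pi_iff)
      also have "\<dots> = (\<Oplus>k\<in>J0. fejer_coeff Q R k \<odot> (M (F0 k) \<otimes> W k))"
        using mono_c smult_add_left[of _ "fejer_coeff Q R _ - 1" 1] by (intro finsum_cong') auto
      also have "\<dots> = ?\<sigma> t0"
        unfolding J0(3) using fejer_mean_polynomial[OF J0(1,2)] by simp
      finally show ?thesis
        using c(2) mono_c by (subst (asm) eq_commute) (simp add: a_minus_def a_assoc r_neg Pi_iff)
    qed
    then have "cnorm A (?\<sigma> t0 \<ominus> t0) \<le> (\<Sum>k\<in>J0. cnorm A ((fejer_coeff Q R k - 1) \<odot> (M (F0 k) \<otimes> W k)))"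
      using J0(1) mono_c by (simp add: norm_finsum_le)
    also have "\<dots> \<le> (\<Sum>k\<in>J0. real_of_int \<bar>k\<bar> / real (Suc R) * cnorm A (M (F0 k) \<otimes> W k))"
    proof (rule sum_mono)
      fix k assume "k \<in> J0"
      then have "cmod (fejer_coeff Q R k - 1) \<le> real_of_int \<bar>k\<bar> / real (Suc R)"
        by (intro fejer_coeff_near_one Qk) simp
      then show "cnorm A ((fejer_coeff Q R k - 1) \<odot> (M (F0 k) \<otimes> W k))
          \<le> real_of_int \<bar>k\<bar> / real (Suc R) * cnorm A (M (F0 k) \<otimes> W k)"
        unfolding norm_smult[OF mono_c(1)] using norm_nonneg[OF mono_c(1)] by (rule mult_right_mono)
    qed
    also have "\<dots> = (\<Sum>k\<in>J0. real_of_int \<bar>k\<bar> * cnorm A (M (F0 k) \<otimes> W k)) / real (Suc R)"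
      by (simp add: sum_divide_distrib)
    also have "\<dots> < e"
      using R by (simp add: divide_less_eq)
    finally have 1: "cnorm A (?\<sigma> t0 \<ominus> t0) < e" .
    have "cnorm A (?\<sigma> t) \<le> (\<Sum>k\<in>J. cnorm A (fejer_coeff Q R k \<odot> (M (F k) \<otimes> W k)))"
      unfolding J(4) fejer_mean_polynomial[OF J(1,3)] using J(1) mono_c by (intro norm_finsum_le) auto
    also have "\<dots> \<le> (\<Sum>k\<in>J. if \<bar>k\<bar> \<le> int R then d else 0)"
    proof (rule sum_mono)
      fix k assume k: "k \<in> J"
      show "cnorm A (fejer_coeff Q R k \<odot> (M (F k) \<otimes> W k)) \<le> (if \<bar>k\<bar> \<le> int R then d else 0)"
      proof (cases "\<bar>k\<bar> \<le> int R")
        case True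
        have "cnorm A (M (F k)) \<le> cnorm B (h t)"
          unfolding J(4) using J(1-3) k by (intro bound)
        then have "cnorm A (M (F k) \<otimes> W k) \<le> d"
          using monomial_norm_le[OF J(3), of k k] norm_image[OF a span_closed[OF t(1)] t(2)] by simp
        moreover have "cmod (fejer_coeff Q R k) * cnorm A (M (F k) \<otimes> W k) \<le> 1 * cnorm A (M (F k) \<otimes> W k)"
          using norm_fejer_coeff_le[OF Q] mono_c by (intro mult_right_mono norm_nonneg)
        ultimately show ?thesis
          using True mono_c by (simp add: norm_smult)
      next
        case False
        then show ?thesis
          using fejer_coeff_zero[OF Qk] k mono_c by simp
      qed
    qed
    also have "\<dots> = real (card {k \<in> J. \<bar>k\<bar> \<le> int R}) * d"
      using J(1) by (simp add: sum.If_cases Int_def)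
    also have "\<dots> \<le> real (2 * R + 1) * d"
    proof -
      have "card {k \<in> J. \<bar>k\<bar> \<le> int R} \<le> card {- int R..int R}"
        by (intro card_mono) auto
      also have "\<dots> = 2 * R + 1"
        by simp
      finally show ?thesis
        using d(1) by (intro mult_right_mono) simp_all
    qed
    also have "\<dots> = e"
      by (simp add: d_def)
    finally have 2: "cnorm A (?\<sigma> t) \<le> e" .
    have 3: "cnorm A (?\<sigma> t0 \<ominus> ?\<sigma> a) < e"
      using fejer_mean_norm_le[of "t0 \<ominus> a" R Q] Q c t0(2) norm_minus_commute[of a t0] by (simp add: diff)
    have 4: "cnorm A (?\<sigma> a \<ominus> ?\<sigma> t) < e"
      using fejer_mean_norm_le[of "a \<ominus> t" R Q] Q c t(2) d(2) by (simp add: diff)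
    \<comment> \<open>From \<open>a\<close> to 0 through \<open>t0\<close>, its mean, the mean of
      \<open>a\<close> and the mean of \<open>t\<close>, in five steps of at most \<open>e\<close>.
      The route passes through \<open>t0\<close> because the mean is known to be close to the
      identity on that polynomial, not on \<open>a\<close>.\<close>
    have "cnorm A a \<le> cnorm A (a \<ominus> t0) + (cnorm A (t0 \<ominus> ?\<sigma> t0) + (cnorm A (?\<sigma> t0 \<ominus> ?\<sigma> a)
        + (cnorm A (?\<sigma> a \<ominus> ?\<sigma> t) + cnorm A (?\<sigma> t))))"
      using norm_le_minus[of a t0] norm_le_minus[of t0 "?\<sigma> t0"] norm_le_minus[of "?\<sigma> t0" "?\<sigma> a"]
        norm_le_minus[of "?\<sigma> a" "?\<sigma> t"] c by simp
    then show ?thesis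
      using 1 2 3 4 t0(2) norm_minus_commute[of t0 "?\<sigma> t0"] c by simp
  qed
  show ?thesis
  proof (rule inj_onI)
    fix x y assume xy: "x \<in> carrier A" "y \<in> carrier A" "h x = h y"
    have zero: "h (x \<ominus> y) = \<zero>\<^bsub>B\<^esub>"
      using xy star_hom_closed[OF h xy(2)] by (simp add: minus B.minus_eq B.r_neg)
    have "cnorm A (x \<ominus> y) \<le> 0"
    proof (rule field_le_epsilon)
      fix e :: real assume "0 < e"
      then show "cnorm A (x \<ominus> y) \<le> 0 + e"
        using small[of "x \<ominus> y" "e / 5"] xy zero by simp
    qed
    then have "cnorm A (x \<ominus> y) = 0"
      using norm_nonneg[of "x \<ominus> y"] xy by simp
    then show "x = y"
      using limit_unique[of "\<lambda>_. x" x y] xy by (simp add: cstar_limit_def a_minus_def r_neg)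
  qed
qed

end

section \<open>The representation on the orbits of the sample points\<close>

lemma mult_op_apply: "\<phi> \<in> ell2 I \<Longrightarrow> mult_op I g \<phi> = (\<lambda>i. if i \<in> I then g i * \<phi> i else 0)"
  by (simp add: mult_op_def)

lemma bounded_mult_op:
  assumes "0 \<le> K" "\<And>i. i \<in> I \<Longrightarrow> cmod (g i) \<le> K"
  shows "bounded_op I (mult_op I g)"
  unfolding mult_op_def
proof (rule bounded_opI[where K=K])
  fix \<phi> assume \<phi>: "\<phi> \<in> ell2 I"
  have le: "cmod (if i \<in> I then g i * \<phi> i else 0) \<le> K * cmod (\<phi> i)" for i
    using assms by (simp add: norm_mult mult_right_mono)
  show "(\<lambda>i. if i \<in> I then g i * \<phi> i else 0) \<in> ell2 I"
    "ell2_norm I (\<lambda>i. if i \<in> I then g i * \<phi> i else 0) \<le> K * ell2_norm I \<phi>"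
    using ell2_dominated[OF \<phi> le assms(1)] by auto
qed (auto simp: algebra_simps)

lemma op_adjoint_mult_op:
  assumes "0 \<le> K" "\<And>i. i \<in> I \<Longrightarrow> cmod (g i) \<le> K"
  shows "op_adjoint I (mult_op I g) = mult_op I (\<lambda>i. cnj (g i))"
proof (rule op_adjoint_eqI)
  fix \<phi> \<psi> assume "\<phi> \<in> ell2 I" "\<psi> \<in> ell2 I"
  then show "ell2_inner I (mult_op I g \<phi>) \<psi> = ell2_inner I \<phi> (mult_op I (\<lambda>i. cnj (g i)) \<psi>)"
    unfolding ell2_inner_def by (intro infsum_cong) (simp add: mult_op_apply mult_ac)
qed (use assms in \<open>auto intro!: bounded_mult_op\<close>)

lemma pullback_op_apply: "\<phi> \<in> ell2 I \<Longrightarrow> pullback_op I s \<phi> = (\<lambda>i. if i \<in> I then \<phi> (s i) else 0)"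
  by (simp add: pullback_op_def)

lemma pullback_op:
  assumes s: "\<And>i. i \<in> I \<Longrightarrow> s i \<in> I" "\<And>i. i \<in> I \<Longrightarrow> s' i \<in> I"
    "\<And>i. i \<in> I \<Longrightarrow> s' (s i) = i" "\<And>i. i \<in> I \<Longrightarrow> s (s' i) = i"
  shows bounded_pullback_op: "bounded_op I (pullback_op I s)"
    and op_adjoint_pullback_op: "op_adjoint I (pullback_op I s) = pullback_op I s'"
proof -
  have bounded: "bounded_op I (pullback_op I s)"
    if s: "\<And>i. i \<in> I \<Longrightarrow> s i \<in> I" "\<And>i. i \<in> I \<Longrightarrow> s' i \<in> I"
      "\<And>i. i \<in> I \<Longrightarrow> s' (s i) = i" "\<And>i. i \<in> I \<Longrightarrow> s (s' i) = i" for s s'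
  proof -
    have bij: "bij_betw s I I"
      using s by (intro bij_betw_byWitness[where f'=s']) auto
    show ?thesis
      unfolding pullback_op_def
    proof (rule bounded_opI[where K=1])
      fix \<phi> assume \<phi>: "\<phi> \<in> ell2 I"
      have "(\<lambda>i. (cmod (\<phi> (s i)))\<^sup>2) summable_on I"
        using \<phi> summable_on_reindex_bij_betw[OF bij, of "\<lambda>i. (cmod (\<phi> i))\<^sup>2"] by (simp add: ell2_def)
      then show "(\<lambda>i. if i \<in> I then \<phi> (s i) else 0) \<in> ell2 I"
        by (simp add: ell2_def cong: summable_on_cong)
      have "(\<Sum>\<^sub>\<infinity>i\<in>I. (cmod (if i \<in> I then \<phi> (s i) else 0))\<^sup>2) = (\<Sum>\<^sub>\<infinity>i\<in>I. (cmod (\<phi> (s i)))\<^sup>2)"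
        by (intro infsum_cong) simp
      also have "\<dots> = (\<Sum>\<^sub>\<infinity>i\<in>I. (cmod (\<phi> i))\<^sup>2)"
        by (rule infsum_reindex_bij_betw[OF bij])
      finally show "ell2_norm I (\<lambda>i. if i \<in> I then \<phi> (s i) else 0) \<le> 1 * ell2_norm I \<phi>"
        by (simp add: ell2_norm_def)
    qed auto
  qed
  show "bounded_op I (pullback_op I s)"
    using s by (rule bounded)
  show "op_adjoint I (pullback_op I s) = pullback_op I s'"
  proof (rule op_adjoint_eqI)
    show "bounded_op I (pullback_op I s)" "bounded_op I (pullback_op I s')"
      using s bounded[of s s'] bounded[of s' s] by simp_all
    have bij: "bij_betw s' I I"
      using s by (intro bij_betw_byWitness[where f'=s]) auto
    fix \<phi> \<psi> assume \<phi>: "\<phi> \<in> ell2 I" and \<psi>: "\<psi> \<in> ell2 I"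
    have "ell2_inner I (pullback_op I s \<phi>) \<psi> = (\<Sum>\<^sub>\<infinity>i\<in>I. \<phi> (s i) * cnj (\<psi> i))"
      unfolding ell2_inner_def using \<phi> by (intro infsum_cong) (simp add: pullback_op_apply)
    also have "\<dots> = (\<Sum>\<^sub>\<infinity>i\<in>I. \<phi> (s (s' i)) * cnj (\<psi> (s' i)))"
      by (rule infsum_reindex_bij_betw[OF bij, symmetric])
    also have "\<dots> = ell2_inner I \<phi> (pullback_op I s' \<psi>)"
      unfolding ell2_inner_def using \<psi> s(4) by (intro infsum_cong) (simp add: pullback_op_apply)
    finally show "ell2_inner I (pullback_op I s \<phi>) \<psi> = ell2_inner I \<phi> (pullback_op I s' \<psi>)" .
  qed
qed

text \<open>An abstraction of the sample points: \<open>Y\<close> labels orbits under multiplication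
  by \<open>r\<close>, and \<open>k\<close> is the position along an orbit. Density is required of
  all orbits together. Both crossed products are instances, with the same \<open>Y\<close> and
  \<open>s\<close> but different \<open>n\<close>.\<close>

locale orbit_model =
  fixes p :: nat and r :: "nat \<Rightarrow> int" and n :: nat
    and Y :: "'y set" and s :: "int \<Rightarrow> 'y \<Rightarrow> nat \<Rightarrow> int"
  assumes p_pos: "0 < p" and r_unit: "r \<in> Units (Zp p)"
    and s_closed: "y \<in> Y \<Longrightarrow> s k y \<in> carrier (Zp p)"
    and s_step: "y \<in> Y \<Longrightarrow> s k y \<otimes>\<^bsub>Zp p\<^esub> inv\<^bsub>Zp p\<^esub> r = s (k - 1) y"
    and s_mod: "y \<in> Y \<Longrightarrow> s (k mod int n) y = s k y"
    and s_dense: "x \<in> carrier (Zp p) \<Longrightarrow> \<exists>k. \<exists>y\<in>Y. s k y m = x m"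
    and countable_Y: "countable Y"
begin

text \<open>The first factor is \<open>{0..<n}\<close> for positive \<open>n\<close>, and all of
  \<int> for \<open>n = 0\<close>, where \<open>k mod 0 = k\<close>.\<close>

definition I :: "(int \<times> 'y) set" where
  "I = range (\<lambda>k. k mod int n) \<times> Y"

definition m :: "((nat \<Rightarrow> int) \<Rightarrow> complex) \<Rightarrow> (int \<times> 'y \<Rightarrow> complex) \<Rightarrow> int \<times> 'y \<Rightarrow> complex" where
  "m f = mult_op I (\<lambda>(k, y). f (s k y))"

definition shift :: "int \<Rightarrow> (int \<times> 'y \<Rightarrow> complex) \<Rightarrow> int \<times> 'y \<Rightarrow> complex" where
  "shift j = pullback_op I (\<lambda>(k, y). ((k - j) mod int n, y))"

lemma I_mod: "(k, y) \<in> I \<Longrightarrow> k mod int n = k"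
  by (auto simp: I_def)

lemma I_iff: "(k mod int n, y) \<in> I \<longleftrightarrow> y \<in> Y"
  by (auto simp: I_def)

lemma I_second: "(k, y) \<in> I \<Longrightarrow> y \<in> Y"
  by (auto simp: I_def)

lemma shift_bounded: "bounded_op I (shift j)" and shift_adjoint: "op_adjoint I (shift j) = shift (- j)"
proof -
  let ?s = "\<lambda>j (k, y). ((k - j) mod int n, y)"
  have closed: "?s j i \<in> I" if "i \<in> I" for i j
    using that by (cases i) (auto simp: I_iff dest: I_second)
  have inv: "?s (- j) (?s j i) = i" if "i \<in> I" for i j
    using that I_mod by (cases i) (auto simp: mod_add_left_eq)
  show "bounded_op I (shift j)"
    unfolding shift_def using closed inv[of _ j] inv[of _ "- j"]
    by (intro bounded_pullback_op[where s'="?s (- j)"]) (simp_all only: minus_minus)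
  show "op_adjoint I (shift j) = shift (- j)"
    unfolding shift_def using closed inv[of _ j] inv[of _ "- j"]
    by (intro op_adjoint_pullback_op) (simp_all only: minus_minus)
qed

lemma shift_apply: "\<phi> \<in> ell2 I \<Longrightarrow> shift j \<phi> (k, y) = (if (k, y) \<in> I then \<phi> ((k - j) mod int n, y) else 0)"
  by (simp add: shift_def pullback_op_apply)

lemma shift_add: "shift j \<otimes>\<^bsub>bounded_ops I\<^esub> shift l = shift (j + l)"
proof (rule bounded_ops_eqI[of _ I])
  fix \<phi> and i :: "int \<times> 'y" assume \<phi>: "\<phi> \<in> ell2 I"
  obtain k y where i: "i = (k, y)"
    by fastforce
  show "(shift j \<otimes>\<^bsub>bounded_ops I\<^esub> shift l) \<phi> i = shift (j + l) \<phi> i"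
    using \<phi> bounded_op_closed[OF shift_bounded \<phi>, of l] I_second[of k y]
    by (auto simp: i bounded_ops_apply shift_apply I_iff mod_diff_left_eq diff_diff_eq)
qed (simp_all add: shift_bounded bounded_ops_closed)

lemma shift_zero: "shift 0 = \<one>\<^bsub>bounded_ops I\<^esub>"
proof (rule bounded_ops_eqI[of _ I])
  fix \<phi> and i :: "int \<times> 'y" assume \<phi>: "\<phi> \<in> ell2 I"
  obtain k y where i: "i = (k, y)"
    by fastforce
  show "shift 0 \<phi> i = \<one>\<^bsub>bounded_ops I\<^esub> \<phi> i"
    using \<phi> I_mod[of k y] by (auto simp: i bounded_ops_apply shift_apply ell2_outside)
qed (simp_all add: shift_bounded bounded_ops_closed)

lemma shift_mod: "shift (int n) = shift 0"
  by (simp add: shift_def)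

lemma shift_unit:
  assumes "(l, y) \<in> I"
  shows "shift j (ell2_unit (l, y)) (k, y) = (if (k, y) \<in> I \<and> (k - j) mod int n = l then 1 else 0)"
  using assms by (simp add: shift_apply) (simp add: ell2_unit_def)

lemma m_bound:
  assumes "f \<in> carrier (CZp p)"
  shows "\<exists>K\<ge>0. \<forall>i\<in>I. cmod ((\<lambda>(k, y). f (s k y)) i) \<le> K"
proof -
  obtain K where K: "0 \<le> K" "\<forall>x\<in>carrier (Zp p). cmod (f x) \<le> K"
    using CZp_bounded[OF assms] by blast
  then have "cmod ((\<lambda>(k, y). f (s k y)) i) \<le> K" if "i \<in> I" for i
    using that s_closed I_second by (cases i) simp
  then show ?thesis
    using K(1) by blast
qed

lemma m_bounded: "f \<in> carrier (CZp p) \<Longrightarrow> bounded_op I (m f)"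
  using m_bound[of f] bounded_mult_op[of _ I] unfolding m_def by blast

lemma m_apply:
  "\<phi> \<in> ell2 I \<Longrightarrow> m f \<phi> (k, y) = (if (k, y) \<in> I then f (s k y) * \<phi> (k, y) else 0)"
  by (simp add: m_def mult_op_apply)

lemma star_hom_m: "star_hom (CZp p) (bounded_ops I) m"
proof -
  let ?B = "bounded_ops I"
  have eqI: "S = T" if "bounded_op I S" "bounded_op I T"
    "\<And>\<phi> k y. \<phi> \<in> ell2 I \<Longrightarrow> (k, y) \<in> I \<Longrightarrow> y \<in> Y \<Longrightarrow> S \<phi> (k, y) = T \<phi> (k, y)" for S T
  proof (rule bounded_ops_eqI[of _ I])
    fix \<phi> and i :: "int \<times> 'y" assume \<phi>: "\<phi> \<in> ell2 I"
    obtain k y where i: "i = (k, y)"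
      by fastforce
    show "S \<phi> i = T \<phi> i"
    proof (cases "i \<in> I")
      case True
      then show ?thesis
        using that(3)[OF \<phi>] I_second by (simp add: i)
    qed (simp add: ell2_outside[OF bounded_op_closed[OF that(1) \<phi>]]
        ell2_outside[OF bounded_op_closed[OF that(2) \<phi>]])
  qed (use that in simp_all)
  have "m f \<in> carrier ?B" if "f \<in> carrier (CZp p)" for f
    using that by (simp add: m_bounded)
  moreover have "m (f \<otimes>\<^bsub>CZp p\<^esub> g) = m f \<otimes>\<^bsub>?B\<^esub> m g" "m (f \<oplus>\<^bsub>CZp p\<^esub> g) = m f \<oplus>\<^bsub>?B\<^esub> m g"
    if "f \<in> carrier (CZp p)" "g \<in> carrier (CZp p)" for f g
    using that bounded_op_closed[OF m_bounded]
    by (intro eqI; simp add: m_bounded bounded_ops_closed CZp_closed bounded_ops_apply m_apply CZp_apply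
        s_closed algebra_simps)+
  moreover have "m \<one>\<^bsub>CZp p\<^esub> = \<one>\<^bsub>?B\<^esub>"
    by (intro eqI) (simp_all add: m_bounded bounded_ops_closed CZp_closed bounded_ops_apply m_apply
        CZp_apply s_closed)
  moreover have "m (c \<odot>\<^bsub>CZp p\<^esub> f) = c \<odot>\<^bsub>?B\<^esub> m f" if "f \<in> carrier (CZp p)" for c f
    using that by (intro eqI) (simp_all add: m_bounded bounded_ops_closed CZp_closed bounded_ops_apply
        m_apply CZp_apply s_closed)
  moreover have "m (adj (CZp p) f) = adj ?B (m f)" if f: "f \<in> carrier (CZp p)" for f
  proof -
    have adj: "adj ?B (m f) = mult_op I (\<lambda>i. cnj ((\<lambda>(k, y). f (s k y)) i))"
      using m_bound[OF f] op_adjoint_mult_op[of _ I] unfolding m_def adj_bounded_ops by blast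
    have "bounded_op I (adj ?B (m f))"
      using m_bounded[OF f] by (simp add: op_adjoint_bounded)
    then show ?thesis
      using f unfolding adj by (intro eqI)
        (simp_all add: m_bounded CZp_closed m_apply mult_op_apply CZp_apply s_closed)
  qed
  ultimately show ?thesis
    by (simp add: star_hom_def ring_hom_def)
qed

text \<open>Conjugation by the shift replaces the sample point \<open>s k y\<close> by
  \<open>s (k - 1) y\<close>. By \<open>s_step\<close> this is the quotient of \<open>s k y\<close>
  by \<open>r\<close>, the point at which \<open>alpha p r f\<close> evaluates
  \<open>f\<close>.\<close>

lemma model_relations: "crossed_relations p r n (bounded_ops I) m (shift 1)"
proof -
  let ?B = "bounded_ops I"
  interpret B: cstar_algebra ?B
    by (rule cstar_algebra_bounded_ops)
  have pow: "shift 1 [^]\<^bsub>?B\<^esub> j = shift (int j)" for j :: nat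
    by (induction j) (simp_all add: shift_zero shift_add add.commute)
  have "shift 1 \<otimes>\<^bsub>?B\<^esub> m f \<otimes>\<^bsub>?B\<^esub> shift (-1) = m (alpha p r f)" if f: "f \<in> carrier (CZp p)" for f
  proof (rule bounded_ops_eqI[of _ I])
    have af: "alpha p r f \<in> carrier (CZp p)"
      using alpha_closed[OF p_pos r_unit f] .
    show "shift 1 \<otimes>\<^bsub>?B\<^esub> m f \<otimes>\<^bsub>?B\<^esub> shift (-1) \<in> carrier ?B" "m (alpha p r f) \<in> carrier ?B"
      using f af by (simp_all add: bounded_ops_closed shift_bounded m_bounded)
    fix \<phi> and i :: "int \<times> 'y" assume \<phi>: "\<phi> \<in> ell2 I"
    obtain k y where i: "i = (k, y)"
      by fastforce
    have \<phi>1: "shift (-1) \<phi> \<in> ell2 I"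
      using bounded_op_closed[OF shift_bounded \<phi>] .
    have \<phi>2: "m f (shift (-1) \<phi>) \<in> ell2 I"
      using bounded_op_closed[OF m_bounded[OF f] \<phi>1] .
    show "(shift 1 \<otimes>\<^bsub>?B\<^esub> m f \<otimes>\<^bsub>?B\<^esub> shift (-1)) \<phi> i = m (alpha p r f) \<phi> i"
    proof (cases "(k, y) \<in> I")
      case True
      then have y: "y \<in> Y" and k: "k mod int n = k"
        by (auto intro: I_second I_mod)
      have "((k - 1) mod int n + 1) mod int n = k"
        using k by (simp add: mod_add_left_eq)
      then have "m f (shift (-1) \<phi>) ((k - 1) mod int n, y) = f (s (k - 1) y) * \<phi> (k, y)"
        using y \<phi> \<phi>1 by (simp add: m_apply shift_apply I_iff s_mod)
      then show ?thesis
        using True y \<phi> \<phi>1 \<phi>2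
        by (simp add: i bounded_ops_apply shift_apply m_apply alpha_def s_closed s_step)
    qed (use \<phi> \<phi>1 \<phi>2 in \<open>simp add: i bounded_ops_apply shift_apply m_apply\<close>)
  qed
  then show ?thesis
    by (simp add: crossed_relations_def star_hom_m shift_bounded shift_adjoint shift_add shift_zero pow
        shift_mod)
qed

lemma representation_W:
  assumes "covariant_pair A p r n M V" "star_hom A (bounded_ops I) h" "h V = shift 1"
  shows "h (covariant_pair.W A V k) = shift k"
proof -
  interpret covariant_pair A p r n M V by fact
  interpret B: cstar_algebra "bounded_ops I"
    by (rule cstar_algebra_bounded_ops)
  show ?thesis
  proof (induction k rule: int_induct[where k=0])
    case base
    show ?case
      using star_hom_one[OF assms(2)] by (simp add: shift_zero)
  next
    case (step1 i)
    then show ?case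
      by (simp add: W_add W_one star_hom_mult[OF assms(2)] assms(3) shift_add)
  next
    case (step2 i)
    have "h (adj A V) = shift (-1)"
      using star_hom_adj[OF assms(2), of V] by (simp add: assms(3) shift_adjoint)
    then show ?case
      using step2 W_add[of i "-1"] by (simp add: W_minus_one star_hom_mult[OF assms(2)] shift_add)
  qed
qed

text \<open>The operator \<open>m (F j)\<close> followed after \<open>shift j\<close> has entries
  only where row minus column is \<open>j\<close> modulo \<open>n\<close>. Hence an entry of the
  whole sum on the \<open>k\<close>-th such diagonal is a value of \<open>F k\<close> alone, and it
  is bounded by the operator norm.\<close>

lemma coefficient_bound:
  assumes "covariant_pair A p r n M V" and h: "star_hom A (bounded_ops I) h" "h V = shift 1"
    "\<And>f. f \<in> carrier (CZp p) \<Longrightarrow> h (M f) = m f"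
    and J: "finite J" "J \<subseteq> range (\<lambda>k. k mod int n)" and F: "\<And>k. F k \<in> carrier (CZp p)" and k: "k \<in> J"
  shows "cnorm A (M (F k))
    \<le> cnorm (bounded_ops I) (h (\<Oplus>\<^bsub>A\<^esub>k\<in>J. M (F k) \<otimes>\<^bsub>A\<^esub> covariant_pair.W A V k))"
proof -
  interpret covariant_pair A p r n M V by fact
  let ?B = "bounded_ops I"
  interpret B: cstar_algebra ?B
    by (rule cstar_algebra_bounded_ops)
  let ?T = "h (\<Oplus>\<^bsub>A\<^esub>k\<in>J. M (F k) \<otimes>\<^bsub>A\<^esub> W k)"
  have T: "bounded_op I ?T"
    using star_hom_closed[OF h(1) finsum_closed, of "\<lambda>k. M (F k) \<otimes>\<^bsub>A\<^esub> W k"] F by (simp add: Pi_iff)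
  have T_eq: "?T = (\<Oplus>\<^bsub>?B\<^esub>j\<in>J. m (F j) \<otimes>\<^bsub>?B\<^esub> shift j)"
  proof -
    have "?T = (\<Oplus>\<^bsub>?B\<^esub>j\<in>J. h (M (F j) \<otimes>\<^bsub>A\<^esub> W j))"
      using J(1) F star_hom_closed[OF h(1)] star_hom_add[OF h(1)]
        star_hom_zero[OF cstar_algebra_axioms B.cstar_algebra_axioms h(1)]
      by (intro additive_finsum B.cstar_algebra_axioms) auto
    also have "\<dots> = (\<Oplus>\<^bsub>?B\<^esub>j\<in>J. m (F j) \<otimes>\<^bsub>?B\<^esub> shift j)"
      using F h(3) representation_W[OF assms(1) h(1,2)]
      by (intro B.finsum_cong') (auto simp: star_hom_mult[OF h(1)] bounded_ops_closed m_bounded shift_bounded)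
    finally show ?thesis .
  qed
  have eval: "finsum ?B g J \<phi> i = (\<Sum>j\<in>J. g j \<phi> i)"
    if "\<And>j. bounded_op I (g j)" "\<phi> \<in> ell2 I" for g \<phi> i
    using J(1)
  proof (induction J rule: finite_induct)
    case (insert j J)
    then show ?case
      using that by (simp add: Pi_iff bounded_ops_apply)
  qed (use that in \<open>simp add: bounded_ops_apply\<close>)
  have bound: "cmod (F k (s k' y)) \<le> cnorm ?B ?T" if y: "y \<in> Y" for k' y
  proof -
    \<comment> \<open>The points \<open>s k y\<close> for one fixed \<open>k\<close> need not be dense, so the column \<open>l\<close> varies with \<open>k'\<close>.\<close>
    define l where "l = (k' - k) mod int n"
    let ?e = "ell2_unit (l, y)" and ?i = "(k' mod int n, y)"
    have I: "(l, y) \<in> I" "?i \<in> I"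
      using y by (simp_all add: l_def I_iff)
    have coeff: "(m (F j) \<otimes>\<^bsub>?B\<^esub> shift j) ?e ?i = (if j = k then F k (s k' y) else 0)" if j: "j \<in> J" for j
    proof -
      have jk: "j mod int n = j" "k mod int n = k"
        using J(2) j k by auto
      \<comment> \<open>Elements of \<open>J\<close> are reduced modulo \<open>n\<close>, so
        congruent ones are equal.\<close>
      have "(k' mod int n - j) mod int n = l \<longleftrightarrow> j = k"
      proof
        assume "(k' mod int n - j) mod int n = l"
        then have "(k' - (k' - j)) mod int n = (k' - (k' - k)) mod int n"
          unfolding l_def mod_diff_left_eq by (metis mod_diff_right_eq)
        then show "j = k"
          using jk by simp
      qed (simp add: l_def mod_diff_left_eq)
      then show ?thesis
        using I bounded_op_closed[OF shift_bounded ell2_unit_closed[OF I(1)]] y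
        by (simp add: bounded_ops_apply m_apply shift_unit s_mod)
    qed
    have "?T ?e ?i = (\<Sum>j\<in>J. (m (F j) \<otimes>\<^bsub>?B\<^esub> shift j) ?e ?i)"
      unfolding T_eq using F I by (intro eval) (simp_all add: bounded_ops_closed m_bounded shift_bounded)
    also have "\<dots> = F k (s k' y)"
      using J(1) k by (simp add: coeff)
    finally have "cmod (F k (s k' y)) = cmod (?T ?e ?i)"
      by simp
    also have "\<dots> \<le> ell2_norm I (?T ?e)"
      using I by (intro cmod_le_ell2_norm bounded_op_closed[OF T]) simp
    also have "\<dots> \<le> cnorm ?B ?T * ell2_norm I ?e"
      using I by (intro cnorm_bounded_ops_bound[OF T]) simp
    finally show ?thesis
      using I by (simp add: ell2_norm_unit)
  qed
  show ?thesis
  proof (rule M_norm_le[OF F])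
    fix x assume x: "x \<in> carrier (Zp p)"
    show "cmod (F k x) \<le> cnorm ?B ?T"
    proof (rule Zp_dense_bound[OF _ _ _ _ x])
      show "continuous_on (carrier (Zp p)) (F k)"
        using F[of k] by (simp add: CZp_carrier)
      show "{s k' y | k' y. y \<in> Y} \<subseteq> carrier (Zp p)"
        using s_closed by auto
      show "\<exists>d\<in>{s k' y | k' y. y \<in> Y}. d j = x j" if "x \<in> carrier (Zp p)" for x j
        using s_dense[OF that, of j] by blast
    qed (use bound in auto)
  qed
qed

text \<open>The homomorphism supplied by \<open>univ\<close> goes into a copy of
  \<open>bounded_ops I\<close> on \<open>'a\<close>, to which the relations pass by
  \<open>crossed_relations_transfer\<close>; composing it with the inverse of \<open>j\<close> gives
  the representation.\<close>

lemma universal_faithful: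
  fixes A :: "'a cstar"
  assumes A: "cstar_algebra A" and rel: "crossed_relations p r n A M V"
    and inj: "inj_on M (carrier (CZp p))"
    and gen: "cstar_generated A (insert V (M ` carrier (CZp p)))"
    and univ: "\<And>B N W. \<lbrakk>cstar_algebra (B :: 'a cstar); crossed_relations p r n B N W\<rbrakk> \<Longrightarrow>
      \<exists>h. star_hom A B h \<and> (\<forall>f\<in>carrier (CZp p). h (M f) = N f) \<and> h V = W"
  shows "defines_faithful_rep p A M V I m (shift 1)"
proof -
  let ?B = "bounded_ops I"
  interpret covariant_pair A p r n M V
    using A p_pos r_unit rel by (simp add: covariant_pair_def covariant_pair_axioms_def)
  have B: "cstar_algebra ?B"
    by (rule cstar_algebra_bounded_ops)
  define const where "const c = M (\<lambda>x\<in>carrier (Zp p). c)" for c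
  have "inj const"
  proof (rule injI)
    fix c d assume "const c = const d"
    then have "(\<lambda>x\<in>carrier (Zp p). c) = (\<lambda>x\<in>carrier (Zp p). d)"
      unfolding const_def using inj by (auto simp: inj_on_eq_iff CZp_restrict)
    then show "c = d"
      using Zp_of_int_closed[OF p_pos, of 1] by (metis restrict_apply)
  qed
  moreover have "countable I"
    by (simp add: I_def countable_Y)
  ultimately obtain j :: "((int \<times> 'y \<Rightarrow> complex) \<Rightarrow> int \<times> 'y \<Rightarrow> complex) \<Rightarrow> 'a"
    where j: "inj_on j (carrier ?B)"
    using bounded_op_embedding by blast
  have jm: "crossed_relations p r n (transport j ?B) (j \<circ> m) (j (shift 1))"
    using crossed_relations_transfer[OF B cstar_algebra_transport[OF B j] star_hom_transport(1)[OF B j]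
        model_relations] .
  obtain h where h: "star_hom A (transport j ?B) h" "\<And>f. f \<in> carrier (CZp p) \<Longrightarrow> h (M f) = j (m f)"
    "h V = j (shift 1)"
    using univ[OF cstar_algebra_transport[OF B j] jm] by auto
  define \<pi> where "\<pi> = inv_into (carrier ?B) j \<circ> h"
  have \<pi>: "star_hom A ?B \<pi>" "\<pi> V = shift 1" "\<And>f. f \<in> carrier (CZp p) \<Longrightarrow> \<pi> (M f) = m f"
    using star_hom_comp[OF h(1) star_hom_transport(2)[OF B j]] h(2,3) j
    by (simp_all add: \<pi>_def shift_bounded m_bounded)
  have "inj_on \<pi> (carrier A)"
  proof (rule faithful_if_coefficients_bounded[OF B \<pi>(1) gen])
    fix J and F :: "int \<Rightarrow> (nat \<Rightarrow> int) \<Rightarrow> complex" and k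
    assume "finite J" "J \<subseteq> range (\<lambda>k. k mod int n)" "\<And>k. F k \<in> carrier (CZp p)" "k \<in> J"
    then show "cnorm A (M (F k)) \<le> cnorm ?B (\<pi> (\<Oplus>\<^bsub>A\<^esub>k\<in>J. M (F k) \<otimes>\<^bsub>A\<^esub> W k))"
      using coefficient_bound[OF covariant_pair_axioms \<pi>] by simp
  next
    assume n: "n = 0"
    \<comment> \<open>The universal property is applied to \<open>A\<close> itself, with
      \<open>V\<close> rotated by the angle \<theta>.\<close>
    have "\<exists>g. star_hom A A g \<and> (\<forall>f\<in>carrier (CZp p). g (M f) = M f) \<and> g V = cis \<theta> \<odot>\<^bsub>A\<^esub> V" for \<theta>
      using univ[OF A gauge_relations[OF n, of "cis \<theta>"]] by simp
    then obtain g where "\<And>\<theta>. star_hom A A (g \<theta>) \<and> (\<forall>f\<in>carrier (CZp p). g \<theta> (M f) = M f)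
        \<and> g \<theta> V = cis \<theta> \<odot>\<^bsub>A\<^esub> V"
      by metis
    then have "gauge_covariant_pair A p r n M V g"
      by unfold_locales auto
    then show "\<exists>g. gauge_covariant_pair A p r n M V g"
      by blast
  qed
  moreover have "\<rho> a = \<pi> a"
    if "star_hom A ?B \<rho>" "\<rho> V = shift 1" "\<forall>f\<in>carrier (CZp p). \<rho> (M f) = m f" "a \<in> carrier A" for \<rho> a
    by (rule star_hom_eq_on_generated[OF A B that(1) \<pi>(1) gen _ _ that(4)]) (use \<pi> that in auto)
  ultimately show ?thesis
    unfolding defines_faithful_rep_def using \<pi> by blast
qed

end

section \<open>The sample points as an orbit model\<close>

lemma units_of_nat_pow: "x [^]\<^bsub>units_of G\<^esub> (n::nat) = x [^]\<^bsub>G\<^esub> n"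
  by (induction n) (simp_all add: nat_pow_def units_of_def)

lemma root_ord_pow:
  assumes "r \<in> carrier (roots_Zp p)"
  shows "0 < root_ord p r \<and> r [^]\<^bsub>Zp p\<^esub> root_ord p r = \<one>\<^bsub>Zp p\<^esub>"
  unfolding root_ord_def by (rule LeastI_ex) (use assms in \<open>simp add: roots_Zp_carrier\<close>)

text \<open>The condition on \<open>n\<close> holds for \<open>root_ord p r\<close> and for 0, so
  one verification serves both crossed products.\<close>

lemma orbit_model_sample_points:
  assumes p: "prime p" and r: "r \<in> carrier (roots_Zp p)" and \<gamma>: "is_section p r \<gamma>"
    and n: "r [^]\<^bsub>Zp p\<^esub> n = \<one>\<^bsub>Zp p\<^esub>"
  shows "orbit_model p r n (UNIV \<times> carrier (roots_quotient p r) \<times> UNIV)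
    (\<lambda>k (L, c, x). sample_point p r \<gamma> k L c x)"
proof -
  have p0: "0 < p"
    using p by (rule prime_gt_0_nat)
  interpret Z: comm_monoid "Zp p"
    using p0 by (rule Zp_comm_monoid)
  interpret U: comm_group "units_of (Zp p)"
    by (rule Z.units_comm_group)
  have rU: "r \<in> Units (Zp p)" "r \<in> carrier (units_of (Zp p))"
    using r by (simp_all add: roots_Zp_carrier units_of_carrier)
  have pow: "r [^]\<^bsub>units_of (Zp p)\<^esub> (k::int) \<in> Units (Zp p)" for k
    using U.int_pow_closed[OF rU(2), of k] by (simp add: units_of_carrier)
  have \<gamma>c: "\<gamma> c \<in> carrier (Zp p)" if "c \<in> carrier (roots_quotient p r)" for c
    using \<gamma> that Z.Units_closed by (auto simp: is_section_def roots_Zp_carrier Pi_iff)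
  show ?thesis
  proof (unfold_locales, goal_cases)
    case (3 y k)
    then show ?case
      using sample_point_closed[OF p0 r \<gamma>] by auto
  next
    case (4 y k)
    obtain L c x where y: "y = (L, c, x)" "c \<in> carrier (roots_quotient p r)"
      using 4 by auto
    have "r [^]\<^bsub>units_of (Zp p)\<^esub> (k - 1) = r [^]\<^bsub>units_of (Zp p)\<^esub> k \<otimes>\<^bsub>Zp p\<^esub> inv\<^bsub>Zp p\<^esub> r"
      using U.int_pow_mult[OF rU(2), of k "-1"] U.int_pow_neg[OF rU(2), of 1] rU
      by (simp add: U.int_pow_1 Z.units_of_inv units_of_mult)
    then show ?case
      using y pow \<gamma>c rU Zp_of_int_closed[OF p0]
      by (simp add: sample_point_def Z.m_ac Z.Units_closed)
  next
    case (5 y k)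
    have "r [^]\<^bsub>units_of (Zp p)\<^esub> int n = \<one>\<^bsub>units_of (Zp p)\<^esub>"
      using n units_of_nat_pow[where x=r and G="Zp p" and n=n] by (simp add: int_pow_int units_of_one)
    then have "r [^]\<^bsub>units_of (Zp p)\<^esub> (int n * (k div int n)) = \<one>\<^bsub>units_of (Zp p)\<^esub>"
      using U.int_pow_pow[OF rU(2), of "int n" "k div int n"] U.int_pow_one[of "k div int n"] by simp
    then have "r [^]\<^bsub>units_of (Zp p)\<^esub> k = r [^]\<^bsub>units_of (Zp p)\<^esub> (k mod int n)"
      using U.int_pow_mult[OF rU(2), of "int n * (k div int n)" "k mod int n"] pow
      by (simp add: units_of_carrier)
    then show ?case
      by (auto simp: sample_point_def split: prod.split)
  next
    case (6 x m)
    then show ?case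
      using sample_point_approximates[OF p r \<gamma> 6, of m] by fastforce
  next
    case 7
    then show ?case
      using countable_roots_quotient[OF p, of r] by simp
  qed (use p0 rU in auto)
qed

theorem proposition6p2:
  fixes p :: nat and r :: "nat \<Rightarrow> int" and \<gamma> :: "(nat \<Rightarrow> int) set \<Rightarrow> (nat \<Rightarrow> int)"
  assumes "prime p" and "odd p"
    and "r \<in> carrier (roots_Zp p)" and "r \<noteq> \<one>\<^bsub>Zp p\<^esub>"
    and "is_section p r \<gamma>"
  shows
    "(\<forall>(A' :: 'a cstar) M V. is_crossed_product_cyclic p r A' M V \<longrightarrow>
        defines_faithful_rep p A' M V (cyclic_index p r)
          (\<lambda>f. mult_op (cyclic_index p r) (\<lambda>(k, L, c, x). f (sample_point p r \<gamma> k L c x)))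
          (pullback_op (cyclic_index p r)
             (\<lambda>(k, L, c, x). ((k - 1) mod int (root_ord p r), L, c, x)))) \<and>
     (\<forall>(A :: 'b cstar) M V. is_crossed_product_N p r A M V \<longrightarrow>
        defines_faithful_rep p A M V (N_index p r)
          (\<lambda>f. mult_op (N_index p r) (\<lambda>(k, L, c, x). f (sample_point p r \<gamma> k L c x)))
          (pullback_op (N_index p r) (\<lambda>(k, L, c, x). (k - 1, L, c, x))))"
proof (intro conjI allI impI)
  fix A' :: "'a cstar" and M V
  assume cp: "is_crossed_product_cyclic p r A' M V"
  let ?n = "root_ord p r"
  interpret orbit_model p r ?n "UNIV \<times> carrier (roots_quotient p r) \<times> UNIV"
    "\<lambda>k (L, c, x). sample_point p r \<gamma> k L c x"
    using assms(1,3,5) root_ord_pow[OF assms(3)] by (intro orbit_model_sample_points) simp_all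
  have "{0..<int ?n} = range (\<lambda>k. k mod int ?n)"
  proof (intro equalityI subsetI)
    fix k assume "k \<in> {0..<int ?n}"
    then have "k = k mod int ?n"
      by simp
    then show "k \<in> range (\<lambda>k. k mod int ?n)"
      by blast
  qed (use root_ord_pow[OF assms(3)] in auto)
  then have idx: "cyclic_index p r = I"
    by (simp add: cyclic_index_def I_def)
  have "defines_faithful_rep p A' M V I m (shift 1)"
    using cp unfolding is_crossed_product_cyclic_def universal_cstar_def cyclic_relations_eq
    by (intro universal_faithful) blast+
  then show "defines_faithful_rep p A' M V (cyclic_index p r)
      (\<lambda>f. mult_op (cyclic_index p r) (\<lambda>(k, L, c, x). f (sample_point p r \<gamma> k L c x)))
      (pullback_op (cyclic_index p r) (\<lambda>(k, L, c, x). ((k - 1) mod int ?n, L, c, x)))"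
    unfolding idx m_def[abs_def] shift_def by (simp add: case_prod_unfold)
next
  fix A :: "'b cstar" and M V
  assume cp: "is_crossed_product_N p r A M V"
  interpret orbit_model p r 0 "UNIV \<times> carrier (roots_quotient p r) \<times> UNIV"
    "\<lambda>k (L, c, x). sample_point p r \<gamma> k L c x"
    using assms(1,3,5) by (intro orbit_model_sample_points) simp_all
  have idx: "N_index p r = I"
    by (simp add: N_index_def I_def)
  have "defines_faithful_rep p A M V I m (shift 1)"
  proof (rule universal_faithful)
    show A: "cstar_algebra A"
      using cp by (simp add: is_crossed_product_N_def universal_cstar_def)
    show "crossed_relations p r 0 A M V" "inj_on M (carrier (CZp p))"
      "cstar_generated A (insert V (M ` carrier (CZp p)))"
      using cp by (simp_all add: is_crossed_product_N_def universal_cstar_def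
          flip: N_relations_iff[OF A p_pos r_unit])
    fix B :: "'b cstar" and N W
    assume "cstar_algebra B" "crossed_relations p r 0 B N W"
    then have "cstar_algebra B \<and> N_relations p r B N W"
      by (simp add: N_relations_iff p_pos r_unit)
    then show "\<exists>h. star_hom A B h \<and> (\<forall>f\<in>carrier (CZp p). h (M f) = N f) \<and> h V = W"
      using cp unfolding is_crossed_product_N_def universal_cstar_def by blast
  qed
  then show "defines_faithful_rep p A M V (N_index p r)
      (\<lambda>f. mult_op (N_index p r) (\<lambda>(k, L, c, x). f (sample_point p r \<gamma> k L c x)))
      (pullback_op (N_index p r) (\<lambda>(k, L, c, x). (k - 1, L, c, x)))"
    unfolding idx m_def[abs_def] shift_def by (simp add: case_prod_unfold)
qed

end
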